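(* Let $U$ and $V$ be open subsets of $\mathbb{R}^n$ that are $C$-bi-Lipschitz homeomorphic, let $1\le k\le n$ and $1\le p<\infty$, and let $P:B^k_p(V)\to\Omega^{k-1}_p(V)$ be an operator such that $d(P\omega)=\omega$ for all $\omega\in B^k_p(V)$ and $\|P\|\le M$. Then there exists an operator $\gamma:B^k_p(U)\to\Omega^{k-1}_p(U)$ such that $d(\gamma\omega)=\omega$ for all $\omega\in B^k_p(U)$ and $$\|\gamma\|\le M\,(n-k+1)\,C^{\frac{2(pk+n)-p}{p}}\left(\frac{n!}{(n-k+1)!}\right)^2.$$
   Context: $U$ and $V$ are $C$-bi-Lipschitz homeomorphic if there is a homeomorphism $\beta:U\to V$ such that $|\beta(x)-\beta(x')|\le C|x-x'|$ for all $x,x'\in U$ and $|\beta^{-1}(y)-\beta^{-1}(y')|\le C|y-y'|$ for all $y,y'\in V$. For an open set $W\subset\mathbb{R}^n$, $\Omega^k_p(W)$ is the Banach space of (equivalence classes of) measurable differential $k$-forms on $W$ with finite norm $\|\omega\|_{\Omega^k_p(W)}=\big(\int_W|\omega|_x^p\,dx\big)^{1/p}$, where for $\omega=\sum_j f_jdx_{j_1}\wedge\dots\wedge dx_{j_k}$ (strictly increasing multi-indices) $|\omega|_x=\big(\sum_jf_j(x)^2\big)^{1/2}$. The differential $d$ is in the sense of distributions: a $(k+1)$-form $\eta$ is $d\omega$ if $\int_W\omega\wedge d\phi=(-1)^{k+1}\int_W\eta\wedge\phi$ for every smooth compactly supported $(n-k-1)$-form $\phi$ on $W$. $\Omega^{k}_{p,p}(W)$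 is the space of $\omega\in\Omega^k_p(W)$ with $d\omega\in\Omega^{k+1}_p(W)$, and $$B^k_p(W)=\{\omega\in\Omega^k_p(W):\ \omega=d\theta\text{ for some }\theta\in\Omega^{k-1}_{p,p}(W)\},$$ equipped with the norm of $\Omega^k_p(W)$. Operators are linear and bounded, and $\|\cdot\|$ is the operator norm. *)

theory Defs
  imports "HOL-Analysis.Analysis"
begin

definition bi_lipschitz_homeomorphic ::
    "real \<Rightarrow> 'a::metric_space set \<Rightarrow> 'b::metric_space set \<Rightarrow> bool" where
  "bi_lipschitz_homeomorphic C U V \<longleftrightarrow>
     (\<exists>f g. homeomorphism U V f g \<and>
        (\<forall>x\<in>U. \<forall>x'\<in>U. dist (f x) (f x') \<le> C * dist x x') \<and>
        (\<forall>y\<in>V. \<forall>y'\<in>V. dist (g y) (g y') \<le> C * dist y y'))"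

text \<open>
  A differential form on \<open>\<real>\<^sup>n\<close> is given by its coefficients: a strictly increasing multi-index
  \<open>j\<^sub>1 < \<dots> < j\<^sub>k\<close> is the \<open>k\<close>-element set \<open>I = {j\<^sub>1, \<dots>, j\<^sub>k}\<close>, and \<open>\<omega> x $ I\<close> is the coefficient of
  \<open>dx\<^sub>I\<close> at \<open>x\<close>.  A \<open>k\<close>-form has vanishing coefficients at all sets that do not have \<open>k\<close> elements, so
  the Euclidean norm of \<open>\<omega> x\<close> is the pointwise norm of \<open>\<omega>\<close>, the square root of the sum of the
  squared coefficients over all increasing multi-indices of length \<open>k\<close>.
  Values outside the open set under consideration carry no information.
\<close>

type_synonym 'n form = "real ^ 'n \<Rightarrow> real ^ ('n set)"

definition is_form :: "(real ^ 'n) set \<Rightarrow> nat \<Rightarrow> 'n::finite form \<Rightarrow> bool" where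
  "is_form W k \<omega> \<longleftrightarrow> (\<forall>x\<in>W. \<forall>I. card I \<noteq> k \<longrightarrow> \<omega> x $ I = 0)"

text \<open>For disjoint \<open>I\<close> and \<open>J\<close>, \<open>dx\<^sub>I \<and> dx\<^sub>J\<close> is \<open>merge_sign I J\<close> times the basis form of \<open>I \<union> J\<close>.\<close>

definition merge_sign :: "'n::{finite,linorder} set \<Rightarrow> 'n set \<Rightarrow> real" where
  "merge_sign I J = (- 1) ^ card {(i, j). i \<in> I \<and> j \<in> J \<and> j < i}"

definition wedge :: "'n::{finite,linorder} form \<Rightarrow> 'n form \<Rightarrow> 'n form" where
  "wedge \<alpha> \<beta> = (\<lambda>x. \<chi> K. \<Sum>I\<in>Pow K. merge_sign I (K - I) * \<alpha> x $ I * \<beta> x $ (K - I))"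

definition partial :: "'n::finite \<Rightarrow> (real ^ 'n \<Rightarrow> 'b::real_normed_vector) \<Rightarrow> real ^ 'n \<Rightarrow> 'b" where
  "partial i f = (\<lambda>x. frechet_derivative f (at x) (axis i 1))"

text \<open>\<open>C\<^sup>\<infinity>\<close> on the whole space: all iterated partial derivatives are differentiable everywhere.\<close>

definition smooth :: "(real ^ 'n::finite \<Rightarrow> 'b::real_normed_vector) \<Rightarrow> bool" where
  "smooth f \<longleftrightarrow> (\<forall>js x. fold partial js f differentiable (at x))"

text \<open>The exterior derivative of a differentiable form,
  \<open>d(f dx\<^sub>J) = (\<Sum>i. \<partial>\<^sub>i f dx\<^sub>i \<and> dx\<^sub>J)\<close>, collected by basis forms.\<close>

definition ext_deriv :: "'n::{finite,linorder} form \<Rightarrow> 'n form" where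
  "ext_deriv \<phi> =
     (\<lambda>x. \<chi> K. \<Sum>i\<in>K. merge_sign {i} (K - {i}) * partial i \<phi> x $ (K - {i}))"

text \<open>Compactly supported forms on \<open>W\<close> are extended by zero to the whole space.\<close>

definition test_form :: "(real ^ 'n) set \<Rightarrow> nat \<Rightarrow> 'n::finite form \<Rightarrow> bool" where
  "test_form W m \<phi> \<longleftrightarrow>
     is_form UNIV m \<phi> \<and> smooth \<phi> \<and>
     compact (closure {x. \<phi> x \<noteq> 0}) \<and> closure {x. \<phi> x \<noteq> 0} \<subseteq> W"

definition form_integral :: "(real ^ 'n) set \<Rightarrow> 'n::finite form \<Rightarrow> real" where
  "form_integral W \<alpha> = (LINT x|lebesgue_on W. \<alpha> x $ UNIV)"

text \<open>\<open>weak_d W k \<omega> \<eta>\<close>: the \<open>(k + 1)\<close>-form \<open>\<eta>\<close> is the distributional differential of the \<open>k\<close>-form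
  \<open>\<omega>\<close>.  Only meant for locally integrable \<open>\<omega>\<close> and \<open>\<eta>\<close>.  Writing the degree \<open>m = n - k - 1\<close> of the
  test forms additively avoids truncated subtraction: for \<open>k = n\<close> there are no test forms.\<close>

definition weak_d :: "(real ^ 'n::{finite,linorder}) set \<Rightarrow> nat \<Rightarrow> 'n form \<Rightarrow> 'n form \<Rightarrow> bool" where
  "weak_d W k \<omega> \<eta> \<longleftrightarrow>
     (\<forall>m \<phi>. m + k + 1 = CARD('n) \<longrightarrow> test_form W m \<phi> \<longrightarrow>
        form_integral W (wedge \<omega> (ext_deriv \<phi>)) =
          (- 1) ^ (k + 1) * form_integral W (wedge \<eta> \<phi>))"

text \<open>The spaces below consist of representatives; their elements are identified if they
  agree almost everywhere, see \<open>form_eq\<close>.\<close>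

definition Omega :: "(real ^ 'n) set \<Rightarrow> nat \<Rightarrow> real \<Rightarrow> 'n::finite form set" where
  "Omega W k p =
     {\<omega>. is_form W k \<omega> \<and> \<omega> \<in> borel_measurable (lebesgue_on W) \<and>
         integrable (lebesgue_on W) (\<lambda>x. norm (\<omega> x) powr p)}"

definition Omega_norm :: "(real ^ 'n) set \<Rightarrow> real \<Rightarrow> 'n::finite form \<Rightarrow> real" where
  "Omega_norm W p \<omega> = (LINT x|lebesgue_on W. norm (\<omega> x) powr p) powr (1 / p)"

definition form_eq :: "(real ^ 'n) set \<Rightarrow> 'n::finite form \<Rightarrow> 'n form \<Rightarrow> bool" where
  "form_eq W \<omega> \<omega>' \<longleftrightarrow> (AE x in lebesgue_on W. \<omega> x = \<omega>' x)"

definition Omega_pp :: "(real ^ 'n::{finite,linorder}) set \<Rightarrow> nat \<Rightarrow> real \<Rightarrow> 'n form set" where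
  "Omega_pp W k p = {\<omega> \<in> Omega W k p. \<exists>\<eta> \<in> Omega W (k + 1) p. weak_d W k \<omega> \<eta>}"

text \<open>Only meant for \<open>k \<ge> 1\<close>.\<close>

definition B :: "(real ^ 'n::{finite,linorder}) set \<Rightarrow> nat \<Rightarrow> real \<Rightarrow> 'n form set" where
  "B W k p = {\<omega> \<in> Omega W k p. \<exists>\<theta> \<in> Omega_pp W (k - 1) p. weak_d W (k - 1) \<theta> \<omega>}"

text \<open>A bounded linear operator from \<open>B W k p\<close> to \<open>Omega W (k - 1) p\<close>, both modulo equality almost
  everywhere, is given by a map of representatives that respects this equality; linearity is
  linearity of the induced map on equivalence classes.\<close>

definition form_operator ::
    "(real ^ 'n::{finite,linorder}) set \<Rightarrow> nat \<Rightarrow> real \<Rightarrow> ('n form \<Rightarrow> 'n form) \<Rightarrow> bool" where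
  "form_operator W k p T \<longleftrightarrow>
     (\<forall>\<omega> \<in> B W k p. T \<omega> \<in> Omega W (k - 1) p) \<and>
     (\<forall>\<omega> \<in> B W k p. \<forall>\<omega>' \<in> B W k p. form_eq W \<omega> \<omega>' \<longrightarrow> form_eq W (T \<omega>) (T \<omega>')) \<and>
     (\<forall>\<omega> \<in> B W k p. \<forall>\<omega>' \<in> B W k p.
        form_eq W (T (\<lambda>x. \<omega> x + \<omega>' x)) (\<lambda>x. T \<omega> x + T \<omega>' x)) \<and>
     (\<forall>c. \<forall>\<omega> \<in> B W k p. form_eq W (T (\<lambda>x. c *\<^sub>R \<omega> x)) (\<lambda>x. c *\<^sub>R T \<omega> x)) \<and>
     (\<exists>K. \<forall>\<omega> \<in> B W k p. Omega_norm W p (T \<omega>) \<le> K * Omega_norm W p \<omega>)"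

text \<open>As for \<open>onorm\<close>, the zero form contributes the quotient \<open>0 / 0 = 0\<close>.\<close>

definition operator_norm ::
    "(real ^ 'n::{finite,linorder}) set \<Rightarrow> nat \<Rightarrow> real \<Rightarrow> ('n form \<Rightarrow> 'n form) \<Rightarrow> real" where
  "operator_norm W k p T = (SUP \<omega>\<in>B W k p. Omega_norm W p (T \<omega>) / Omega_norm W p \<omega>)"

end

theory Submission
  imports Defs
begin

text \<open>
  The operator is \<open>\<gamma> = f\<^sup>* \<circ> P \<circ> g\<^sup>*\<close>, where \<open>f : U \<rightarrow> V\<close> is the given homeomorphism and \<open>g\<close> its inverse.
  A minor of order \<open>k\<close> of a matrix with entries bounded by \<open>C\<close> is at most \<open>k! C\<^sup>k\<close>, and \<open>f\<close> distorts
  volumes by at most \<open>C\<^sup>n\<close>, so \<open>f\<^sup>*\<close> has norm at most \<open>n! / (n - k)! C\<^sup>k C\<^bsup>n/p\<^esup>\<close> on \<open>k\<close>-forms.  The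
  product of \<open>M\<close> with the bounds for \<open>f\<^sup>*\<close> on \<open>(k - 1)\<close>-forms and \<open>g\<^sup>*\<close> on \<open>k\<close>-forms is the claimed constant.

  It remains to see that pullback commutes with the weak differential and that \<open>f\<^sup>* \<circ> g\<^sup>* = id\<close>.
  The derivative of \<open>f\<close> is only needed weakly: convex combinations of difference quotients converge
  almost everywhere to a weak Jacobian, and mollifying \<open>f\<close> yields smooth maps whose Jacobians
  converge to it boundedly almost everywhere.  By the product rule and \<open>d \<circ> d = 0\<close>, the forms
  \<open>df\<^sub>i\<^sub>1 \<and> \<dots> \<and> df\<^sub>i\<^sub>k\<close> are then weakly closed, which gives \<open>d (f\<^sup>* \<theta>) = f\<^sup>* (d \<theta>)\<close> for smooth \<open>\<theta>\<close>.  A general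
  \<open>\<theta>\<close> is mollified on the side of \<open>V\<close>; the bound on volumes lets one pass to the limit, so neither
  Rademacher's theorem nor the sign of the Jacobian determinant is needed.  Pulling back the coordinate
  functions of \<open>g\<close> and using uniqueness of weak differentials gives the chain rule
  \<open>Dg (f x) Df (x) = 1\<close> almost everywhere, hence \<open>f\<^sup>* \<circ> g\<^sup>* = id\<close>.
\<close>

subsection \<open>Exterior algebra\<close>

text \<open>Elements of \<open>Omega\<close> are determined only up to null sets, while a Lipschitz
  map can send a set of positive measure to a null set. Composition with \<open>F\<close> therefore
  makes sense on equivalence classes only because its inverse on \<open>V\<close> is Lipschitz as
  well; the inequality between the integrals of \<open>h \<circ> F\<close> over \<open>U\<close> and
  of \<open>h\<close> over \<open>V\<close> carries this information. Both homeomorphisms are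
  extended to the whole space, so that mollifying them never meets a boundary. The extension is made
  coordinate by coordinate: it keeps the constant \<open>C\<close> for every single coordinate,
  hence every entry of the Jacobian is bounded by \<open>C\<close>, and this is what the estimate
  for minors consumes. The factor n!/(n - k)! is the number of increasing multi-indices of length k
  times the k! terms of a minor. In degrees k - 1 and k the two factors multiply to (n - k + 1)
  (n!/(n - k + 1)!)^2, and the powers of C add up to (k - 1) + k + 2n/p, the exponent in the
  theorem.\<close>

lemma merge_sign_Un_left:
  fixes A Q C :: "'n::{finite,linorder} set"
  assumes "A \<inter> Q = {}"
  shows "merge_sign (A \<union> Q) C = merge_sign A C * merge_sign Q C"
proof -
  have "{(i, j). i \<in> A \<union> Q \<and> j \<in> C \<and> j < i} =
      {(i, j). i \<in> A \<and> j \<in> C \<and> j < i} \<union> {(i, j). i \<in> Q \<and> j \<in> C \<and> j < i}"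
    by auto
  moreover have "{(i, j). i \<in> A \<and> j \<in> C \<and> j < i} \<inter> {(i, j). i \<in> Q \<and> j \<in> C \<and> j < i} = {}"
    using assms by auto
  ultimately show ?thesis
    by (simp add: merge_sign_def card_Un_disjoint power_add)
qed

lemma merge_sign_Un_right:
  fixes A Q C :: "'n::{finite,linorder} set"
  assumes "Q \<inter> C = {}"
  shows "merge_sign A (Q \<union> C) = merge_sign A Q * merge_sign A C"
proof -
  have "{(i, j). i \<in> A \<and> j \<in> Q \<union> C \<and> j < i} =
      {(i, j). i \<in> A \<and> j \<in> Q \<and> j < i} \<union> {(i, j). i \<in> A \<and> j \<in> C \<and> j < i}"
    by auto
  moreover have "{(i, j). i \<in> A \<and> j \<in> Q \<and> j < i} \<inter> {(i, j). i \<in> A \<and> j \<in> C \<and> j < i} = {}"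
    using assms by auto
  ultimately show ?thesis
    by (simp add: merge_sign_def card_Un_disjoint power_add)
qed

lemma merge_sign_square [simp]: "merge_sign A Q * merge_sign A Q = 1"
  by (simp add: merge_sign_def flip: power_add)

lemma merge_sign_singletons:
  "merge_sign {i} {j} = (if j < i then - 1 else (1::real))"
proof -
  have "{(i', j'). i' \<in> {i} \<and> j' \<in> {j} \<and> j' < i'} = (if j < i then {(i, j)} else {})"
    by auto
  then show ?thesis
    by (simp add: merge_sign_def)
qed

lemma merge_sign_empty_right [simp]: "merge_sign A {} = 1"
  by (simp add: merge_sign_def)

lemma merge_sign_insert_right:
  "j \<notin> I \<Longrightarrow> merge_sign {i} (insert j I) = (if j < i then - 1 else 1) * merge_sign {i} I"
  using merge_sign_Un_right[of "{j}" I "{i}"] by (simp add: merge_sign_singletons)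

lemma merge_sign_min: "\<forall>i\<in>I. j < i \<Longrightarrow> merge_sign {j} I = 1"
proof -
  assume "\<forall>i\<in>I. j < i"
  then have "{(i', j'). i' \<in> {j} \<and> j' \<in> I \<and> j' < i'} = {}"
    by auto
  then show ?thesis by (simp only: merge_sign_def) simp
qed

text \<open>Every element of \<open>I\<close> differs from \<open>i\<close>, so it contributes an
  inversion to exactly one of the two signs.\<close>

lemma merge_sign_flip:
  assumes "i \<notin> I"
  shows "merge_sign {i} I * merge_sign I {i} = (- 1) ^ card I"
proof -
  have "finite I" by simp
  then show ?thesis using assms
  proof (induction I)
    case empty
    then show ?case by (simp add: merge_sign_def)
  next
    case (insert j I)
    have "merge_sign (insert j I) {i} = merge_sign {j} {i} * merge_sign I {i}"
      using merge_sign_Un_left[of "{j}" I "{i}"] insert by simp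
    with insert show ?case
      by (auto simp: merge_sign_insert_right merge_sign_singletons)
  qed
qed

text \<open>\<open>lw u b\<close> is \<open>u \<and> b\<close> at a point, for a covector \<open>u\<close>.\<close>

definition lw :: "real ^ 'n::{finite,linorder} \<Rightarrow> real ^ ('n set) \<Rightarrow> real ^ ('n::{finite,linorder}
    set)" where
  "lw u b = (\<chi> K. \<Sum>i\<in>K. merge_sign {i} (K - {i}) * u $ i * b $ (K - {i}))"

text \<open>The pointwise counterpart of \<open>is_form\<close>; global representatives satisfy it
  at every point, not only on the open set.\<close>

definition homog :: "nat \<Rightarrow> real ^ ('n::finite set) \<Rightarrow> bool" where
  "homog k b \<longleftrightarrow> (\<forall>I. card I \<noteq> k \<longrightarrow> b $ I = 0)"

text \<open>The coefficient of the volume form in the exterior product of \<open>a\<close> and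
  \<open>b\<close>, the only coefficient that \<open>form_integral\<close> reads.\<close>

definition wedge_top :: "real ^ ('n::{finite,linorder} set) \<Rightarrow> real ^ ('n::{finite,linorder} set) \<Rightarrow>
    real" where
  "wedge_top a b = (\<Sum>I\<in>UNIV. merge_sign I (- I) * a $ I * b $ (- I))"

lemma wedge_UNIV: "wedge \<alpha> \<beta> x $ UNIV = wedge_top (\<alpha> x) (\<beta> x)"
  by (simp add: wedge_def wedge_top_def Compl_eq_Diff_UNIV)

lemma lw_add_right: "lw u (a + b) = lw u a + lw u b"
  by (simp add: lw_def vec_eq_iff algebra_simps sum.distrib)
lemma lw_add_left: "lw (u + v) a = lw u a + lw v a"
  by (simp add: lw_def vec_eq_iff algebra_simps sum.distrib)
lemma lw_scaleR_right: "lw u (c *\<^sub>R a) = c *\<^sub>R lw u a"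
  by (simp add: lw_def vec_eq_iff algebra_simps sum_distrib_left)
lemma lw_scaleR_left: "lw (c *\<^sub>R u) a = c *\<^sub>R lw u a"
  by (simp add: lw_def vec_eq_iff algebra_simps sum_distrib_left)
lemma bilinear_lw: "bilinear lw"
  unfolding bilinear_def
  by (auto intro!: linearI simp: lw_add_right lw_add_left lw_scaleR_right lw_scaleR_left)
lemma bounded_bilinear_lw: "bounded_bilinear lw"
  using bilinear_lw by (simp add: bilinear_conv_bounded_bilinear)

interpretation lw: bounded_bilinear lw by (rule bounded_bilinear_lw)

lemma bounded_bilinear_wedge_top: "bounded_bilinear wedge_top"
proof -
  have "bilinear wedge_top"
    unfolding bilinear_def
    by (auto intro!: linearI simp: wedge_top_def algebra_simps sum.distrib sum_distrib_left)
  then show ?thesis by (simp add: bilinear_conv_bounded_bilinear)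
qed

interpretation wedge_top: bounded_bilinear wedge_top by (rule bounded_bilinear_wedge_top)

text \<open>The bijection between pairs \<open>(K, i)\<close> with \<open>i \<in> K\<close> and
  pairs \<open>(I, i)\<close> with \<open>i \<notin> I\<close>, given by removing \<open>i\<close>.
  It is the reindexing behind every identity that moves a covector across a sum over sets.\<close>

lemma sum_sets_remove:
  fixes h :: "'n::finite \<Rightarrow> 'n set \<Rightarrow> 'b::comm_monoid_add"
  shows "(\<Sum>K\<in>UNIV. \<Sum>i\<in>K. h i (K - {i})) = (\<Sum>I\<in>UNIV. \<Sum>i\<in>- I. h i I)"
proof -
  have "(\<Sum>K\<in>UNIV. \<Sum>i\<in>K. h i (K - {i})) = (\<Sum>(K, i)\<in>Sigma UNIV (\<lambda>K. K). h i (K - {i}))"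
    by (rule sum.Sigma) auto
  also have "\<dots> = (\<Sum>(I, i)\<in>Sigma UNIV uminus. h i I)"
    by (rule sum.reindex_bij_witness[of _ "\<lambda>(I, i). (insert i I, i)" "\<lambda>(K, i). (K - {i}, i)"])
       auto
  also have "\<dots> = (\<Sum>I\<in>UNIV. \<Sum>i\<in>- I. h i I)"
    by (rule sum.Sigma[symmetric]) auto
  finally show ?thesis .
qed

text \<open>Removing \<open>i\<close> and \<open>j\<close> from \<open>K\<close> in either order
  leaves the same set \<open>R\<close>, and the two sign products differ only in whether
  \<open>i\<close> precedes \<open>j\<close>. The vanishing of \<open>d \<circ> d\<close> and the
  alternation of \<open>ext_pow\<close> both rest on this.\<close>

lemma lw_anticommute: "lw u (lw v b) = - lw v (lw u b)"
proof -
  have sgn: "merge_sign {i} (K - {i}) * merge_sign {j} (K - {i} - {j})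
      = - (merge_sign {j} (K - {j}) * merge_sign {i} (K - {j} - {i}))"
    if "i \<in> K" "j \<in> K" "i \<noteq> j" for i j :: 'a and K
  proof -
    define R where "R = K - {i} - {j}"
    have R: "K - {i} = insert j R" "K - {j} = insert i R" "K - {j} - {i} = R" "i \<notin> R" "j \<notin> R"
      using that by (auto simp: R_def)
    have "merge_sign {i} (K - {i}) = (if j < i then - 1 else 1) * merge_sign {i} R"
      "merge_sign {j} (K - {j}) = (if i < j then - 1 else 1) * merge_sign {j} R"
      using merge_sign_insert_right[OF R(5), of i] merge_sign_insert_right[OF R(4), of j] R(1,2)
      by simp_all
    then show ?thesis
      using that by (auto simp: R(3) R_def[symmetric])
  qed
  have "(lw u (lw v b)) $ K = - lw v (lw u b) $ K" for K
  proof -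
    define h where "h i j = merge_sign {i} (K - {i}) * merge_sign {j} (K - {i} - {j}) * u $ i *
        v $ j
          * b $ (K - {i} - {j})" for i j
    have "(lw u (lw v b)) $ K = (\<Sum>i\<in>K. \<Sum>j\<in>K - {i}. h i j)"
      by (simp add: lw_def h_def sum_distrib_left mult_ac)
    also have "\<dots> = (\<Sum>(i, j)\<in>Sigma K (\<lambda>i. K - {i}). h i j)"
      by (rule sum.Sigma) auto
    also have "\<dots> = (\<Sum>(j, i)\<in>Sigma K (\<lambda>i. K - {i}). h i j)"
      by (rule sum.reindex_bij_witness[of _ "\<lambda>(i, j). (j, i)" "\<lambda>(i, j). (j, i)"]) auto
    also have "\<dots> = (\<Sum>j\<in>K. \<Sum>i\<in>K - {j}. h i j)"
      by (rule sum.Sigma[symmetric]) auto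
    also have "\<dots> = (\<Sum>j\<in>K. \<Sum>i\<in>K - {j}. - (merge_sign {j} (K - {j}) * merge_sign {i} (K - {j} - {i})
          * v $ j * u $ i * b $ (K - {j} - {i})))"
    proof (intro sum.cong refl)
      fix j i assume "j \<in> K" "i \<in> K - {j}"
      then have "merge_sign {i} (K - {i}) * merge_sign {j} (K - {i} - {j})
        = - (merge_sign {j} (K - {j}) * merge_sign {i} (K - {j} - {i}))"
        and "K - {i} - {j} = K - {j} - {i}"
        using sgn[of i K j] by auto
      then show "h i j = - (merge_sign {j} (K - {j}) * merge_sign {i} (K - {j} - {i})
          * v $ j * u $ i * b $ (K - {j} - {i}))"
        by (simp add: h_def)
    qed
    also have "\<dots> = - lw v (lw u b) $ K"
      by (simp add: lw_def sum_distrib_left mult_ac sum_negf)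
    finally show ?thesis .
  qed
  then show ?thesis by (simp add: vec_eq_iff)
qed

lemma lw_lw_self [simp]: "lw u (lw u b) = 0"
proof -
  have "lw u (lw u b) = - lw u (lw u b)" by (rule lw_anticommute)
  then show ?thesis by (simp add: vec_eq_iff)
qed

text \<open>Moving \<open>u\<close> across the \<open>k\<close> covectors of \<open>a\<close> costs
  \<open>k\<close> sign changes, by \<open>merge_sign_flip\<close>. This is the source of the sign
  in the weak differential.\<close>

lemma wedge_top_lw:
  assumes "homog k a"
  shows "wedge_top (lw u a) b = (- 1) ^ k * wedge_top a (lw u b)"
proof -
  have "wedge_top (lw u a) b =
      (\<Sum>K\<in>UNIV. \<Sum>i\<in>K. merge_sign (insert i (K - {i})) (- insert i (K - {i})) *
        merge_sign {i} (K - {i}) * u $ i * a $ (K - {i}) * b $ (- insert i (K - {i})))"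
    by (simp add: wedge_top_def lw_def sum_distrib_left sum_distrib_right insert_absorb mult_ac)
  also have "\<dots> = (\<Sum>I\<in>UNIV. \<Sum>i\<in>- I. merge_sign (insert i I) (- insert i I) *
        merge_sign {i} I * u $ i * a $ I * b $ (- insert i I))"
    by (rule sum_sets_remove[where h = "\<lambda>i I. merge_sign (insert i I) (- insert i I) *
        merge_sign {i} I * u $ i * a $ I * b $ (- insert i I)"])
  also have "\<dots> = (\<Sum>I\<in>UNIV. \<Sum>i\<in>- I. (- 1) ^ k * (merge_sign I (- I) * a $ I *
        (merge_sign {i} (- I - {i}) * u $ i * b $ (- I - {i}))))"
  proof (intro sum.cong refl)
    fix I :: "'a set" and i assume "i \<in> - I"
    then have i: "i \<notin> I" by simp
    define R where "R = - I - {i}"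
    have R: "- insert i I = R" "- I = insert i R" "i \<notin> R"
      using i by (auto simp: R_def)
    have "merge_sign (insert i I) R = merge_sign {i} R * merge_sign I R"
      using merge_sign_Un_left[of "{i}" I R] i by simp
    moreover have "merge_sign I (insert i R) = merge_sign I {i} * merge_sign I R"
      using merge_sign_Un_right[of "{i}" R I] R(3) by simp
    moreover have "merge_sign {i} I = (- 1) ^ card I * merge_sign I {i}"
      using merge_sign_flip[OF i] merge_sign_square[of I "{i}"]
      by (metis mult.assoc mult.right_neutral)
    ultimately show "merge_sign (insert i I) (- insert i I) *
        merge_sign {i} I * u $ i * a $ I * b $ (- insert i I) =
            (- 1) ^ k * (merge_sign I (- I) * a $ I *
        (merge_sign {i} (- I - {i}) * u $ i * b $ (- I - {i})))"
      using assms R by (cases "card I = k") (auto simp: homog_def R_def[symmetric])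
  qed
  also have "\<dots> = (- 1) ^ k * wedge_top a (lw u b)"
    by (simp add: wedge_top_def lw_def sum_distrib_left)
  finally show ?thesis .
qed

text \<open>\<open>ext_pow A I\<close> is the exterior product of the rows of \<open>A\<close> with index in \<open>I\<close>, in increasing order; it
  is the pullback of \<open>dx\<^sub>I\<close> by a map with Jacobian matrix \<open>A\<close>.\<close>

definition ext_pow :: "real ^ 'n::{finite,linorder} ^ 'n::{finite,linorder} \<Rightarrow> 'n::{finite,linorder}
    set \<Rightarrow> real ^ ('n::{finite,linorder} set)" where
  "ext_pow A I = foldr (\<lambda>j b. lw (A $ j) b) (sorted_list_of_set I) (axis {} 1)"

lemma ext_pow_empty [simp]: "ext_pow A {} = axis {} 1"
  by (simp add: ext_pow_def)

lemma ext_pow_insert_min: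
  assumes "\<forall>i\<in>I. j < i"
  shows "ext_pow A (insert j I) = lw (A $ j) (ext_pow A I)"
proof -
  have "j \<notin> I" using assms by auto
  then have "sorted_list_of_set (insert j I) = insort j (sorted_list_of_set I)"
    by simp
  also have "\<dots> = j # sorted_list_of_set I"
    using assms by (intro insort_is_Cons) (auto intro: less_imp_le)
  finally show ?thesis by (simp add: ext_pow_def)
qed

text \<open>\<open>ext_pow\<close> is built by putting ever smaller indices in front. A row with a
  larger index is moved past the minimum by \<open>lw_anticommute\<close>, and the sign so produced
  is the one in \<open>merge_sign_insert_right\<close>; a repeated row gives 0.\<close>

lemma lw_ext_pow:
  "lw (A $ j) (ext_pow A I) = (if j \<in> I then 0 else merge_sign {j} I *\<^sub>R ext_pow A (insert j I))"
proof -
  have "finite I" by simp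
  then show ?thesis
  proof (induction I rule: finite_linorder_min_induct)
    case empty
    then show ?case using ext_pow_insert_min[of "{}" j A] by simp
  next
    case (insert b I)
    note b = ext_pow_insert_min[OF insert(2), of A]
    have bI: "b \<notin> I" using insert(2) by auto
    consider "j = b" | "j < b" | "b < j" by fastforce
    then show ?case
    proof cases
      case 1
      then show ?thesis by (simp add: b)
    next
      case 2
      then have *: "\<forall>i\<in>insert b I. j < i" using insert(2) by auto
      then have "j \<notin> insert b I" by auto
      then show ?thesis
        using ext_pow_insert_min[OF *, of A] merge_sign_min[OF *] by simp
    next
      case 3
      then have *: "\<forall>i\<in>insert j I. b < i" using insert(2) by auto
      have "lw (A $ j) (ext_pow A (insert b I)) = - lw (A $ b) (lw (A $ j) (ext_pow A I))"
        unfolding b by (rule lw_anticommute)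
      also have "\<dots> = (if j \<in> I then 0 else - (merge_sign {j} I *\<^sub>R ext_pow A (insert b (insert j
          I))))"
        unfolding insert.IH ext_pow_insert_min[OF *] by (simp add: lw_scaleR_right lw.zero_right)
      finally show ?thesis
        using 3 bI by (auto simp: merge_sign_insert_right insert_commute)
    qed
  qed
qed

lemma homog_axis: "homog (card I) (axis I c)"
  by (auto simp: homog_def axis_def)

lemma homog_lw: "homog k b \<Longrightarrow> homog (Suc k) (lw u b)"
  unfolding homog_def lw_def
  by (auto intro!: sum.neutral) (metis card_Suc_Diff1 finite)

lemma homog_sum: "(\<And>i. i \<in> S \<Longrightarrow> homog k (f i)) \<Longrightarrow> homog k (\<Sum>i\<in>S. f i)"
  by (auto simp: homog_def)

lemma homog_scaleR: "homog k b \<Longrightarrow> homog k (c *\<^sub>R b)"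
  by (auto simp: homog_def)

lemma homog_0 [simp]: "homog k 0"
  by (auto simp: homog_def)

lemma homog_ext_pow: "homog (card I) (ext_pow A I)"
proof -
  have "finite I" by simp
  then show ?thesis
  proof (induction I rule: finite_linorder_min_induct)
    case empty
    then show ?case using homog_axis[of "{}" 1] by simp
  next
    case (insert b I)
    then have "card (insert b I) = Suc (card I)" by (subst card_insert_disjoint) auto
    with insert show ?case
      by (simp add: ext_pow_insert_min homog_lw)
  qed
qed

section \<open>Pullback of alternating forms by a matrix\<close>

definition pull :: "real ^ 'n::{finite,linorder} ^ 'n::{finite,linorder} \<Rightarrow> real ^
    ('n::{finite,linorder} set) \<Rightarrow> real ^ ('n::{finite,linorder} set)" where
  "pull A b = (\<Sum>I\<in>UNIV. b $ I *\<^sub>R ext_pow A I)"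

lemma homog_pull: "homog k b \<Longrightarrow> homog k (pull A b)"
  unfolding pull_def
  by (intro homog_sum) (metis homog_def homog_0 homog_ext_pow homog_scaleR scaleR_zero_left)

lemma pull_add: "pull A (a + b) = pull A a + pull A b"
  by (simp add: pull_def algebra_simps sum.distrib)

lemma pull_scaleR: "pull A (c *\<^sub>R b) = c *\<^sub>R pull A b"
  by (simp add: pull_def scaleR_sum_right)

lemma pull_axis: "pull A (axis I 1) = ext_pow A I"
proof -
  have "pull A (axis I 1) = (\<Sum>J\<in>UNIV. if J = I then ext_pow A J else 0)"
    unfolding pull_def by (rule sum.cong) (auto simp: axis_def)
  then show ?thesis by simp
qed

text \<open>Pullback is multiplicative; \<open>v v* A\<close> is the pullback of the covector
  \<open>v\<close>. Expanding it in the rows of \<open>A\<close>, the terms with a repeated row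
  vanish and \<open>sum_sets_remove\<close> collects the others.\<close>

lemma pull_lw: "pull A (lw v b) = lw (v v* A) (pull A b)"
proof -
  have "v v* A = (\<Sum>j\<in>UNIV. v $ j *\<^sub>R A $ j)"
    by (simp add: vector_matrix_mult_def vec_eq_iff mult.commute)
  then have "lw (v v* A) (pull A b) =
      (\<Sum>I\<in>UNIV. \<Sum>j\<in>UNIV. (b $ I * v $ j) *\<^sub>R lw (A $ j) (ext_pow A I))"
    by (simp add: pull_def lw.sum_left lw.sum_right lw_scaleR_left lw_scaleR_right mult.commute
        scaleR_sum_right)
  also have "\<dots> = (\<Sum>I\<in>UNIV. \<Sum>j\<in>- I. (merge_sign {j} I * v $ j * b $ I) *\<^sub>R ext_pow A (insert j I))"
    by (intro sum.cong refl sum.mono_neutral_cong_right) (auto simp: lw_ext_pow mult_ac)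
  also have "\<dots> = (\<Sum>K\<in>UNIV. \<Sum>j\<in>K. (merge_sign {j} (K - {j}) * v $ j * b $ (K - {j})) *\<^sub>R
      ext_pow A (insert j (K - {j})))"
    by (rule sum_sets_remove[symmetric, where h = "\<lambda>j I. (merge_sign {j} I * v $ j * b $ I) *\<^sub>R
        ext_pow A (insert j I)"])
  also have "\<dots> = pull A (lw v b)"
    by (simp add: pull_def lw_def insert_absorb scaleR_sum_left)
  finally show ?thesis by simp
qed

lemma matrix_mult_row: "(Q ** A) $ j = (Q $ j) v* A" for A Q :: "real ^ 'n::{finite,linorder} ^
    'n::{finite,linorder}"
  by (simp add: matrix_matrix_mult_def vector_matrix_mult_def vec_eq_iff mult.commute)

lemma pull_ext_pow: "pull A (ext_pow Q I) = ext_pow (Q ** A) I"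
proof -
  have "finite I" by simp
  then show ?thesis
  proof (induction I rule: finite_linorder_min_induct)
    case empty
    then show ?case by (simp add: pull_axis)
  next
    case (insert b I)
    then show ?case
      by (simp add: ext_pow_insert_min pull_lw matrix_mult_row)
  qed
qed

text \<open>By linearity it suffices to treat basis forms, which is \<open>pull_ext_pow\<close>. The
  order is contravariant: the outer pullback belongs to the map that is applied first.\<close>

lemma pull_pull: "pull A (pull Q b) = pull (Q ** A) b"
proof -
  have "linear (pull A)"
    by (auto intro!: linearI simp: pull_add pull_scaleR)
  then show ?thesis
    unfolding pull_def[of Q] pull_def[of "Q ** A"]
    by (simp add: linear_sum linear_cmul pull_ext_pow)
qed

lemma lw_axis: "j \<notin> I \<Longrightarrow> lw (axis j 1) (axis I 1) = merge_sign {j} I *\<^sub>R axis (insert j I) 1"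
proof -
  assume j: "j \<notin> I"
  have "lw (axis j 1) (axis I 1) $ K = (merge_sign {j} I *\<^sub>R axis (insert j I) (1::real)) $ K" for K
  proof -
    have "lw (axis j 1) (axis I 1) $ K =
      (\<Sum>i\<in>K. if i = j then (if K - {j} = I then merge_sign {j} I else 0) else 0)"
      unfolding lw_def vec_lambda_beta by (rule sum.cong) (auto simp: axis_def)
    also have "\<dots> = (merge_sign {j} I *\<^sub>R axis (insert j I) (1::real)) $ K"
      using j by (auto simp: axis_def)
    finally show ?thesis .
  qed
  then show ?thesis by (simp add: vec_eq_iff)
qed

lemma ext_pow_one:
  fixes I :: "'n::{finite,linorder} set"
  shows "ext_pow (mat 1) I = axis I 1"
proof -
  have "finite I" by simp
  then show ?thesis
  proof (induction I rule: finite_linorder_min_induct)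
    case empty
    then show ?case by simp
  next
    case (insert b I)
    have "mat 1 $ b = (axis b 1 :: (real, 'n) vec)"
      by (auto simp: mat_def axis_def vec_eq_iff)
    moreover have "b \<notin> I" using insert by auto
    ultimately show ?case
      using insert by (simp add: ext_pow_insert_min lw_axis merge_sign_min)
  qed
qed

lemma pull_one: "pull (mat 1) b = b"
proof -
  have "pull (mat 1) b $ K = b $ K" for K
  proof -
    have "pull (mat 1) b $ K = (\<Sum>I\<in>UNIV. if I = K then b $ K else 0)"
      unfolding pull_def ext_pow_one sum_component by (rule sum.cong) (auto simp: axis_def)
    then show ?thesis by simp
  qed
  then show ?thesis by (simp add: vec_eq_iff)
qed

section \<open>Norm estimates for minors and pullbacks\<close>

lemma abs_merge_sign [simp]: "\<bar>merge_sign A Q\<bar> = 1"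
  by (simp add: merge_sign_def power_abs)

text \<open>Expansion of a minor along its first row. When \<open>K\<close> has the right size the
  sum has \<open>card I + 1\<close> terms, which turns the factorial into the next one; for all
  other \<open>K\<close> the coefficient vanishes by degree.\<close>

lemma ext_pow_bound:
  assumes "\<And>i j. \<bar>A $ i $ j\<bar> \<le> C"
  shows "\<bar>ext_pow A I $ K\<bar> \<le> fact (card I) * C ^ card I"
proof -
  have C: "0 \<le> C" using assms abs_ge_zero order_trans by blast
  have "finite I" by simp
  then show ?thesis
  proof (induction I arbitrary: K rule: finite_linorder_min_induct)
    case empty
    then show ?case by (simp add: axis_def)
  next
    case (insert b I)
    have bI: "b \<notin> I" using insert by auto
    show ?case
    proof (cases "card K = Suc (card I)")
      case True
      have "\<bar>ext_pow A (insert b I) $ K\<bar> \<le>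
          (\<Sum>i\<in>K. \<bar>merge_sign {i} (K - {i}) * A $ b $ i * ext_pow A I $ (K - {i})\<bar>)"
        using insert by (simp add: ext_pow_insert_min lw_def)
      also have "\<dots> \<le> (\<Sum>i\<in>K. C * (fact (card I) * C ^ card I))"
        by (intro sum_mono) (simp add: abs_mult mult_mono assms insert C)
      also have "\<dots> = fact (card (insert b I)) * C ^ card (insert b I)"
        using bI True by (simp add: algebra_simps)
      finally show ?thesis .
    next
      case False
      then have "ext_pow A (insert b I) $ K = 0"
        using homog_ext_pow[of "insert b I" A] bI by (simp add: homog_def)
      then show ?thesis using C by simp
    qed
  qed
qed

text \<open>Cauchy-Schwarz over the multi-indices of length \<open>k\<close> bounds each component,
  and as many components enter the norm of the result. Each of the two sums contributes the square
  root of the binomial coefficient, so the bound is that coefficient times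
  \<open>fact k * C ^ k\<close>.\<close>

lemma norm_pull:
  fixes A :: "real ^ 'n::{finite,linorder} ^ 'n::{finite,linorder}"
  assumes A: "\<And>i j. \<bar>A $ i $ j\<bar> \<le> C" and b: "homog k b" and k: "k \<le> CARD('n)"
  shows "norm (pull A b) \<le> fact CARD('n) / fact (CARD('n) - k) * C ^ k * norm b"
proof -
  have C: "0 \<le> C" using A abs_ge_zero order_trans by blast
  define S where "S = {I :: 'n set. card I = k}"
  have card_S: "card S = CARD('n) choose k"
    using n_subsets[of "UNIV :: 'n set" k] by (simp add: S_def)
  define D where "D = fact k * C ^ k"
  have D: "0 \<le> D" using C by (simp add: D_def)
  have norm_S: "(norm a)\<^sup>2 = (\<Sum>I\<in>S. (a $ I)\<^sup>2)" if "homog k a" for a :: "real ^ 'n set"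
  proof -
    have "(norm a)\<^sup>2 = (\<Sum>I\<in>UNIV. (a $ I)\<^sup>2)"
      by (simp add: norm_vec_def L2_set_def sum_nonneg)
    also have "\<dots> = (\<Sum>I\<in>S. (a $ I)\<^sup>2)"
      using that by (intro sum.mono_neutral_right) (auto simp: S_def homog_def)
    finally show ?thesis .
  qed
  have comp: "(pull A b $ K)\<^sup>2 \<le> real (card S) * D\<^sup>2 * (norm b)\<^sup>2" for K
  proof -
    have "pull A b $ K = (\<Sum>I\<in>S. b $ I * ext_pow A I $ K)"
      unfolding pull_def sum_component
      using b by (intro sum.mono_neutral_cong_right) (auto simp: S_def homog_def)
    then have "(pull A b $ K)\<^sup>2 \<le> (\<Sum>I\<in>S. (b $ I)\<^sup>2) * (\<Sum>I\<in>S. (ext_pow A I $ K)\<^sup>2)"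
      using Cauchy_Schwarz_ineq_sum[of "\<lambda>I. b $ I" "\<lambda>I. ext_pow A I $ K" S] by simp
    also have "\<dots> \<le> (norm b)\<^sup>2 * (\<Sum>I\<in>S. D\<^sup>2)"
    proof (intro mult_mono sum_mono)
      fix I assume "I \<in> S"
      then have "\<bar>ext_pow A I $ K\<bar> \<le> D"
        using ext_pow_bound[OF A, of I K] by (simp add: S_def D_def)
      then show "(ext_pow A I $ K)\<^sup>2 \<le> D\<^sup>2"
        by (metis abs_ge_zero power2_abs power_mono)
    qed (auto simp: norm_S[OF b] sum_nonneg)
    finally show ?thesis by (simp add: mult_ac)
  qed
  have "(norm (pull A b))\<^sup>2 \<le> (\<Sum>K\<in>S. real (card S) * D\<^sup>2 * (norm b)\<^sup>2)"
    unfolding norm_S[OF homog_pull[OF b]] by (intro sum_mono comp)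
  also have "\<dots> = (real (card S) * D * norm b)\<^sup>2"
    by (simp add: power_mult_distrib power2_eq_square)
  finally have "norm (pull A b) \<le> real (card S) * D * norm b"
    by (rule power2_le_imp_le) (simp add: D)
  also have "real (card S) * D = fact CARD('n) / fact (CARD('n) - k) * C ^ k"
    using k by (simp add: card_S D_def binomial_fact)
  finally show ?thesis .
qed

subsection \<open>Smooth functions\<close>

lemma partial_eqI: "(f has_derivative f') (at x) \<Longrightarrow> partial i f x = f' (axis i 1)"
  by (simp add: partial_def frechet_derivative_at[symmetric])

text \<open>A set of differentiable functions that is stable under \<open>partial\<close> certifies
  smoothness of its members; the closure properties below only exhibit such a set.\<close>

lemma smooth_coinduct:
  assumes "f \<in> S"
    and "\<And>g x. g \<in> S \<Longrightarrow> g differentiable (at x)"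
    and "\<And>g i. g \<in> S \<Longrightarrow> partial i g \<in> S"
  shows "smooth f"
proof -
  have "fold partial js g \<in> S" if "g \<in> S" for js g
    using that by (induction js arbitrary: g) (auto simp: assms(3))
  then show ?thesis
    using assms by (auto simp: smooth_def)
qed

lemma smooth_differentiable: "smooth f \<Longrightarrow> f differentiable (at x)"
  unfolding smooth_def by (metis fold_simps(1))

lemma smooth_partial: "smooth f \<Longrightarrow> smooth (partial i f)"
  unfolding smooth_def by (metis fold_simps(2))

lemma smooth_continuous_on: "smooth f \<Longrightarrow> continuous_on S f"
  by (meson continuous_at_imp_continuous_on differentiable_imp_continuous_within
      smooth_differentiable)

lemma differentiable_has_derivative_partial:
  assumes "f differentiable (at x)"
  shows "(f has_derivative (\<lambda>h. \<Sum>i\<in>UNIV. h $ i *\<^sub>R partial i f x)) (at x)"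
proof -
  let ?D = "frechet_derivative f (at x)"
  have D: "(f has_derivative ?D) (at x)"
    using assms by (simp add: frechet_derivative_works)
  then have lin: "linear ?D" by (rule has_derivative_linear)
  have "?D h = (\<Sum>i\<in>UNIV. h $ i *\<^sub>R partial i f x)" for h
  proof -
    have "h = (\<Sum>i\<in>UNIV. h $ i *\<^sub>R axis i 1)"
      by (metis basis_expansion scalar_mult_eq_scaleR)
    then have "?D h = ?D (\<Sum>i\<in>UNIV. h $ i *\<^sub>R axis i 1)" by simp
    then show ?thesis
      by (simp add: linear_sum[OF lin] linear_cmul[OF lin] partial_def)
  qed
  then show ?thesis using D by presburger
qed

lemmas smooth_has_derivative = differentiable_has_derivative_partial[OF smooth_differentiable]

lemma partial_add:
  "f differentiable (at x) \<Longrightarrow> g differentiable (at x) \<Longrightarrow>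
    partial i (\<lambda>x. f x + g x) x = partial i f x + partial i g x"
  using partial_eqI[OF has_derivative_add[OF differentiable_has_derivative_partial
    differentiable_has_derivative_partial], of f x g i]
  by (simp add: axis_def if_distrib[of "\<lambda>c. c *\<^sub>R _"] cong: if_cong)

text \<open>Product and chain rule turn one term into a sum of terms of the same shape. Coinduction
  up to finite sums allows the certifying set to contain the single terms only.\<close>

inductive_set sum_closure :: "('a \<Rightarrow> 'b::real_normed_vector) set \<Rightarrow> ('a \<Rightarrow> 'b) set" for S where
  zero: "(\<lambda>x. 0) \<in> sum_closure S"
| base: "f \<in> S \<Longrightarrow> f \<in> sum_closure S"
| add: "f \<in> sum_closure S \<Longrightarrow> g \<in> sum_closure S \<Longrightarrow> (\<lambda>x. f x + g x) \<in> sum_closure S"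

lemma sum_closure_sum:
  "finite I \<Longrightarrow> (\<And>i. i \<in> I \<Longrightarrow> f i \<in> sum_closure S) \<Longrightarrow> (\<lambda>x. \<Sum>i\<in>I. f i x) \<in> sum_closure S"
  by (induction I rule: finite_induct) (auto intro: sum_closure.intros)

lemma smooth_coinduct_sum:
  fixes f :: "real ^ 'n \<Rightarrow> 'b::real_normed_vector"
  assumes "f \<in> sum_closure S"
    and diff: "\<And>g x. g \<in> S \<Longrightarrow> g differentiable (at x)"
    and part: "\<And>g i. g \<in> S \<Longrightarrow> partial i g \<in> sum_closure S"
  shows "smooth f"
  using assms(1)
proof (rule smooth_coinduct)
  show D: "g differentiable (at x)" if "g \<in> sum_closure S" for g x
    using that by induction (auto intro: diff)
  show "partial i g \<in> sum_closure S" if "g \<in> sum_closure S" for g i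
    using that
  proof induction
    case zero
    have "partial i (\<lambda>x::real ^ 'n. 0::'b) = (\<lambda>x. 0)"
      by (rule ext) (simp add: partial_eqI[OF has_derivative_const])
    then show ?case by (simp add: sum_closure.zero)
  next
    case (base f)
    then show ?case by (rule part)
  next
    case (add f g)
    have "partial i (\<lambda>x. f x + g x) = (\<lambda>x. partial i f x + partial i g x)"
      using D[OF add.hyps(1)] D[OF add.hyps(2)] by (simp add: partial_add fun_eq_iff)
    with add.IH show ?case by (simp add: sum_closure.add)
  qed
qed

lemma smooth_const [simp]: "smooth (\<lambda>x. c)"
proof (rule smooth_coinduct[of _ "range (\<lambda>c x. c)"])
  fix g :: "real ^ 'a \<Rightarrow> 'b" and i assume "g \<in> range (\<lambda>c x. c)"
  then obtain c where g: "g = (\<lambda>x. c)" by auto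
  have "partial i g = (\<lambda>x. 0)"
    unfolding g by (rule ext) (simp add: partial_eqI[OF has_derivative_const])
  then show "partial i g \<in> range (\<lambda>c x. c)" by auto
qed auto

lemma partial_bounded_linear:
  assumes "bounded_linear L" and "f differentiable (at x)"
  shows "partial i (\<lambda>x. L (f x)) x = L (partial i f x)"
  by (rule partial_eqI[THEN trans, OF bounded_linear.has_derivative[OF assms(1)
    differentiable_has_derivative_partial[OF assms(2)]]])
    (simp add: axis_def if_distrib[of "\<lambda>c. c *\<^sub>R _"] cong: if_cong)

lemma smooth_bounded_linear:
  fixes f :: "real ^ 'n \<Rightarrow> 'b::real_normed_vector" and L :: "'b \<Rightarrow> 'c::real_normed_vector"
  assumes L: "bounded_linear L" and f: "smooth f"
  shows "smooth (\<lambda>x. L (f x))"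
proof (rule smooth_coinduct[of _ "{\<lambda>x. L (f x) | f. smooth f}"])
  show "(\<lambda>x. L (f x)) \<in> {\<lambda>x. L (f x) | f. smooth f}" using f by auto
next
  fix g :: "real ^ 'n \<Rightarrow> 'c" and x i assume "g \<in> {\<lambda>x. L (f x) | f. smooth f}"
  then obtain f where g: "g = (\<lambda>x. L (f x))" and f: "smooth f" by auto
  have "(\<lambda>x. L (f x)) differentiable (at x)" for x
    using bounded_linear.has_derivative[OF L smooth_has_derivative[OF f]]
    unfolding differentiable_def by blast
  then show "g differentiable (at x)" by (simp add: g)
  have "partial i g = (\<lambda>x. L (partial i f x))"
    unfolding g by (rule ext) (intro partial_bounded_linear L smooth_differentiable f)
  then show "partial i g \<in> {\<lambda>x. L (f x) | f. smooth f}"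
    using smooth_partial[OF f] by auto
qed

lemma smooth_sum:
  assumes "\<And>i. i \<in> I \<Longrightarrow> smooth (f i)" "finite I"
  shows "smooth (\<lambda>x. \<Sum>i\<in>I. f i x)"
  by (rule smooth_coinduct_sum[of _ "Collect smooth"])
    (auto intro: smooth_differentiable smooth_partial sum_closure_sum sum_closure.base assms)

lemma smooth_add: "smooth f \<Longrightarrow> smooth g \<Longrightarrow> smooth (\<lambda>x. f x + g x)"
  by (rule smooth_coinduct_sum[of _ "Collect smooth"])
    (auto intro: smooth_differentiable smooth_partial sum_closure.intros)

lemma partial_bilinear:
  assumes b: "bounded_bilinear prd"
    and f: "f differentiable (at x)" and g: "g differentiable (at x)"
  shows "partial i (\<lambda>x. prd (f x) (g x)) x = prd (f x) (partial i g x) + prd (partial i f x) (g x)"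
  by (rule partial_eqI[THEN trans, OF bounded_bilinear.FDERIV[OF b
        f[THEN differentiable_has_derivative_partial] g[THEN
            differentiable_has_derivative_partial]]])
    (simp add: axis_def if_distrib[of "\<lambda>c. c *\<^sub>R _"] cong: if_cong)

lemma smooth_bilinear:
  fixes f :: "real ^ 'n \<Rightarrow> 'b::real_normed_vector" and g :: "real ^ 'n \<Rightarrow> 'c::real_normed_vector"
    and prd :: "'b \<Rightarrow> 'c \<Rightarrow> 'd::real_normed_vector"
  assumes b: "bounded_bilinear prd" and "smooth f" "smooth g"
  shows "smooth (\<lambda>x. prd (f x) (g x))"
proof (rule smooth_coinduct_sum[of _ "{\<lambda>x. prd (f x) (g x) | f g. smooth f \<and> smooth g}"])
  show "(\<lambda>x. prd (f x) (g x)) \<in> sum_closure {\<lambda>x. prd (f x) (g x) | f g. smooth f \<and> smooth g}"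
    using assms by (auto intro: sum_closure.base)
next
  fix h :: "real ^ 'n \<Rightarrow> 'd" and x i
  assume "h \<in> {\<lambda>x. prd (f x) (g x) | f g. smooth f \<and> smooth g}"
  then obtain f g where h: "h = (\<lambda>x. prd (f x) (g x))" and fg: "smooth f" "smooth g" by auto
  note d = smooth_has_derivative[OF fg(1)] smooth_has_derivative[OF fg(2)]
  show "h differentiable (at x)"
    unfolding h using bounded_bilinear.FDERIV[OF b d] differentiable_def by blast
  have "partial i h = (\<lambda>x. prd (f x) (partial i g x) + prd (partial i f x) (g x))"
    unfolding h by (rule ext) (intro partial_bilinear b smooth_differentiable fg)
  then show "partial i h \<in> sum_closure {\<lambda>x. prd (f x) (g x) | f g. smooth f \<and> smooth g}"
    using fg by (auto intro!: sum_closure.add intro: sum_closure.base smooth_partial)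
qed

lemmas smooth_scaleR = smooth_bilinear[OF bounded_bilinear_scaleR]
lemmas smooth_mult = smooth_bilinear[OF bounded_bilinear_mult]

lemma smooth_id: "smooth (\<lambda>x::real ^ 'n::finite. x)"
proof (rule smooth_coinduct[of _ "insert (\<lambda>x. x) (range (\<lambda>c x. c))"])
  fix g :: "real ^ 'n \<Rightarrow> real ^ 'n" and i assume "g \<in> insert (\<lambda>x. x) (range (\<lambda>c x. c))"
  moreover have "partial i (\<lambda>x::real ^ 'n. x) = (\<lambda>x. axis i 1)"
    by (rule ext) (simp add: partial_eqI[OF has_derivative_ident])
  moreover have "partial i (\<lambda>x::real ^ 'n. c::real ^ 'n) = (\<lambda>x. 0)" for c
    by (rule ext) (simp add: partial_eqI[OF has_derivative_const])
  ultimately show "partial i g \<in> insert (\<lambda>x. x) (range (\<lambda>c x. c))"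
    by auto
qed auto

lemma smooth_compose:
  fixes F :: "real ^ 'm \<Rightarrow> real ^ 'n" and a :: "real ^ 'n \<Rightarrow> 'b::real_normed_vector"
  assumes F: "smooth F" and a: "smooth a"
  shows "smooth (\<lambda>x. a (F x))"
    and "partial i (\<lambda>x. a (F x)) x = (\<Sum>j\<in>UNIV. partial i F x $ j *\<^sub>R partial j a (F x))"
proof -
  have d: "((\<lambda>x. a (F x)) has_derivative
     (\<lambda>h. \<Sum>j\<in>UNIV. (\<Sum>i\<in>UNIV. h $ i *\<^sub>R partial i F x) $ j *\<^sub>R partial j a (F x))) (at x)"
    if "smooth a" for x and a :: "real ^ 'n \<Rightarrow> 'b"
    using has_derivative_compose[OF smooth_has_derivative[OF F] smooth_has_derivative[OF that]] .
  have p: "partial i (\<lambda>x. a (F x)) x = (\<Sum>j\<in>UNIV. partial i F x $ j *\<^sub>R partial j a (F x))"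
    if "smooth a" for i x and a :: "real ^ 'n \<Rightarrow> 'b"
    by (rule partial_eqI[THEN trans, OF d[OF that]])
      (simp add: axis_def if_distrib[of "\<lambda>c. c * _"] cong: if_cong)
  from p[OF a] show "partial i (\<lambda>x. a (F x)) x = (\<Sum>j\<in>UNIV. partial i F x $ j *\<^sub>R partial j a (F
      x))" .
  have Fj: "smooth (\<lambda>x. F x $ j)" for j
    by (rule smooth_bounded_linear[OF bounded_linear_vec_nth F])
  have pFj: "partial i (\<lambda>x. F x $ j) x = partial i F x $ j" for i j x
    by (rule partial_bounded_linear[OF bounded_linear_vec_nth smooth_differentiable[OF F]])
  \<comment> \<open>Differentiating \<open>a \<circ> F\<close> produces derivatives of
    \<open>F\<close> as coefficients; the factor \<open>c\<close> absorbs them, and this makes the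
    set stable up to sums.\<close>
  define S where "S = {\<lambda>x. c x *\<^sub>R a (F x) | c a. smooth (c :: real ^ 'm \<Rightarrow> real) \<and>
      smooth (a :: real ^ 'n \<Rightarrow> 'b)}"
  show "smooth (\<lambda>x. a (F x))"
  proof (rule smooth_coinduct_sum[of _ S])
    have "(\<lambda>x. (1::real) *\<^sub>R a (F x)) \<in> S"
      unfolding S_def using a by (intro CollectI exI[of _ "\<lambda>x. 1"] exI[of _ a]) auto
    then show "(\<lambda>x. a (F x)) \<in> sum_closure S"
      by (auto intro: sum_closure.base)
  next
    fix g :: "real ^ 'm \<Rightarrow> 'b" and x i assume "g \<in> S"
    then obtain c :: "real ^ 'm \<Rightarrow> real" and a :: "real ^ 'n \<Rightarrow> 'b"
      where g: "g = (\<lambda>x. c x *\<^sub>R a (F x))" and ca: "smooth c" "smooth a"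
      by (auto simp: S_def)
    have da: "(\<lambda>x. a (F x)) differentiable (at x)" for x
      using d[OF ca(2)] differentiable_def by blast
    show "g differentiable (at x)"
      unfolding g by (intro differentiable_scaleR smooth_differentiable ca da)
    have "partial i g = (\<lambda>x. (\<Sum>j\<in>UNIV. (c x * partial i F x $ j) *\<^sub>R partial j a (F x))
        + partial i c x *\<^sub>R a (F x))"
      unfolding g
      by (rule ext) (simp add: partial_bilinear[OF bounded_bilinear_scaleR smooth_differentiable[OF
          ca(1)] da]
          p[OF ca(2)] scaleR_sum_right)
    moreover have "(\<lambda>x. (c x * partial i F x $ j) *\<^sub>R partial j a (F x)) \<in> S" for j
    proof -
      have "smooth (\<lambda>x. c x * partial i F x $ j)"
        by (intro smooth_mult ca smooth_bounded_linear[OF bounded_linear_vec_nth] smooth_partial F)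
      then show ?thesis
        unfolding S_def by (intro CollectI exI[of _ "\<lambda>x. c x *
            partial i F x $ j"] exI[of _ "partial j a"])
          (auto intro: smooth_partial ca)
    qed
    moreover have "(\<lambda>x. partial i c x *\<^sub>R a (F x)) \<in> S"
      unfolding S_def using ca smooth_partial by blast
    ultimately show "partial i g \<in> sum_closure S"
      by (auto intro!: sum_closure.add sum_closure_sum intro: sum_closure.base)
  qed
qed

lemma smooth_reflect:
  fixes a :: "real ^ 'n \<Rightarrow> 'b::real_normed_vector"
  assumes "smooth a"
  shows "smooth (\<lambda>z. a (y - z))" and "partial i (\<lambda>z. a (y - z)) z = - partial i a (y - z)"
proof -
  have d: "((\<lambda>z. y - z) has_derivative (\<lambda>h. - h)) (at z)" for z :: "real ^ 'n"
    by (auto intro!: derivative_eq_intros)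
  have "bounded_linear (\<lambda>z::real ^ 'n. - z)" by (simp add: bounded_linear_minus
      bounded_linear_ident)
  then have F: "smooth (\<lambda>z::real ^ 'n. y - z)"
    using smooth_add[OF smooth_const smooth_bounded_linear[OF _ smooth_id], of "\<lambda>z. - z" y] by simp
  show "smooth (\<lambda>z. a (y - z))" by (rule smooth_compose(1)[OF F assms])
  show "partial i (\<lambda>z. a (y - z)) z = - partial i a (y - z)"
    using smooth_compose(2)[OF F assms, of i z] partial_eqI[OF d]
    by (simp add: axis_def if_distrib[of "\<lambda>c. c *\<^sub>R _"] sum_negf cong: if_cong)
qed

lemma line_has_derivative_partial:
  fixes f :: "real ^ 'n \<Rightarrow> real"
  assumes "smooth f"
  shows "((\<lambda>t. f (y + t *\<^sub>R axis i 1)) has_real_derivative partial i f (y + t *\<^sub>R axis i 1)) (at t)"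
proof -
  have "((\<lambda>t. y + t *\<^sub>R axis i 1) has_derivative (\<lambda>h. h *\<^sub>R axis i 1)) (at t)"
    by (auto intro!: derivative_eq_intros)
  from has_derivative_compose[OF this smooth_has_derivative[OF assms]]
  have "((\<lambda>t. f (y + t *\<^sub>R axis i 1)) has_derivative
      (\<lambda>h. \<Sum>j\<in>UNIV. (h *\<^sub>R axis i 1) $ j *\<^sub>R partial j f (y + t *\<^sub>R axis i 1))) (at t)" .
  moreover have "(\<lambda>h::real. \<Sum>j\<in>UNIV. (h *\<^sub>R axis i 1) $ j *\<^sub>R partial j f (y + t *\<^sub>R axis i 1)) =
      (*) (partial i f (y + t *\<^sub>R axis i 1))"
    by (rule ext) (simp add: axis_def if_distrib[of "\<lambda>c. _ * c * _"] mult.commute cong: if_cong)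
  ultimately show ?thesis
    by (simp add: has_field_derivative_def)
qed

text \<open>The second difference \<Delta> is symmetric in \<open>i\<close> and \<open>j\<close>.
  Two applications of the mean value theorem identify it with \<open>h * h\<close> times either
  mixed derivative at points that converge to \<open>x\<close>.\<close>

lemma smooth_partial_commute_real:
  fixes f :: "real ^ 'n \<Rightarrow> real"
  assumes f: "smooth f"
  shows "partial i (partial j f) x = partial j (partial i f) x"
proof -
  let ?e = "\<lambda>i. axis i (1::real) :: real ^ 'n"
  define \<Delta> where "\<Delta> i j h = f (x + h *\<^sub>R ?e i + h *\<^sub>R ?e j) - f (x + h *\<^sub>R ?e i) - f (x +
      h *\<^sub>R ?e j) + f x"
    for i j h
  have mv: "\<exists>p. dist p x \<le> 2 * h \<and> \<Delta> i j h = h * h * partial j (partial i f) p" if h: "h > 0"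
      for i j h
  proof -
    have "\<exists>\<xi>>0. \<xi> < h \<and> (f (x + h *\<^sub>R ?e j + h *\<^sub>R ?e i) - f (x + h *\<^sub>R ?e i)) -
        (f (x + h *\<^sub>R ?e j + 0 *\<^sub>R ?e i) - f (x + 0 *\<^sub>R ?e i)) = (h - 0) *
        (partial i f (x + h *\<^sub>R ?e j + \<xi> *\<^sub>R ?e i) - partial i f (x + \<xi> *\<^sub>R ?e i))"
      by (rule MVT2[OF h]) (intro derivative_intros line_has_derivative_partial f)
    then obtain \<xi> where \<xi>: "\<xi> > 0" "\<xi> < h" "\<Delta> i j h =
        h * (partial i f (x + h *\<^sub>R ?e j + \<xi> *\<^sub>R ?e i) - partial i f (x + \<xi> *\<^sub>R ?e i))"
      by (auto simp: \<Delta>_def algebra_simps)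
    have "\<exists>\<eta>>0. \<eta> < h \<and> partial i f (x + \<xi> *\<^sub>R ?e i + h *\<^sub>R ?e j) - partial i f (x + \<xi> *\<^sub>R ?e i +
        0 *\<^sub>R ?e j)
      = (h - 0) * partial j (partial i f) (x + \<xi> *\<^sub>R ?e i + \<eta> *\<^sub>R ?e j)"
      by (rule MVT2[OF h]) (intro line_has_derivative_partial smooth_partial f)
    then obtain \<eta> where \<eta>: "\<eta> > 0" "\<eta> < h" "partial i f (x + \<xi> *\<^sub>R ?e i +
        h *\<^sub>R ?e j) - partial i f (x + \<xi> *\<^sub>R ?e i)
      = h * partial j (partial i f) (x + \<xi> *\<^sub>R ?e i + \<eta> *\<^sub>R ?e j)"
      by auto
    have "norm (\<xi> *\<^sub>R ?e i + \<eta> *\<^sub>R ?e j) \<le> norm (\<xi> *\<^sub>R ?e i) + norm (\<eta> *\<^sub>R ?e j)"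
      by (rule norm_triangle_ineq)
    then have "dist (x + \<xi> *\<^sub>R ?e i + \<eta> *\<^sub>R ?e j) x \<le> 2 * h"
      using \<xi> \<eta> by (simp add: dist_norm add.assoc)
    then show ?thesis
      using \<xi>(3) \<eta>(3) by (intro exI[of _ "x + \<xi> *\<^sub>R ?e i + \<eta> *\<^sub>R ?e j"]) (simp add: algebra_simps)
  qed
  define h where "h n = inverse (real (Suc n))" for n
  have h: "h n > 0" "h \<longlonglongrightarrow> 0" for n
    using LIMSEQ_inverse_real_of_nat by (simp_all add: h_def[abs_def])
  from mv[OF h(1)] obtain p where p: "\<And>n i j. dist (p n i j) x \<le> 2 * h n"
    "\<And>n i j. \<Delta> i j (h n) = h n * h n * partial j (partial i f) (p n i j)" by metis
  have px: "(\<lambda>n. p n i j) \<longlonglongrightarrow> x" for i j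
  proof (rule metric_tendsto_imp_tendsto[of "\<lambda>n. 2 * h n" 0])
    show "(\<lambda>n. 2 * h n) \<longlonglongrightarrow> 0" using tendsto_mult_right_zero[OF h(2)] by simp
    show "\<forall>\<^sub>F n in sequentially. dist (p n i j) x \<le> dist (2 * h n) 0"
      using p(1) h(1) by (auto simp: abs_of_pos)
  qed
  have "continuous_on UNIV (partial j (partial i f))" for i j
    by (intro smooth_continuous_on smooth_partial f)
  then have lim: "(\<lambda>n. partial j (partial i f) (p n i j)) \<longlonglongrightarrow> partial j (partial i f) x" for i j
    by (rule continuous_on_tendsto_compose[of UNIV]) (auto intro: px)
  have "\<Delta> i j = \<Delta> j i"
    by (rule ext) (simp add: \<Delta>_def algebra_simps)
  then have "partial j (partial i f) (p n i j) = partial i (partial j f) (p n j i)" for n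
    using p(2)[where n = n and i = i and j = j] p(2)[where n = n and i = j and j = i] h(1)[of n]
        by simp
  then show ?thesis
    using LIMSEQ_unique[OF lim[of j i]] lim[of i j] by simp
qed

lemma smooth_partial_commute:
  fixes f :: "real ^ 'n \<Rightarrow> real ^ 'm"
  assumes f: "smooth f"
  shows "partial i (partial j f) x = partial j (partial i f) x"
proof -
  have *: "partial i (\<lambda>x. g x $ k) = (\<lambda>x. partial i g x $ k)"
    if "smooth g" for i k and g :: "real ^ 'n \<Rightarrow> real ^ 'm"
    by (rule ext) (intro partial_bounded_linear[OF bounded_linear_vec_nth] smooth_differentiable
        that)
  have "partial i (partial j f) x $ k = partial j (partial i f) x $ k" for k
    using smooth_partial_commute_real[OF smooth_bounded_linear[OF bounded_linear_vec_nth f], of i j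
        k x]
    by (simp add: * f smooth_partial)
  then show ?thesis by (simp add: vec_eq_iff)
qed

subsection \<open>Mollifiers\<close>

text \<open>The powers in the denominator make the family closed under differentiation: a derivative
  is a combination of the members with index \<open>k + 1\<close> and \<open>k + 2\<close>.\<close>

definition exp_inv :: "nat \<Rightarrow> real \<Rightarrow> real" where
  "exp_inv k t = (if t > 0 then exp (- 1 / t) / t ^ k else 0)"

lemma power_div_fact_le_exp: "0 \<le> y \<Longrightarrow> y ^ n / fact n \<le> exp (y::real)"
proof -
  assume y: "0 \<le> y"
  have "(\<Sum>m\<in>{n}. y ^ m /\<^sub>R fact m) \<le> (\<Sum>m. y ^ m /\<^sub>R fact m)"
    by (rule sum_le_suminf) (use y summable_exp[of y] in auto)
  also have "\<dots> = exp y" by (simp add: exp_def)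
  finally show ?thesis by (simp add: divide_inverse mult.commute)
qed

text \<open>One term of the exponential series at \<open>1 / t\<close> beats the pole of order
  \<open>k\<close> with two powers to spare. The quadratic bound is what forces the derivative at 0
  to vanish.\<close>

lemma exp_inv_bound: "\<bar>exp_inv k t\<bar> \<le> fact (k + 2) * t\<^sup>2"
proof (cases "t > 0")
  case True
  have "(1 / t) ^ (k + 2) / fact (k + 2) \<le> exp (1 / t)"
    by (rule power_div_fact_le_exp) (use True in auto)
  then have "exp (- 1 / t) \<le> fact (k + 2) * t ^ (k + 2)"
    using True by (simp add: exp_minus field_simps power_add power2_eq_square del: fact_Suc)
  then have "exp (- 1 / t) / t ^ k \<le> fact (k + 2) * t ^ 2"
    using True by (simp add: field_simps power_add power2_eq_square del: fact_Suc)
  then show ?thesis using True by (simp add: exp_inv_def del: fact_Suc)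
next
  case False
  then show ?thesis by (simp add: exp_inv_def)
qed

lemma exp_inv_has_derivative:
  "(exp_inv k has_real_derivative (- real k * exp_inv (k + 1) t + exp_inv (k + 2) t)) (at t)"
proof -
  consider "t > 0" | "t < 0" | "t = 0" by linarith
  then show ?thesis
  proof cases
    case 1
    have "((\<lambda>t. exp (- 1 / t)) has_real_derivative exp (- 1 / t) / t\<^sup>2) (at t)"
      using 1 by (auto intro!: derivative_eq_intros simp: power2_eq_square)
    moreover have "((\<lambda>t. inverse t ^ k) has_real_derivative - real k / t ^ (k + 1)) (at t)"
    proof (cases k)
      case (Suc m)
      have "((\<lambda>t. inverse t ^ Suc m) has_real_derivative
          real (Suc m) * (- (inverse t ^ Suc (Suc 0)) * inverse t ^ (Suc m - Suc 0))) (at t)"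
        by (rule DERIV_power[OF DERIV_inverse]) (use 1 in simp)
      moreover have "real (Suc m) * (- (inverse t ^ Suc (Suc 0)) * inverse t ^ (Suc m - Suc 0)) =
          - real (Suc m) / t ^ (Suc m + 1)"
        using 1 by (simp add: field_simps)
      ultimately show ?thesis unfolding Suc by simp
    qed simp
    ultimately have "((\<lambda>t. exp (- 1 / t) * inverse t ^ k) has_real_derivative
        exp (- 1 / t) * (- real k / t ^ (k + 1)) + exp (- 1 / t) / t\<^sup>2 * inverse t ^ k) (at t)"
      by (rule DERIV_mult')
    moreover have "exp (- 1 / t) * (- real k / t ^ (k + 1)) + exp (- 1 / t) / t\<^sup>2 * inverse t ^ k =
        - real k * exp_inv (k + 1) t + exp_inv (k + 2) t"
      using 1 by (simp add: exp_inv_def divide_inverse power_inverse power_add power2_eq_square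
          mult_ac)
    ultimately have "((\<lambda>t. exp (- 1 / t) * inverse t ^ k) has_real_derivative
        - real k * exp_inv (k + 1) t + exp_inv (k + 2) t) (at t)"
      by simp
    then show ?thesis
      by (rule has_field_derivative_transform_within_open[where S = "{0<..}"])
        (use 1 in \<open>auto simp: exp_inv_def divide_inverse power_inverse\<close>)
  next
    case 2
    have "((\<lambda>t. 0) has_real_derivative (- real k * exp_inv (k + 1) t + exp_inv (k + 2) t)) (at t)"
      using 2 by (auto simp: exp_inv_def)
    then show ?thesis
      by (rule has_field_derivative_transform_within_open[where S = "{..<0}"])
        (use 2 in \<open>auto simp: exp_inv_def\<close>)
  next
    case 3
    have "((\<lambda>h. (exp_inv k (0 + h) - exp_inv k 0) / h) \<longlongrightarrow> 0) (at 0)"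
    proof (rule Lim_null_comparison[where g = "\<lambda>h. fact (k + 2) * \<bar>h\<bar>"])
      have "norm ((exp_inv k (0 + h) - exp_inv k 0) / h) \<le> fact (k + 2) * \<bar>h\<bar>" if "h \<noteq> 0" for h
      proof -
        have "\<bar>exp_inv k h\<bar> / \<bar>h\<bar> \<le> (fact (k + 2) * h\<^sup>2) / \<bar>h\<bar>"
          by (intro divide_right_mono exp_inv_bound) simp
        also have "\<dots> = fact (k + 2) * \<bar>h\<bar>"
          using that by (cases "h > 0") (simp_all add: power2_eq_square del: fact_Suc)
        finally show ?thesis by (simp add: exp_inv_def[of k 0] del: fact_Suc)
      qed
      then show "\<forall>\<^sub>F h in at 0. norm ((exp_inv k (0 + h) - exp_inv k 0) / h) \<le> fact (k + 2) * \<bar>h\<bar>"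
        by (auto simp: eventually_at_filter)
      show "((\<lambda>h. fact (k + 2) * \<bar>h\<bar>) \<longlongrightarrow> (0::real)) (at 0)"
        by (intro tendsto_eq_intros refl) auto
    qed
    then show ?thesis using 3 by (simp add: DERIV_def exp_inv_def)
  qed
qed

lemma smooth_exp_inv:
  fixes q :: "real ^ 'n \<Rightarrow> real"
  assumes q: "smooth q"
  shows "smooth (\<lambda>x. exp_inv k (q x))"
proof -
  define S where "S = {\<lambda>x. c x * exp_inv k (q x) | c k. smooth c}"
  have d: "((\<lambda>x. exp_inv k (q x)) has_derivative (\<lambda>h. (\<Sum>i\<in>UNIV. h $ i *\<^sub>R partial i q x) *
      (- real k * exp_inv (k + 1) (q x) + exp_inv (k + 2) (q x)))) (at x)" for x k
    using DERIV_compose_FDERIV[OF exp_inv_has_derivative smooth_has_derivative[OF q]] .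
  have p: "partial i (\<lambda>x. exp_inv k (q x)) x = partial i q x *
     (- real k * exp_inv (k + 1) (q x) + exp_inv (k + 2) (q x))" for x k i
    using partial_eqI[OF d, where i = i and x = x]
    by (simp add: axis_def if_distrib[of "\<lambda>c. c * _"] cong: if_cong)
  show ?thesis
  proof (rule smooth_coinduct_sum[of _ S])
    have "(\<lambda>x. (\<lambda>x. 1) x * exp_inv k (q x)) \<in> S"
      unfolding S_def by (intro CollectI exI[of _ "\<lambda>x. 1"] exI[of _ k] conjI smooth_const) simp
    then show "(\<lambda>x. exp_inv k (q x)) \<in> sum_closure S"
      by (auto intro: sum_closure.base)
  next
    fix g x i assume "g \<in> S"
    then obtain c k where g: "g = (\<lambda>x. c x * exp_inv k (q x))" and c: "smooth c"
      by (auto simp: S_def)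
    have dd: "(\<lambda>x. exp_inv k (q x)) differentiable (at x)" for x
      using d differentiable_def by blast
    show "g differentiable (at x)"
      unfolding g by (intro differentiable_mult smooth_differentiable c dd)
    have "partial i g = (\<lambda>x. ((c x * partial i q x) * (- real k)) * exp_inv (k + 1) (q x) +
        ((c x * partial i q x) * exp_inv (k + 2) (q x) + partial i c x * exp_inv k (q x)))"
      unfolding g
      by (rule ext) (simp add: partial_bilinear[OF bounded_bilinear_mult smooth_differentiable[OF
          c] dd]
          p algebra_simps)
    moreover have m: "(\<lambda>x. b x * exp_inv k (q x)) \<in> sum_closure S" if "smooth b" for b k
      unfolding S_def using that by (intro sum_closure.base) blast
    have "(\<lambda>x. ((c x * partial i q x) * (- real k)) * exp_inv (k + 1) (q x) +
        ((c x * partial i q x) * exp_inv (k + 2) (q x) + partial i c x *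
            exp_inv k (q x))) \<in> sum_closure S"
      by (intro sum_closure.add m smooth_mult smooth_const smooth_partial c q)
    ultimately show "partial i g \<in> sum_closure S"
      by (simp only:)
  qed
qed

lemma smooth_quadratic: "smooth (\<lambda>x::real ^ 'n::finite. c - x \<bullet> x)"
  using smooth_add[OF smooth_const smooth_bounded_linear[OF bounded_linear_minus[OF
      bounded_linear_ident]
      smooth_bilinear[OF bounded_bilinear_inner smooth_id smooth_id]], of c]
  by simp

definition mollifier :: "real \<Rightarrow> (real ^ 'n::finite \<Rightarrow> real) \<Rightarrow> bool" where
  "mollifier r \<rho> \<longleftrightarrow> smooth \<rho> \<and> (\<forall>x. 0 \<le> \<rho> x) \<and> (\<forall>x. r \<le> norm x \<longrightarrow> \<rho> x = 0) \<and>
     integrable lborel \<rho> \<and> (LINT x|lborel. \<rho> x) = 1"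

lemma integrable_continuous_compact_support:
  fixes f :: "'a::euclidean_space \<Rightarrow> 'b::euclidean_space"
  assumes "continuous_on UNIV f" and "compact K" and "\<And>x. x \<notin> K \<Longrightarrow> f x = 0"
  shows "integrable lborel f"
proof -
  have "integrable lborel (\<lambda>x. indicator K x *\<^sub>R f x)"
    using assms by (intro borel_integrable_compact) (auto intro: continuous_on_subset)
  also have "(\<lambda>x. indicator K x *\<^sub>R f x) = f"
    using assms(3) by (auto simp: indicator_def)
  finally show ?thesis .
qed

text \<open>The kernel is the bump exp (- 1 / (r^2 - |x|^2)) divided by its integral, which is
  positive because the bump is positive on a ball of positive measure.\<close>

lemma mollifier_exists:
  assumes r: "0 < r"
  obtains \<rho> :: "real ^ 'n::finite \<Rightarrow> real" where "mollifier r \<rho>"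
proof -
  define \<sigma> where "\<sigma> x = exp_inv 0 (r\<^sup>2 - x \<bullet> x)" for x :: "real ^ 'n"
  have sm: "smooth \<sigma>"
    unfolding \<sigma>_def by (intro smooth_exp_inv smooth_quadratic)
  have "(norm x)\<^sup>2 < r\<^sup>2 \<longleftrightarrow> norm x < r" for x :: "real ^ 'n"
    using r power2_less_imp_less[of "norm x" r] power_strict_mono[of "norm x" r 2] by auto
  then have pos: "0 < \<sigma> x \<longleftrightarrow> norm x < r" and nn: "0 \<le> \<sigma> x" for x
    by (simp_all add: \<sigma>_def exp_inv_def power2_norm_eq_inner)
  then have z: "\<sigma> x = 0" if "r \<le> norm x" for x
    using that by (metis less_le not_less)
  have int: "integrable lborel \<sigma>"
    by (rule integrable_continuous_compact_support[where K = "cball 0 r"])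
      (auto intro: smooth_continuous_on sm z)
  have "(LINT x|lborel. \<sigma> x) \<noteq> 0"
  proof
    assume "(LINT x|lborel. \<sigma> x) = 0"
    then have "AE x in lborel. \<sigma> x = 0"
      using integral_nonneg_eq_0_iff_AE[OF int] nn by auto
    then have "AE x in lborel. x \<notin> ball (0::real ^ 'n) r"
      by eventually_elim (metis pos less_irrefl mem_ball_0)
    then have "emeasure lborel (ball (0::real ^ 'n) r) = 0"
      by (subst (asm) AE_iff_measurable[OF _ refl]) (auto simp: ball_def)
    then show False
      using r unit_ball_vol_pos[of "real CARD('n)"] by (simp add: emeasure_ball)
  qed
  moreover have "0 \<le> (LINT x|lborel. \<sigma> x)" using nn by simp
  ultimately have I: "0 < (LINT x|lborel. \<sigma> x)" by simp
  have "smooth (\<lambda>x. (1 / (LINT x|lborel. \<sigma> x)) * \<sigma> x)"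
    by (intro smooth_mult smooth_const sm)
  then have "mollifier r (\<lambda>x. (1 / (LINT x|lborel. \<sigma> x)) * \<sigma> x)"
    unfolding mollifier_def using I int nn z by simp
  then show thesis by (rule that)
qed

subsection \<open>Continuity of translations in the mean\<close>

lemma nn_integral_lborel_translate:
  fixes h :: "'a::euclidean_space \<Rightarrow> ennreal"
  assumes [measurable]: "h \<in> borel_measurable borel"
  shows "(\<integral>\<^sup>+x. h (x - w) \<partial>lborel) = (\<integral>\<^sup>+x. h x \<partial>lborel)"
proof -
  have "(\<integral>\<^sup>+x. h x \<partial>lborel) = (\<integral>\<^sup>+x. h x \<partial>distr lborel borel ((+) (- w)))"
    by (simp add: lborel_distr_plus)
  also have "\<dots> = (\<integral>\<^sup>+x. h (x - w) \<partial>lborel)"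
    by (subst nn_integral_distr) simp_all
  finally show ?thesis by simp
qed

lemma lborel_distr_reflect:
  fixes y :: "'a::euclidean_space"
  shows "distr lborel borel (\<lambda>z. y - z) = lborel"
proof -
  show ?thesis
    using lborel_affine[of "- 1" y] by (simp add: density_1)
qed

lemma integral_lborel_reflect:
  fixes h :: "'a::euclidean_space \<Rightarrow> 'b::euclidean_space"
  assumes [measurable]: "h \<in> borel_measurable borel"
  shows "(LINT z|lborel. h (y - z)) = (LINT z|lborel. h z)"
proof -
  have "(LINT z|lborel. h z) = (LINT z|distr lborel borel (\<lambda>z. y - z). h z)"
    by (simp add: lborel_distr_reflect)
  also have "\<dots> = (LINT z|lborel. h (y - z))"
    by (rule integral_distr) simp_all
  finally show ?thesis by simp
qed

definition translation_defect :: "('a::euclidean_space \<Rightarrow> 'b::euclidean_space) \<Rightarrow> 'a \<Rightarrow> ennreal" where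
  "translation_defect f w = (\<integral>\<^sup>+x. ennreal (norm (f (x - w) - f x)) \<partial>lborel)"

definition translation_continuous :: "('a::euclidean_space \<Rightarrow> 'b::euclidean_space) \<Rightarrow> bool" where
  "translation_continuous f \<longleftrightarrow> (\<forall>\<epsilon>>0. \<exists>\<delta>>0. \<forall>w. norm w < \<delta> \<longrightarrow> translation_defect f w \<le> ennreal \<epsilon>)"

text \<open>Triangle inequality through \<open>g\<close>. Translation preserves the mean distance of
  \<open>f\<close> and \<open>g\<close>, which is therefore paid twice.\<close>

lemma translation_defect_approx:
  assumes [measurable]: "f \<in> borel_measurable borel" "g \<in> borel_measurable borel"
  shows "translation_defect f w \<le> translation_defect g w + 2 *
      (\<integral>\<^sup>+x. ennreal (norm (g x - f x)) \<partial>lborel)"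
proof -
  have "translation_defect f w \<le> (\<integral>\<^sup>+x. ennreal (norm (g (x - w) - g x)) + 
      (ennreal (norm (g (x - w) - f (x - w))) + ennreal (norm (g x - f x))) \<partial>lborel)"
    unfolding translation_defect_def
  proof (rule nn_integral_mono)
    fix x
    have "norm (f (x - w) - f x) = norm ((g (x - w) - g x) - (g (x - w) - f (x - w)) + (g x - f x))"
      by simp
    also have "\<dots> \<le> norm (g (x - w) - g x) + (norm (g (x - w) - f (x - w)) + norm (g x - f x))"
      by norm
    finally show "ennreal (norm (f (x - w) - f x)) \<le> ennreal (norm (g (x - w) - g x)) + 
      (ennreal (norm (g (x - w) - f (x - w))) + ennreal (norm (g x - f x)))"
      by (simp add: ennreal_plus[symmetric] del: ennreal_plus)
  qed
  also have "\<dots> = translation_defect g w + ((\<integral>\<^sup>+x. ennreal (norm (g (x - w) - f (x - w))) \<partial>lborel)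
      + (\<integral>\<^sup>+x. ennreal (norm (g x - f x)) \<partial>lborel))"
    unfolding translation_defect_def by (subst nn_integral_add, simp, simp)+ simp
  also have "(\<integral>\<^sup>+x. ennreal (norm (g (x - w) - f (x - w))) \<partial>lborel) =
      (\<integral>\<^sup>+x. ennreal (norm (g x - f x)) \<partial>lborel)"
    by (rule nn_integral_lborel_translate[where h = "\<lambda>x. ennreal (norm (g x - f x))"]) simp
  finally show ?thesis by (simp add: mult_2)
qed

lemma translation_continuous_approx:
  assumes f [measurable]: "f \<in> borel_measurable borel"
    and g: "\<And>\<epsilon>. 0 < \<epsilon> \<Longrightarrow> \<exists>g. g \<in> borel_measurable borel \<and> translation_continuous g \<and>
      (\<integral>\<^sup>+x. ennreal (norm (g x - f x)) \<partial>lborel) \<le> ennreal \<epsilon>"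
  shows "translation_continuous f"
  unfolding translation_continuous_def
proof (intro allI impI)
  fix \<epsilon> :: real assume \<epsilon>: "0 < \<epsilon>"
  obtain g where [measurable]: "g \<in> borel_measurable borel" and g: "translation_continuous g"
    and gf: "(\<integral>\<^sup>+x. ennreal (norm (g x - f x)) \<partial>lborel) \<le> ennreal (\<epsilon> / 4)"
    using assms(2)[of "\<epsilon> / 4"] \<epsilon> by auto
  obtain \<delta> where \<delta>: "\<delta> > 0" "\<And>w. norm w < \<delta> \<Longrightarrow> translation_defect g w \<le> ennreal (\<epsilon> / 2)"
    using g \<epsilon> unfolding translation_continuous_def by (meson half_gt_zero)
  have "translation_defect f w \<le> ennreal \<epsilon>" if "norm w < \<delta>" for w
  proof -
    have "translation_defect f w \<le> translation_defect g w + 2 *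
        (\<integral>\<^sup>+x. ennreal (norm (g x - f x)) \<partial>lborel)"
      by (rule translation_defect_approx) simp_all
    also have "\<dots> \<le> ennreal (\<epsilon> / 2) + 2 * ennreal (\<epsilon> / 4)"
      by (intro add_mono mult_mono \<delta> that gf) auto
    also have "2 * ennreal (\<epsilon> / 4) = ennreal (\<epsilon> / 2)"
      using \<epsilon> ennreal_mult[of 2 "\<epsilon> / 4"] by simp
    also have "ennreal (\<epsilon> / 2) + ennreal (\<epsilon> / 2) = ennreal \<epsilon>"
      using \<epsilon> by (subst ennreal_plus[symmetric]) simp_all
    finally show ?thesis .
  qed
  then show "\<exists>\<delta>>0. \<forall>w. norm w < \<delta> \<longrightarrow> translation_defect f w \<le> ennreal \<epsilon>"
    using \<delta>(1) by blast
qed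

lemma translation_continuous_sequentially:
  assumes "\<And>w. w \<longlonglongrightarrow> 0 \<Longrightarrow> (\<lambda>k. translation_defect f (w k)) \<longlonglongrightarrow> 0"
  shows "translation_continuous f"
proof (rule ccontr)
  assume "\<not> translation_continuous f"
  then obtain \<epsilon> where \<epsilon>: "\<epsilon> > 0" and "\<And>\<delta>. \<delta> > 0 \<Longrightarrow> \<exists>w. norm w < \<delta> \<and>
      ennreal \<epsilon> < translation_defect f w"
    unfolding translation_continuous_def by (force simp: not_le)
  then have "\<exists>w. norm w < inverse (real (Suc k)) \<and> ennreal \<epsilon> < translation_defect f w" for k
    by simp
  then obtain w where w: "\<And>k. norm (w k) < inverse (real (Suc k))"
      "\<And>k. ennreal \<epsilon> < translation_defect f (w k)"
    by metis
  have "w \<longlonglongrightarrow> 0"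
    by (rule Lim_null_comparison[OF always_eventually LIMSEQ_inverse_real_of_nat])
      (rule allI, rule less_imp_le[OF w(1)])
  then have "(\<lambda>k. translation_defect f (w k)) \<longlonglongrightarrow> 0" by (rule assms)
  then have "\<forall>\<^sub>F k in sequentially. translation_defect f (w k) < ennreal \<epsilon>"
    using \<epsilon> by (intro order_tendstoD(2)) auto
  then have "\<forall>\<^sub>F k in sequentially. False"
    by eventually_elim (use w(2) in \<open>meson less_asym\<close>)
  then show False by simp
qed

text \<open>The symmetric difference of \<open>U\<close> and its translate has measure
  \<open>2 * |U|\<close> minus twice the measure of the overlap. Openness puts
  \<open>x - w k\<close> into \<open>U\<close> eventually for each \<open>x \<in> U\<close>, so the
  overlap tends to full measure by dominated convergence.\<close>

lemma translation_continuous_open: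
  fixes U :: "'a::euclidean_space set" and c :: "'b::euclidean_space"
  assumes U: "open U" and fin: "emeasure lborel U < \<infinity>"
  shows "translation_continuous (\<lambda>x. indicator U x *\<^sub>R c)"
proof (rule translation_continuous_sequentially)
  fix w :: "nat \<Rightarrow> 'a" assume w: "w \<longlonglongrightarrow> 0"
  have [measurable]: "U \<in> sets borel" using U by simp
  have iU: "integrable lborel (indicator U :: 'a \<Rightarrow> real)"
    using fin by simp
  have iUw: "integrable lborel (\<lambda>x. indicator U (x - w k) :: real)" for k
  proof -
    have "integrable (distr lborel borel ((+) (- w k))) (indicator U :: 'a \<Rightarrow> real)"
      using iU by (simp add: lborel_distr_plus)
    then show ?thesis by (subst (asm) integrable_distr_eq) simp_all
  qed
  have eqI: "(LINT x|lborel. indicator U (x - w k) :: real) = (LINT x|lborel. indicator U x)" for k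
  proof -
    have "(LINT x|lborel. indicator U x :: real) = (LINT x|distr lborel borel ((+) (- w k)).
        indicator U x)"
      by (simp add: lborel_distr_plus)
    also have "\<dots> = (LINT x|lborel. indicator U (x - w k))"
      by (subst integral_distr) simp_all
    finally show ?thesis by simp
  qed
  have iUU: "integrable lborel (\<lambda>x. indicator U (x - w k) * indicator U x :: real)" for k
    by (rule Bochner_Integration.integrable_bound[OF iU]) (auto simp: indicator_def)
  have lim: "(\<lambda>k. LINT x|lborel. indicator U (x - w k) * indicator U x :: real) \<longlonglongrightarrow>
      (LINT x|lborel. indicator U x)"
  proof (rule integral_dominated_convergence[where w = "indicator U"])
    show "AE x in lborel. (\<lambda>k. indicator U (x - w k) * indicator U x :: real) \<longlonglongrightarrow> indicator U x"
    proof (rule AE_I2)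
      fix x
      have "(\<lambda>k. x - w k) \<longlonglongrightarrow> x" using tendsto_diff[OF tendsto_const w, of x] by simp
      then have "\<forall>\<^sub>F k in sequentially. x - w k \<in> U" if "x \<in> U"
        using topological_tendstoD U that by blast
      then show "(\<lambda>k. indicator U (x - w k) * indicator U x :: real) \<longlonglongrightarrow> indicator U x"
        by (cases "x \<in> U") (auto intro!: tendsto_eventually elim: eventually_mono)
    qed
  qed (use iU in \<open>auto simp: indicator_def\<close>)
  have "translation_defect (\<lambda>x. indicator U x *\<^sub>R c) (w k) =
    ennreal (norm c * (2 * (LINT x|lborel. indicator U x) - 2 *
        (LINT x|lborel. indicator U (x - w k) * indicator U x)))" for k
  proof -
    have "translation_defect (\<lambda>x. indicator U x *\<^sub>R c) (w k) = (\<integral>\<^sup>+x. ennreal (norm c *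
        (indicator U (x - w k) + indicator U x - 2 * (indicator U (x - w k) *
            indicator U x))) \<partial>lborel)"
      unfolding translation_defect_def
      by (intro nn_integral_cong) (auto simp: indicator_def)
    also have "\<dots> = ennreal (LINT x|lborel. norm c *
        (indicator U (x - w k) + indicator U x - 2 * (indicator U (x - w k) * indicator U x)))"
      by (rule nn_integral_eq_integral)
        (intro integrable_mult_right Bochner_Integration.integrable_diff
            Bochner_Integration.integrable_add
          iU iUw iUU, auto simp: indicator_def)
    also have "(LINT x|lborel. norm c *
        (indicator U (x - w k) + indicator U x - 2 * (indicator U (x - w k) * indicator U x))) =
        norm c * ((LINT x|lborel. indicator U (x - w k)) + (LINT x|lborel. indicator U x) -
          2 * (LINT x|lborel. indicator U (x - w k) * indicator U x))"
      by (simp only: integral_mult_right_zero Bochner_Integration.integral_diff[OF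
          Bochner_Integration.integrable_add[OF iUw iU]
          integrable_mult_right[OF iUU]] Bochner_Integration.integral_add[OF iUw iU])
    finally show ?thesis by (simp add: eqI)
  qed
  moreover have "(\<lambda>k. ennreal (norm c * (2 * (LINT x|lborel. indicator U x) -
      2 * (LINT x|lborel. indicator U (x - w k) * indicator U x)))) \<longlonglongrightarrow>
      ennreal (norm c * (2 * (LINT x|lborel. indicator U x) - 2 * (LINT x|lborel. indicator U x)))"
    by (intro tendsto_ennrealI tendsto_intros lim)
  ultimately show "(\<lambda>k. translation_defect (\<lambda>x. indicator U x *\<^sub>R c) (w k)) \<longlonglongrightarrow> 0"
    by simp
qed

text \<open>Induction over integrable functions. Indicators of Borel sets reduce to those of open
  sets by outer regularity, and limits are handled by approximation in the mean.\<close>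

lemma integrable_translation_continuous:
  fixes f :: "'a::euclidean_space \<Rightarrow> 'b::euclidean_space"
  assumes "integrable lborel f"
  shows "translation_continuous f"
  using assms
proof induction
  case (base A c)
  then have [measurable]: "A \<in> sets borel" by simp
  show ?case
  proof (rule translation_continuous_approx)
    fix \<epsilon> :: real assume \<epsilon>: "\<epsilon> > 0"
    \<comment> \<open>Adding 1 keeps the quotient meaningful for \<open>c = 0\<close>.\<close>
    have pos: "\<epsilon> / (norm c + 1) > 0" using \<epsilon> by (intro divide_pos_pos) (auto intro: add_nonneg_pos)
    obtain U where U: "open U" "A \<subseteq> U" "emeasure lborel (U - A) < ennreal (\<epsilon> / (norm c + 1))"
      by (rule outer_regular_lborel[OF \<open>A \<in> sets borel\<close> pos])
    have [measurable]: "U \<in> sets borel" using U by simp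
    have "emeasure lborel U = emeasure lborel A + emeasure lborel (U - A)"
      using U(2) by (subst plus_emeasure) (auto simp: Un_absorb1)
    also have "\<dots> < \<infinity>"
      using base U(3) less_trans[OF U(3) ennreal_less_top] by auto
    finally have fin: "emeasure lborel U < \<infinity>" .
    have "(\<integral>\<^sup>+x. ennreal (norm (indicator U x *\<^sub>R c - indicator A x *\<^sub>R c)) \<partial>lborel) =
        (\<integral>\<^sup>+x. ennreal (norm c) * indicator (U - A) x \<partial>lborel)"
      using U(2) by (intro nn_integral_cong) (auto simp: indicator_def)
    also have "\<dots> = ennreal (norm c) * emeasure lborel (U - A)"
      by (subst nn_integral_cmult_indicator) simp_all
    also have "\<dots> \<le> ennreal (norm c) * ennreal (\<epsilon> / (norm c + 1))"
      using U(3) by (intro mult_left_mono) auto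
    also have "\<dots> = ennreal (norm c * (\<epsilon> / (norm c + 1)))"
      by (rule ennreal_mult[symmetric]) (use pos in simp_all)
    also have "\<dots> \<le> ennreal \<epsilon>"
    proof (rule ennreal_leI)
      have "norm c / (norm c + 1) \<le> 1"
        by (subst divide_le_eq_1_pos) (auto intro: add_nonneg_pos)
      from mult_left_mono[OF this less_imp_le[OF \<epsilon>]]
      show "norm c * (\<epsilon> / (norm c + 1)) \<le> \<epsilon>"
        by (simp only: times_divide_eq_right mult.commute mult_1_left)
    qed
    finally have "(\<integral>\<^sup>+x. ennreal (norm (indicator U x *\<^sub>R c - indicator A x *\<^sub>R c)) \<partial>lborel) \<le>
        ennreal \<epsilon>" .
    then show "\<exists>g. g \<in> borel_measurable borel \<and> translation_continuous g \<and>
      (\<integral>\<^sup>+x. ennreal (norm (g x - indicator A x *\<^sub>R c)) \<partial>lborel) \<le> ennreal \<epsilon>"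
      using translation_continuous_open[OF U(1) fin, of c]
      by (intro exI[of _ "\<lambda>x. indicator U x *\<^sub>R c"]) auto
  qed simp
next
  case (add f g)
  have [measurable]: "f \<in> borel_measurable borel" "g \<in> borel_measurable borel"
    using add.hyps(1,2) borel_measurable_integrable by force+
  show ?case
    unfolding translation_continuous_def
  proof (intro allI impI)
    fix \<epsilon> :: real assume "\<epsilon> > 0"
    then have \<epsilon>: "\<epsilon> / 2 > 0" by simp
    obtain d1 where d1: "d1 > 0" "\<And>w. norm w < d1 \<Longrightarrow> translation_defect f w \<le> ennreal (\<epsilon> / 2)"
      using add.IH(1)[unfolded translation_continuous_def, rule_format, OF \<epsilon>] by blast
    obtain d2 where d2: "d2 > 0" "\<And>w. norm w < d2 \<Longrightarrow> translation_defect g w \<le> ennreal (\<epsilon> / 2)"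
      using add.IH(2)[unfolded translation_continuous_def, rule_format, OF \<epsilon>] by blast
    note d = d1 d2
    have "translation_defect (\<lambda>x. f x + g x) w \<le> ennreal \<epsilon>" if "norm w < min d1 d2" for w
    proof -
      have "translation_defect (\<lambda>x. f x + g x) w \<le>
          (\<integral>\<^sup>+x. ennreal (norm (f (x - w) - f x)) + ennreal (norm (g (x - w) - g x)) \<partial>lborel)"
        unfolding translation_defect_def
        by (intro nn_integral_mono)
          (simp add: ennreal_plus[symmetric] norm_diff_triangle_ineq add.commute add_diff_add
              norm_triangle_ineq del: ennreal_plus)
      also have "\<dots> = translation_defect f w + translation_defect g w"
        unfolding translation_defect_def by (rule nn_integral_add) simp_all
      also have "\<dots> \<le> ennreal (\<epsilon> / 2) + ennreal (\<epsilon> / 2)"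
        using that by (intro add_mono d) auto
      also have "\<dots> = ennreal \<epsilon>"
        using \<epsilon> by (subst ennreal_plus[symmetric]) simp_all
      finally show ?thesis .
    qed
    then show "\<exists>\<delta>>0. \<forall>w. norm w < \<delta> \<longrightarrow> translation_defect (\<lambda>x. f x + g x) w \<le> ennreal \<epsilon>"
      using d by (intro exI[of _ "min d1 d2"]) auto
  qed
next
  case (lim f s)
  have [measurable]: "f \<in> borel_measurable borel" "\<And>i. s i \<in> borel_measurable borel"
    using lim.hyps borel_measurable_integrable by force+
  have "(\<lambda>i. \<integral>\<^sup>+x. ennreal (norm (s i x - f x)) \<partial>lborel) \<longlonglongrightarrow> 0"
  proof -
    have int: "integrable lborel (\<lambda>x. norm (s i x - f x))" for i
      using lim.hyps by (intro integrable_norm Bochner_Integration.integrable_diff) auto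
    have "(\<lambda>i. LINT x|lborel. norm (s i x - f x)) \<longlonglongrightarrow> (LINT x|(lborel::'a measure). 0)"
    proof (rule integral_dominated_convergence[where w = "\<lambda>x. 3 * norm (f x)"])
      show "integrable lborel (\<lambda>x. 3 * norm (f x))"
        using lim.hyps by simp
      show "AE x in lborel. (\<lambda>i. norm (s i x - f x)) \<longlonglongrightarrow> 0"
        using lim.hyps(2) by (auto intro!: tendsto_norm_zero LIM_zero)
      show "AE x in lborel. norm (norm (s i x - f x)) \<le> 3 * norm (f x)" for i
      proof (rule AE_I2)
        fix x
        show "norm (norm (s i x - f x)) \<le> 3 * norm (f x)"
          using lim.hyps(3)[of x i] norm_triangle_ineq4[of "s i x" "f x"] by simp
      qed
    qed simp_all
    then have "(\<lambda>i. ennreal (LINT x|lborel. norm (s i x - f x))) \<longlonglongrightarrow> ennreal 0"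
      by (intro tendsto_ennrealI) simp
    then show ?thesis
      by (simp add: nn_integral_eq_integral[OF int])
  qed
  note conv = this
  show ?case
  proof (rule translation_continuous_approx)
    fix \<epsilon> :: real assume "\<epsilon> > 0"
    then have "\<forall>\<^sub>F i in sequentially. (\<integral>\<^sup>+x. ennreal (norm (s i x - f x)) \<partial>lborel) < ennreal \<epsilon>"
      by (intro order_tendstoD(2)[OF conv]) simp
    then obtain i where "(\<integral>\<^sup>+x. ennreal (norm (s i x - f x)) \<partial>lborel) < ennreal \<epsilon>"
      by (meson eventually_happens sequentially_bot)
    then show "\<exists>g. g \<in> borel_measurable borel \<and> translation_continuous g \<and>
      (\<integral>\<^sup>+x. ennreal (norm (g x - f x)) \<partial>lborel) \<le> ennreal \<epsilon>"
      using lim.IH[of i] by (intro exI[of _ "s i"]) (auto intro: less_imp_le)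
  qed simp
qed

subsection \<open>Convolution with a mollifier\<close>

definition conv :: "('a::euclidean_space \<Rightarrow> real) \<Rightarrow> ('a \<Rightarrow> 'b::euclidean_space) \<Rightarrow> 'a \<Rightarrow> 'b" where
  "conv \<rho> f x = (LINT z|lborel. \<rho> (x - z) *\<^sub>R f z)"

lemma conv_shift:
  assumes [measurable]: "\<rho> \<in> borel_measurable borel" "f \<in> borel_measurable borel"
  shows "conv \<rho> f x = (LINT w|lborel. \<rho> w *\<^sub>R f (x - w))"
  using integral_lborel_reflect[of "\<lambda>w. \<rho> w *\<^sub>R f (x - w)" x] by (simp add: conv_def)

lemma compact_support_bounded:
  fixes \<rho> :: "'a::euclidean_space \<Rightarrow> 'b::real_normed_vector"
  assumes "continuous_on UNIV \<rho>" and "\<And>x. s < norm x \<Longrightarrow> \<rho> x = 0"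
  obtains M where "0 \<le> M" "\<And>x. norm (\<rho> x) \<le> M"
proof -
  have "bounded (\<rho> ` cball 0 s)"
    by (intro compact_imp_bounded compact_continuous_image continuous_on_subset[OF assms(1)]) auto
  then obtain M where M: "\<forall>x\<in>cball 0 s. norm (\<rho> x) \<le> M"
    by (auto simp: bounded_iff)
  have "norm (\<rho> x) \<le> max M 0" for x
  proof (cases "norm x \<le> s")
    case True
    then have "norm (\<rho> x) \<le> M" using M by simp
    then show ?thesis by simp
  next
    case False
    then show ?thesis using assms(2)[of x] by simp
  qed
  then show thesis using that[of "max M 0"] by simp
qed

lemma partial_support:
  assumes "\<And>x. s < norm x \<Longrightarrow> \<rho> x = 0" and "s < norm x"
  shows "partial i \<rho> x = 0"
proof -
  have "((\<lambda>x. 0) has_derivative (\<lambda>h. 0)) (at x)" by simp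
  then have "(\<rho> has_derivative (\<lambda>h. 0)) (at x)"
    by (rule has_derivative_transform_within_open[where s = "{x. s < norm x}"])
      (auto simp: assms intro!: open_Collect_less continuous_intros)
  then show ?thesis by (simp add: partial_eqI)
qed

lemma smooth_compact_support_lipschitz:
  fixes \<rho> :: "real ^ 'n \<Rightarrow> real"
  assumes sm: "smooth \<rho>" and supp: "\<And>x. s < norm x \<Longrightarrow> \<rho> x = 0"
  obtains L where "0 \<le> L" "\<And>x y. \<bar>\<rho> y - \<rho> x\<bar> \<le> L * norm (y - x)"
proof -
  have "\<exists>M. 0 \<le> M \<and> (\<forall>x. \<bar>partial i \<rho> x\<bar> \<le> M)" for i
    using compact_support_bounded[of "partial i \<rho>" s]
    by (metis partial_support real_norm_def sm smooth_continuous_on smooth_partial supp)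
  then obtain M where M: "\<And>i. 0 \<le> M i" "\<And>i x. \<bar>partial i \<rho> x\<bar> \<le> M i" by metis
  have "norm (\<rho> y - \<rho> x) \<le> (\<Sum>i\<in>UNIV. M i) * norm (y - x)" for x y
  proof (rule differentiable_bound[OF convex_UNIV smooth_has_derivative[OF sm]])
    show "onorm (\<lambda>h. \<Sum>i\<in>UNIV. h $ i *\<^sub>R partial i \<rho> z) \<le> (\<Sum>i\<in>UNIV. M i)" for z
    proof (rule onorm_bound)
      show "norm (\<Sum>i\<in>UNIV. h $ i *\<^sub>R partial i \<rho> z) \<le> (\<Sum>i\<in>UNIV. M i) * norm h" for h
      proof -
        have "norm (\<Sum>i\<in>UNIV. h $ i *\<^sub>R partial i \<rho> z) \<le> (\<Sum>i\<in>UNIV. norm h * M i)"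
          by (intro sum_norm_le) (auto simp: abs_mult intro!: mult_mono M component_le_norm_cart)
        then show ?thesis by (simp add: sum_distrib_left mult.commute)
      qed
    qed (simp add: M sum_nonneg)
  qed auto
  then show thesis using that[of "\<Sum>i\<in>UNIV. M i"] by (simp add: M sum_nonneg)
qed

text \<open>The remainder bound is uniform in \<open>x\<close>. Integrated against an integrable
  function it becomes a quadratic remainder for the convolution, which gives differentiability
  there.\<close>

lemma smooth_compact_support_taylor:
  fixes \<rho> :: "real ^ 'n \<Rightarrow> real"
  assumes sm: "smooth \<rho>" and supp: "\<And>x. s < norm x \<Longrightarrow> \<rho> x = 0"
  obtains L where "0 \<le> L"
    "\<And>x h. \<bar>\<rho> (x + h) - \<rho> x - (\<Sum>i\<in>UNIV. h $ i * partial i \<rho> x)\<bar> \<le> L * (norm h)\<^sup>2"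
proof -
  have "\<exists>M. 0 \<le> M \<and> (\<forall>x y. \<bar>partial i \<rho> y - partial i \<rho> x\<bar> \<le> M * norm (y - x))" for i
    using smooth_compact_support_lipschitz[of "partial i \<rho>" s]
    by (metis partial_support sm smooth_partial supp)
  then obtain M where M: "\<And>i. 0 \<le> M i" "\<And>i x y. \<bar>partial i \<rho> y - partial i \<rho> x\<bar> \<le>
      M i * norm (y - x)"
    by metis
  define L where "L = (\<Sum>i\<in>UNIV. M i)"
  let ?D = "\<lambda>x h. \<Sum>i\<in>UNIV. h $ i *\<^sub>R partial i \<rho> x"
  have "\<bar>\<rho> (x + h) - \<rho> x - (\<Sum>i\<in>UNIV. h $ i * partial i \<rho> x)\<bar> \<le> L * (norm h)\<^sup>2" for x h
  proof -
    have "norm (\<rho> (x + h) - \<rho> x - ?D x ((x + h) - x)) \<le> norm ((x + h) - x) * (L * norm h)"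
    proof (rule differentiable_bound_linearization[where S = "cball x (norm h)"])
      show "x + t *\<^sub>R (x + h - x) \<in> cball x (norm h)" if "t \<in> {0..1}" for t
        using that by (simp add: dist_norm mult_left_le_one_le)
      show "(\<rho> has_derivative ?D z) (at z within cball x (norm h))" for z
        using smooth_has_derivative[OF sm] has_derivative_at_withinI by blast
      show "onorm (?D z - ?D x) \<le> L * norm h" if z: "z \<in> cball x (norm h)" for z
      proof (rule onorm_bound)
        show "norm ((?D z - ?D x) k) \<le> L * norm h * norm k" for k
        proof -
          have "(?D z - ?D x) k = (\<Sum>i\<in>UNIV. k $ i * (partial i \<rho> z - partial i \<rho> x))"
            by (simp add: algebra_simps sum_subtractf)
          also have "norm \<dots> \<le> (\<Sum>i\<in>UNIV. norm k * (M i * norm h))"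
          proof (intro sum_norm_le)
            fix i
            have "\<bar>partial i \<rho> z - partial i \<rho> x\<bar> \<le> M i * norm (z - x)" by (rule M)
            also have "\<dots> \<le> M i * norm h"
              using z by (intro mult_left_mono M) (simp add: dist_norm norm_minus_commute)
            finally show "norm (k $ i * (partial i \<rho> z - partial i \<rho> x)) \<le> norm k * (M i * norm h)"
              by (simp add: abs_mult mult_mono component_le_norm_cart)
          qed
          finally show ?thesis by (simp add: L_def sum_distrib_left sum_distrib_right mult_ac)
        qed
      qed (simp add: L_def M sum_nonneg)
    qed auto
    then show ?thesis by (simp add: power2_eq_square mult_ac)
  qed
  moreover have "0 \<le> L" by (simp add: L_def M sum_nonneg)
  ultimately show thesis using that by blast
qed

lemma integrable_conv_kernel:
  fixes f :: "'a::euclidean_space \<Rightarrow> 'b::euclidean_space"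
  assumes c: "continuous_on UNIV \<rho>" and supp: "\<And>x. s < norm x \<Longrightarrow> \<rho> x = 0"
      and f: "integrable lborel f"
  shows "integrable lborel (\<lambda>z. \<rho> (x - z) *\<^sub>R f z)"
proof -
  obtain M where M: "0 \<le> M" "\<And>x. norm (\<rho> x) \<le> M"
    using compact_support_bounded[OF c supp] by blast
  have [measurable]: "\<rho> \<in> borel_measurable borel"
    using c by (rule borel_measurable_continuous_onI)
  have [measurable]: "f \<in> borel_measurable borel" using f by auto
  show ?thesis
    by (rule Bochner_Integration.integrable_bound[where f = "\<lambda>z. M *\<^sub>R f z"])
      (use f M in \<open>auto intro!: mult_right_mono\<close>)
qed

lemma conv_has_derivative:
  fixes \<rho> :: "real ^ 'n \<Rightarrow> real" and f :: "real ^ 'n \<Rightarrow> 'b::euclidean_space"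
  assumes sm: "smooth \<rho>" and supp: "\<And>x. s < norm x \<Longrightarrow> \<rho> x = 0" and f: "integrable lborel f"
  shows "(conv \<rho> f has_derivative (\<lambda>h. \<Sum>i\<in>UNIV. h $ i *\<^sub>R conv (partial i \<rho>) f x)) (at x)"
proof -
  obtain L where L: "0 \<le> L"
    "\<And>x h. \<bar>\<rho> (x + h) - \<rho> x - (\<Sum>i\<in>UNIV. h $ i * partial i \<rho> x)\<bar> \<le> L * (norm h)\<^sup>2"
    using smooth_compact_support_taylor[OF sm supp] by blast
  have int: "integrable lborel (\<lambda>z. \<rho> (y - z) *\<^sub>R f z)" for y
    by (rule integrable_conv_kernel[OF smooth_continuous_on[OF sm] supp f])
  have intp: "integrable lborel (\<lambda>z. partial i \<rho> (y - z) *\<^sub>R f z)" for y i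
    by (rule integrable_conv_kernel[OF smooth_continuous_on[OF smooth_partial[OF sm]]
        partial_support[OF supp] f])
  define K where "K = L * (LINT z|lborel. norm (f z))"
  have K: "0 \<le> K" using L by (simp add: K_def)
  have bd: "norm (conv \<rho> f (x + h) - conv \<rho> f x - (\<Sum>i\<in>UNIV. h $ i *\<^sub>R conv (partial i \<rho>) f x)) \<le>
      K * (norm h)\<^sup>2" for h
  proof -
    have "conv \<rho> f (x + h) - conv \<rho> f x - (\<Sum>i\<in>UNIV. h $ i *\<^sub>R conv (partial i \<rho>) f x) =
       (LINT z|lborel. (\<rho> ((x - z) + h) - \<rho> (x - z) - (\<Sum>i\<in>UNIV. h $ i *
           partial i \<rho> (x - z))) *\<^sub>R f z)"
      using int[of "x + h"]
      by (simp add: conv_def scaleR_diff_left scaleR_sum_left int intp algebra_simps flip: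
          scaleR_scaleR)
    also have "norm \<dots> \<le> (LINT z|lborel. (L * (norm h)\<^sup>2) * norm (f z))"
    proof (rule order_trans[OF integral_norm_bound integral_mono])
      show "integrable lborel (\<lambda>z. norm ((\<rho> ((x - z) + h) - \<rho> (x - z) - (\<Sum>i\<in>UNIV. h $ i *
          partial i \<rho> (x - z))) *\<^sub>R f z))"
        using int[of "x + h"]
        by (intro integrable_norm)
          (simp add: scaleR_diff_left scaleR_sum_left int intp algebra_simps flip: scaleR_scaleR)
    qed (use L f in \<open>auto intro!: mult_right_mono\<close>)
    finally show ?thesis by (simp add: K_def mult_ac)
  qed
  show ?thesis
    unfolding has_derivative_at
  proof
    show "bounded_linear (\<lambda>h. \<Sum>i\<in>UNIV. h $ i *\<^sub>R conv (partial i \<rho>) f x)"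
      by (intro bounded_linear_sum bounded_linear_scaleR_const bounded_linear_vec_nth)
    show "((\<lambda>h. norm (conv \<rho> f (x + h) - conv \<rho> f x - (\<Sum>i\<in>UNIV. h $ i *\<^sub>R conv (partial i \<rho>) f x))
        / norm h) \<longlongrightarrow> 0) (at 0)"
    proof (rule Lim_null_comparison[where g = "\<lambda>h. K * norm h"])
      show "\<forall>\<^sub>F h in at 0. norm (norm (conv \<rho> f (x + h) - conv \<rho> f x - (\<Sum>i\<in>UNIV. h $ i *\<^sub>R conv
          (partial i \<rho>) f x)) / norm h) \<le> K * norm h"
        using bd by (auto simp: eventually_at_filter divide_le_eq power2_eq_square mult.assoc)
      show "((\<lambda>h. K * norm h) \<longlongrightarrow> 0) (at (0::real ^ 'n))"
        by (intro tendsto_eq_intros refl) auto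
    qed
  qed
qed

definition locally_integrable :: "('a::euclidean_space \<Rightarrow> 'b::euclidean_space) \<Rightarrow> bool" where
  "locally_integrable f \<longleftrightarrow> (\<forall>R. integrable lborel (\<lambda>x. indicator (cball 0 R) x *\<^sub>R f x))"

text \<open>The convolution at \<open>x\<close> sees \<open>f\<close> only within distance
  \<open>s\<close> of \<open>x\<close>. Hence results for integrable functions carry over to locally
  integrable ones.\<close>

lemma conv_restrict:
  fixes f :: "'a::euclidean_space \<Rightarrow> 'b::euclidean_space"
  assumes "\<And>x. s < norm x \<Longrightarrow> \<rho> x = 0" and "norm x \<le> R"
  shows "conv \<rho> f x = conv \<rho> (\<lambda>z. indicator (cball 0 (R + s)) z *\<^sub>R f z) x"
  unfolding conv_def
proof (rule Bochner_Integration.integral_cong[OF refl])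
  fix z
  show "\<rho> (x - z) *\<^sub>R f z = \<rho> (x - z) *\<^sub>R indicator (cball 0 (R + s)) z *\<^sub>R f z"
  proof (cases "norm z \<le> R + s")
    case False
    then have "s < norm (x - z)"
      using assms(2) norm_triangle_ineq2[of z x] by (simp add: norm_minus_commute)
    then show ?thesis by (simp add: assms(1))
  qed (simp add: indicator_def)
qed

lemma conv_has_derivative_local:
  fixes \<rho> :: "real ^ 'n \<Rightarrow> real" and f :: "real ^ 'n \<Rightarrow> 'b::euclidean_space"
  assumes sm: "smooth \<rho>" and supp: "\<And>x. s < norm x \<Longrightarrow> \<rho> x = 0" and f: "locally_integrable f"
  shows "(conv \<rho> f has_derivative (\<lambda>h. \<Sum>i\<in>UNIV. h $ i *\<^sub>R conv (partial i \<rho>) f x)) (at x)"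
proof -
  define g where "g = (\<lambda>z. indicator (cball 0 (norm x + 1 + s)) z *\<^sub>R f z)"
  have "integrable lborel g" using f by (simp add: g_def locally_integrable_def)
  from conv_has_derivative[OF sm supp this]
  have "(conv \<rho> g has_derivative (\<lambda>h. \<Sum>i\<in>UNIV. h $ i *\<^sub>R conv (partial i \<rho>) g x)) (at x)" .
  moreover have "conv (partial i \<rho>) g x = conv (partial i \<rho>) f x" for i
    unfolding g_def by (rule conv_restrict[symmetric, OF partial_support[OF supp]]) simp_all
  moreover have "conv \<rho> g y = conv \<rho> f y" if "y \<in> ball x 1" for y
    unfolding g_def
  proof (rule conv_restrict[symmetric, OF supp])
    show "norm y \<le> norm x + 1"
      using that norm_triangle_sub[of y x] by (simp add: dist_norm norm_minus_commute)
  qed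
  ultimately show ?thesis
    using has_derivative_transform_within_open[where s = "ball x 1" and f = "conv \<rho> g"] by auto
qed

lemma smooth_conv:
  fixes \<rho> :: "real ^ 'n \<Rightarrow> real" and f :: "real ^ 'n \<Rightarrow> 'b::euclidean_space"
  assumes sm: "smooth \<rho>" and supp: "\<And>x. s < norm x \<Longrightarrow> \<rho> x = 0" and f: "locally_integrable f"
  shows "smooth (conv \<rho> f)" and "partial i (conv \<rho> f) x = conv (partial i \<rho>) f x"
proof -
  have p: "partial i (conv \<rho> f) x = conv (partial i \<rho>) f x"
    if "smooth \<rho>" "\<And>x. s < norm x \<Longrightarrow> \<rho> x = 0" for i x \<rho>
    by (rule partial_eqI[THEN trans, OF conv_has_derivative_local[OF that f]])
      (simp_all add: axis_def if_distrib[of "\<lambda>c. c *\<^sub>R _"] cong: if_cong)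
  show "partial i (conv \<rho> f) x = conv (partial i \<rho>) f x" by (rule p[OF sm supp])
  define S where "S = {conv \<rho> f | \<rho>. smooth \<rho> \<and> (\<forall>x. s < norm x \<longrightarrow> \<rho> x = 0)}"
  show "smooth (conv \<rho> f)"
  proof (rule smooth_coinduct[of _ S])
    show "conv \<rho> f \<in> S" using sm supp by (auto simp: S_def)
  next
    fix g x i assume "g \<in> S"
    then obtain \<rho> where g: "g = conv \<rho> f" and \<rho>: "smooth \<rho>" "\<And>x. s < norm x \<Longrightarrow> \<rho> x = 0"
      by (auto simp: S_def)
    show "g differentiable (at x)"
      unfolding g using conv_has_derivative_local[OF \<rho> f] differentiable_def by blast
    have "partial i g = conv (partial i \<rho>) f"
      unfolding g by (rule ext) (rule p[OF \<rho>])
    then show "partial i g \<in> S"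
      unfolding S_def using smooth_partial[OF \<rho>(1)] partial_support[where \<rho> = \<rho> and s = s, OF \<rho>(2)]
          by blast
  qed
qed

lemma mollifierD:
  assumes "mollifier r \<rho>"
  shows "smooth \<rho>" "\<And>x. 0 \<le> \<rho> x" "\<And>x. r < norm x \<Longrightarrow> \<rho> x = 0" "integrable lborel \<rho>"
    "(LINT x|lborel. \<rho> x) = 1" "\<rho> \<in> borel_measurable borel"
  using assms by (auto simp: mollifier_def)

text \<open>Since \<open>conv \<rho> f x - f x\<close> is the \<open>\<rho>\<close>-average of \<open>f (x - w) - f x\<close> over \<open>w\<close>, its mean is at most the
  average of the translation defects of \<open>f\<close>.\<close>

lemma mollify_L1:
  fixes f :: "real ^ 'n \<Rightarrow> 'b::euclidean_space"
  assumes f: "integrable lborel f" and \<epsilon>: "0 < \<epsilon>"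
  obtains \<delta> where "\<delta> > 0" "\<And>r \<rho>. r < \<delta> \<Longrightarrow> mollifier r \<rho> \<Longrightarrow>
    integrable lborel (\<lambda>x. conv \<rho> f x - f x) \<and> (LINT x|lborel. norm (conv \<rho> f x - f x)) \<le> \<epsilon>"
proof -
  obtain \<delta> where \<delta>: "\<delta> > 0" "\<And>w. norm w < \<delta> \<Longrightarrow> translation_defect f w \<le> ennreal \<epsilon>"
    using integrable_translation_continuous[OF f] \<epsilon> unfolding translation_continuous_def by blast
  have [measurable]: "f \<in> borel_measurable borel" using f by auto
  have "integrable lborel (\<lambda>x. conv \<rho> f x - f x) \<and> (LINT x|lborel. norm (conv \<rho> f x - f x)) \<le> \<epsilon>"
    if r: "r < \<delta>" and \<rho>: "mollifier r \<rho>" for r \<rho>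
  proof -
    note m = mollifierD[OF \<rho>]
    note [measurable] = m(6)
    have int: "integrable lborel (\<lambda>w. \<rho> w *\<^sub>R f (x - w))" for x
    proof -
      have "integrable lborel (\<lambda>z. \<rho> (x - z) *\<^sub>R f z)"
        by (rule integrable_conv_kernel[OF smooth_continuous_on[OF m(1)] m(3) f])
      then have "integrable (distr lborel borel (\<lambda>z. x - z)) (\<lambda>z. \<rho> (x - z) *\<^sub>R f z)"
        by (simp add: lborel_distr_reflect)
      then show ?thesis by (subst (asm) integrable_distr_eq) simp_all
    qed
    have cf: "conv \<rho> f x - f x = (LINT w|lborel. \<rho> w *\<^sub>R (f (x - w) - f x))" for x
    proof -
      have "(LINT w|lborel. \<rho> w *\<^sub>R (f (x - w) - f x)) =
          (LINT w|lborel. \<rho> w *\<^sub>R f (x - w)) - (LINT w|lborel. \<rho> w *\<^sub>R f x)"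
        unfolding scaleR_diff_right by (intro Bochner_Integration.integral_diff int) (simp add: m)
      also have "(LINT w|lborel. \<rho> w *\<^sub>R f x) = f x"
        by (simp add: m)
      finally show ?thesis by (simp add: conv_shift)
    qed
    have [measurable]: "(\<lambda>x. conv \<rho> f x) \<in> borel_measurable borel"
      unfolding conv_def by measurable
    have "(\<integral>\<^sup>+x. ennreal (norm (conv \<rho> f x - f x)) \<partial>lborel) \<le>
        (\<integral>\<^sup>+x. (\<integral>\<^sup>+w. ennreal (\<rho> w) * ennreal (norm (f (x - w) - f x)) \<partial>lborel) \<partial>lborel)"
    proof (rule nn_integral_mono)
      fix x
      have "integrable lborel (\<lambda>w. \<rho> w *\<^sub>R (f (x - w) - f x))"
        unfolding scaleR_diff_right by (intro Bochner_Integration.integrable_diff int) (simp add: m)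
      then have "ennreal (norm (conv \<rho> f x - f x)) \<le> (\<integral>\<^sup>+w. ennreal (norm (\<rho> w *\<^sub>R (f (x - w) - f
          x))) \<partial>lborel)"
        unfolding cf by (rule integral_norm_bound_ennreal)
      then show "ennreal (norm (conv \<rho> f x - f x)) \<le> (\<integral>\<^sup>+w. ennreal (\<rho> w) *
          ennreal (norm (f (x - w) - f x)) \<partial>lborel)"
        by (simp add: m ennreal_mult)
    qed
    also have "\<dots> = (\<integral>\<^sup>+w. (\<integral>\<^sup>+x. ennreal (\<rho> w) * ennreal (norm (f (x - w) - f x)) \<partial>lborel) \<partial>lborel)"
      by (rule lborel_pair.Fubini') measurable
    also have "\<dots> = (\<integral>\<^sup>+w. ennreal (\<rho> w) * translation_defect f w \<partial>lborel)"
      unfolding translation_defect_def by (intro nn_integral_cong nn_integral_cmult) measurable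
    also have "\<dots> \<le> (\<integral>\<^sup>+w. ennreal (\<rho> w) * ennreal \<epsilon> \<partial>lborel)"
    proof (rule nn_integral_mono)
      fix w
      show "ennreal (\<rho> w) * translation_defect f w \<le> ennreal (\<rho> w) * ennreal \<epsilon>"
      proof (cases "norm w < \<delta>")
        case True
        then show ?thesis by (intro mult_left_mono \<delta>) auto
      next
        case False
        then show ?thesis using r m(3)[of w] by simp
      qed
    qed
    also have "\<dots> = ennreal (LINT w|lborel. \<rho> w) * ennreal \<epsilon>"
      by (subst nn_integral_multc) (simp_all add: nn_integral_eq_integral m)
    also have "\<dots> = ennreal \<epsilon>" by (simp add: m)
    finally have le: "(\<integral>\<^sup>+x. ennreal (norm (conv \<rho> f x - f x)) \<partial>lborel) \<le> ennreal \<epsilon>" .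
    then have "integrable lborel (\<lambda>x. conv \<rho> f x - f x)"
      by (intro integrableI_bounded) (auto intro: le_less_trans)
    moreover from this have "ennreal (LINT x|lborel. norm (conv \<rho> f x - f x)) \<le> ennreal \<epsilon>"
      using le by (simp add: nn_integral_eq_integral)
    ultimately show ?thesis using \<epsilon> by (simp add: ennreal_le_iff)
  qed
  with \<delta>(1) show thesis using that by blast
qed

subsection \<open>Convex combinations converging almost everywhere\<close>

text \<open>The series has finite integral, hence finite values almost everywhere. Both
  constructions of almost everywhere convergent sequences below go through this lemma.\<close>

lemma AE_summable_of_nn_integral_bound:
  fixes u :: "nat \<Rightarrow> 'a \<Rightarrow> real"
  assumes [measurable]: "\<And>m. u m \<in> borel_measurable M"
    and nn: "\<And>m x. 0 \<le> u m x" and c: "\<And>m. 0 \<le> c m" "summable c"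
    and bd: "\<And>m. (\<integral>\<^sup>+x. ennreal (u m x) \<partial>M) \<le> ennreal (c m)"
  shows "AE x in M. summable (\<lambda>m. u m x)"
proof -
  have "(\<integral>\<^sup>+x. (\<Sum>m. ennreal (u m x)) \<partial>M) = (\<Sum>m. \<integral>\<^sup>+x. ennreal (u m x) \<partial>M)"
    by (rule nn_integral_suminf) simp
  also have "\<dots> \<le> (\<Sum>m. ennreal (c m))"
    by (intro suminf_le bd) auto
  also have "\<dots> < \<infinity>"
    using c by (simp add: suminf_ennreal2 less_top)
  finally have "(\<integral>\<^sup>+x. (\<Sum>m. ennreal (u m x)) \<partial>M) \<noteq> \<infinity>" by simp
  then have "AE x in M. (\<Sum>m. ennreal (u m x)) \<noteq> \<infinity>"
    by (intro nn_integral_PInf_AE) simp_all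
  then show ?thesis
    by eventually_elim (use nn in \<open>auto intro!: summable_suminf_not_top\<close>)
qed

text \<open>Midpoints are the convex combinations that the parallelogram law compares, and they
  reduce statements about linear functionals to a two-term induction. The index \<open>m\<close>
  discards an initial segment, so that elements of late hulls inherit limits of
  \<open>v\<close>.\<close>

inductive_set midpoint_hull :: "(nat \<Rightarrow> 'a \<Rightarrow> 'b::real_vector) \<Rightarrow> nat \<Rightarrow> ('a \<Rightarrow> 'b) set" for v m where
  base: "m \<le> j \<Longrightarrow> v j \<in> midpoint_hull v m"
| mid: "f \<in> midpoint_hull v m \<Longrightarrow> g \<in> midpoint_hull v m \<Longrightarrow>
    (\<lambda>x. (1 / 2) *\<^sub>R (f x + g x)) \<in> midpoint_hull v m"

lemma midpoint_hull_antimono: "m \<le> m' \<Longrightarrow> midpoint_hull v m' \<subseteq> midpoint_hull v m"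
proof
  fix f assume "m \<le> m'" "f \<in> midpoint_hull v m'"
  from this(2,1) show "f \<in> midpoint_hull v m"
    by induction (auto intro: midpoint_hull.intros)
qed

text \<open>Almost norm-minimal elements of the tail hulls form a Cauchy sequence by the parallelogram law.\<close>

lemma midpoint_hull_AE_convergent:
  fixes v :: "nat \<Rightarrow> 'a \<Rightarrow> 'b::euclidean_space"
  assumes M: "finite_measure M"
    and v: "\<And>j. v j \<in> borel_measurable M" "\<And>j x. norm (v j x) \<le> L"
  obtains w where "\<And>k. w k \<in> midpoint_hull v k" "AE x in M. convergent (\<lambda>k. w k x)"
proof -
  interpret finite_measure M by (rule M)
  have meas: "f \<in> borel_measurable M" and bnd: "\<And>x. norm (f x) \<le> L" if "f \<in> midpoint_hull v m"
      for f m
  proof -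
    show "f \<in> borel_measurable M" using that by induction (auto simp: v)
    show "norm (f x) \<le> L" for x
      using that
    proof induction
      case (mid f g)
      have "norm ((1 / 2) *\<^sub>R (f x + g x)) \<le> (1 / 2) * (norm (f x) + norm (g x))"
        by (simp add: norm_triangle_ineq)
      also have "\<dots> \<le> (1 / 2) * (L + L)"
        by (intro mult_left_mono add_mono mid.IH) simp
      finally show ?case by simp
    qed (rule v)
  qed
  define E where "E f = (LINT x|M. (norm (f x))\<^sup>2)" for f :: "'a \<Rightarrow> 'b"
  have int: "integrable M (\<lambda>x. (norm (f x))\<^sup>2)" if "f \<in> midpoint_hull v m" for f m
    by (rule integrable_const_bound[where B = "L\<^sup>2"])
      (use meas[OF that] bnd[OF that] in \<open>auto intro!: power_mono\<close>)
  have E_nn: "0 \<le> E f" for f by (simp add: E_def)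
  have E_le: "E f \<le> L\<^sup>2 * measure M (space M)" if "f \<in> midpoint_hull v m" for f m
  proof -
    have "E f \<le> (LINT x|M. L\<^sup>2)"
      unfolding E_def by (intro integral_mono int[OF that]) (auto intro!: power_mono bnd[OF that])
    then show ?thesis by (simp add: mult.commute)
  qed
  define d where "d m = Inf (E ` midpoint_hull v m)" for m
  have ne: "midpoint_hull v m \<noteq> {}" for m
    using midpoint_hull.base[of m m v] by auto
  have bdd: "bdd_below (E ` midpoint_hull v m)" for m
    using E_nn by (intro bdd_belowI[of _ 0]) auto
  have d_le: "d m \<le> E f" if "f \<in> midpoint_hull v m" for f m
    unfolding d_def using that bdd by (intro cInf_lower) auto
  have d_mono: "d m \<le> d m'" if "m \<le> m'" for m m'
    unfolding d_def using ne bdd midpoint_hull_antimono[OF that, of v]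
    by (intro cInf_superset_mono) auto
  have d_bd: "d m \<le> L\<^sup>2 * measure M (space M)" for m
    using d_le[OF midpoint_hull.base[of m m]] E_le[OF midpoint_hull.base[of m m]]
        by (meson order_refl order_trans)
  \<comment> \<open>The least energies \<open>d m\<close> of the tail hulls increase and stay
    bounded. Far out they are all close to \<open>D\<close>, so near-minimisers of different tails
    have almost the same energy.\<close>
  define D where "D = Sup (range d)"
  have bddD: "bdd_above (range d)" using d_bd by (rule bdd_aboveI2)
  have d_D: "d m \<le> D" for m
    unfolding D_def by (intro cSup_upper bddD) auto
  \<comment> \<open>The rate is chosen so that the squared steps, of size
    \<open>8 * \<epsilon> k\<close>, remain summable after multiplication by
    \<open>2 ^ k\<close>.\<close>
  define \<epsilon> where "\<epsilon> k = (1 / 4 :: real) ^ k" for k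
  have \<epsilon>: "0 < \<epsilon> k" for k by (simp add: \<epsilon>_def)
  have "\<exists>m. D - \<epsilon> k < d m" for k
    using less_cSup_iff[OF _ bddD, of "D - \<epsilon> k"] \<epsilon>[of k] by (auto simp: D_def)
  then obtain N where N: "\<And>k. D - \<epsilon> k < d (N k)" by metis
  \<comment> \<open>Summing the \<open>N j\<close> makes \<open>m\<close> monotone and at least as
    large as both \<open>k\<close> and \<open>N k\<close>.\<close>
  define m where "m k = k + (\<Sum>j\<le>k. N j)" for k
  have m_mono: "m k \<le> m (Suc k)" for k by (simp add: m_def)
  have mN: "N k \<le> m k" for k
    using member_le_sum[of k "{..k}" N] by (simp add: m_def)
  have mk: "k \<le> m k" for k by (simp add: m_def)
  have dm: "D - \<epsilon> k < d (m k)" for k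
    using N[of k] d_mono[OF mN[of k]] by simp
  have "\<exists>f\<in>midpoint_hull v (m k). E f < d (m k) + \<epsilon> k" for k
    using cInf_lessD[of "E ` midpoint_hull v (m k)" "d (m k) + \<epsilon> k"] ne \<epsilon>[of k]
        by (auto simp: d_def)
  then obtain w where w: "\<And>k. w k \<in> midpoint_hull v (m k)" "\<And>k. E (w k) < d (m k) + \<epsilon> k"
    by metis
  have step: "(LINT x|M. (norm (w k x - w (Suc k) x))\<^sup>2) \<le> 8 * \<epsilon> k"
    and step_int: "integrable M (\<lambda>x. (norm (w k x - w (Suc k) x))\<^sup>2)" for k
  proof -
    have w': "w (Suc k) \<in> midpoint_hull v (m k)"
      using w(1)[of "Suc k"] midpoint_hull_antimono[OF m_mono] by blast
    let ?g = "\<lambda>x. (1 / 2) *\<^sub>R (w k x + w (Suc k) x)"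
    have g: "?g \<in> midpoint_hull v (m k)" by (rule midpoint_hull.mid[OF w(1) w'])
    have par: "(norm (w k x - w (Suc k) x))\<^sup>2 = 2 * (norm (w k x))\<^sup>2 + 2 *
        (norm (w (Suc k) x))\<^sup>2 - 4 * (norm (?g x))\<^sup>2" for x
      by (simp add: power2_norm_eq_inner algebra_simps inner_commute)
    show "integrable M (\<lambda>x. (norm (w k x - w (Suc k) x))\<^sup>2)"
      unfolding par by (intro Bochner_Integration.integrable_diff Bochner_Integration.integrable_add
          integrable_mult_right int[OF w(1)] int[OF g])
    \<comment> \<open>The midpoint lies in the same tail hull, so its energy exceeds
      \<open>D - \<epsilon> k\<close>, while both endpoints stay below
      \<open>D + \<epsilon> k\<close>. The parallelogram law leaves at most
      \<open>8 * \<epsilon> k\<close> for the step.\<close>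
    have "(LINT x|M. (norm (w k x - w (Suc k) x))\<^sup>2) = 2 * E (w k) + 2 * E (w (Suc k)) - 4 * E ?g"
      unfolding par E_def using int[OF w(1)[of k]] int[OF w'] int[OF g] by simp
    moreover have "D - \<epsilon> k < E ?g" using d_le[OF g] dm[of k] by linarith
    moreover have "E (w k) < D + \<epsilon> k" using w(2)[of k] d_D[of "m k"] by linarith
    moreover have "E (w (Suc k)) < D + \<epsilon> k"
    proof -
      have "\<epsilon> (Suc k) \<le> \<epsilon> k" by (simp add: \<epsilon>_def)
      then show ?thesis using w(2)[of "Suc k"] d_D[of "m (Suc k)"] by linarith
    qed
    ultimately show "(LINT x|M. (norm (w k x - w (Suc k) x))\<^sup>2) \<le> 8 * \<epsilon> k" by linarith
  qed
  have "AE x in M. summable (\<lambda>k. 2 ^ k * (norm (w k x - w (Suc k) x))\<^sup>2)"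
  proof (rule AE_summable_of_nn_integral_bound)
    show "summable (\<lambda>k. 8 * (1 / 2 :: real) ^ k)"
      by (intro summable_mult summable_geometric) simp
    show "(\<integral>\<^sup>+x. ennreal (2 ^ k * (norm (w k x - w (Suc k) x))\<^sup>2) \<partial>M) \<le> ennreal (8 * (1 / 2) ^ k)"
        for k
    proof -
      have "(\<integral>\<^sup>+x. ennreal (2 ^ k * (norm (w k x - w (Suc k) x))\<^sup>2) \<partial>M) =
          ennreal (LINT x|M. 2 ^ k * (norm (w k x - w (Suc k) x))\<^sup>2)"
        by (rule nn_integral_eq_integral) (use step_int in auto)
      also have "\<dots> \<le> ennreal (2 ^ k * (8 * \<epsilon> k))"
        using step[of k] by (intro ennreal_leI) simp
      also have "2 ^ k * (8 * \<epsilon> k) = 8 * (1 / 2) ^ k"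
        by (simp add: \<epsilon>_def power_mult_distrib[symmetric])
      finally show ?thesis .
    qed
    show "(\<lambda>x. 2 ^ k * (norm (w k x - w (Suc k) x))\<^sup>2) \<in> borel_measurable M" for k
      using meas[OF w(1)] by simp
  qed auto
  then have "AE x in M. convergent (\<lambda>k. w k x)"
  proof eventually_elim
    fix x assume s: "summable (\<lambda>k. 2 ^ k * (norm (w k x - w (Suc k) x))\<^sup>2)"
    have "summable (\<lambda>k. norm (w (Suc k) x - w k x))"
    proof (rule summable_comparison_test'[where N = 0])
      show "summable (\<lambda>k. (1 / 2) ^ k + 2 ^ k * (norm (w k x - w (Suc k) x))\<^sup>2)"
        by (intro summable_add s summable_geometric) simp
      show "norm (norm (w (Suc k) x - w k x)) \<le> (1 / 2) ^ k + 2 ^ k *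
          (norm (w k x - w (Suc k) x))\<^sup>2" for k
      proof -
        define a where "a = norm (w k x - w (Suc k) x)"
        \<comment> \<open>Completing the square bounds a step by a geometric term plus its weighted
          square, so weighted square summability yields absolute summability.\<close>
        have "0 \<le> (2 ^ k * a - 1)\<^sup>2 + 2 ^ k * a" by (simp add: a_def)
        then have "2 ^ k * a \<le> 1 + 2 ^ k * (2 ^ k * a\<^sup>2)"
          by (simp add: power2_eq_square algebra_simps)
        then have "(1 / 2) ^ k * (2 ^ k * a) \<le> (1 / 2) ^ k * (1 + 2 ^ k * (2 ^ k * a\<^sup>2))"
          by (intro mult_left_mono) auto
        then have "a \<le> (1 / 2) ^ k + 2 ^ k * a\<^sup>2"
          by (simp add: power_one_over field_simps)
        then show ?thesis by (simp add: a_def norm_minus_commute)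
      qed
    qed
    then have "summable (\<lambda>k. w (Suc k) x - w k x)" by (rule summable_norm_cancel)
    then have "convergent (\<lambda>n. (\<Sum>k<n. w (Suc k) x - w k x))"
      by (simp add: summable_iff_convergent)
    then have "convergent (\<lambda>n. w n x - w 0 x)"
      by (simp only: sum_lessThan_telescope[of "\<lambda>k. w k x"])
    then show "convergent (\<lambda>n. w n x)"
      using convergent_add[OF _ convergent_const[of "w 0 x"]] by fastforce
  qed
  moreover have "w k \<in> midpoint_hull v k" for k
    using w(1)[of k] midpoint_hull_antimono[OF mk] by blast
  ultimately show thesis using that by blast
qed

text \<open>Energies require a finite measure. A strictly positive density with finite integral
  provides one with the same null sets as \<open>lborel\<close>.\<close>

lemma midpoint_hull_AE_convergent_lborel:
  fixes v :: "nat \<Rightarrow> 'a::euclidean_space \<Rightarrow> 'b::euclidean_space"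
  assumes v: "\<And>j. v j \<in> borel_measurable borel" "\<And>j x. norm (v j x) \<le> L"
  obtains w where "\<And>k. w k \<in> midpoint_hull v k" "AE x in lborel. convergent (\<lambda>k. w k x)"
proof -
  obtain h :: "'a \<Rightarrow> ennreal" where h: "h \<in> borel_measurable lborel" "integral\<^sup>N lborel h \<noteq> \<infinity>"
    "\<And>x. 0 < h x"
    using sigma_finite_measure.Ex_finite_integrable_function[OF sigma_finite_lborel] by auto
  have "finite_measure (density lborel h)"
    by (rule finite_measureI) (use h in \<open>simp add: emeasure_density\<close>)
  then obtain w where "\<And>k. w k \<in> midpoint_hull v k" "AE x in density lborel h. convergent (\<lambda>k. w k
      x)"
    using midpoint_hull_AE_convergent[of "density lborel h" v L] v by auto
  moreover from this(2) have "AE x in lborel. convergent (\<lambda>k. w k x)"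
    by (simp add: AE_density[OF h(1)] h(3))
  ultimately show thesis using that by blast
qed

text \<open>Balls are convex: a functional that respects midpoints and sends the tail of
  \<open>v\<close> into a ball around \<open>c\<close> sends the whole hull there.\<close>

lemma midpoint_hull_functional_bound:
  fixes \<Lambda> :: "('a \<Rightarrow> 'b::real_vector) \<Rightarrow> 'c::real_normed_vector"
  assumes "f \<in> midpoint_hull v m"
    and "\<And>f g. f \<in> midpoint_hull v m \<Longrightarrow> g \<in> midpoint_hull v m \<Longrightarrow>
      \<Lambda> (\<lambda>x. (1 / 2) *\<^sub>R (f x + g x)) = (1 / 2) *\<^sub>R (\<Lambda> f + \<Lambda> g)"
    and "\<And>j. m \<le> j \<Longrightarrow> norm (\<Lambda> (v j) - c) \<le> e"
  shows "norm (\<Lambda> f - c) \<le> e"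
  using assms(1)
proof induction
  case (base j)
  then show ?case by (rule assms(3))
next
  case (mid f g)
  have "c = (1 / 2) *\<^sub>R (c + c)" by (simp flip: scaleR_2)
  then have "\<Lambda> (\<lambda>x. (1 / 2) *\<^sub>R (f x + g x)) - c = (1 / 2) *\<^sub>R (\<Lambda> f + \<Lambda> g) - (1 / 2) *\<^sub>R (c + c)"
    using assms(2)[OF mid.hyps(1,2)] by simp
  also have "\<dots> = (1 / 2) *\<^sub>R ((\<Lambda> f - c) + (\<Lambda> g - c))"
    by (simp only: scaleR_diff_right[symmetric] add_diff_add)
  finally have "\<Lambda> (\<lambda>x. (1 / 2) *\<^sub>R (f x + g x)) - c = (1 / 2) *\<^sub>R ((\<Lambda> f - c) + (\<Lambda> g - c))" .
  then have "norm (\<Lambda> (\<lambda>x. (1 / 2) *\<^sub>R (f x + g x)) - c) \<le>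
      (1 / 2) * (norm (\<Lambda> f - c) + norm (\<Lambda> g - c))"
    by (simp add: norm_triangle_ineq)
  also have "\<dots> \<le> (1 / 2) * (e + e)"
    by (intro mult_left_mono add_mono mid.IH) simp
  finally show ?case by simp
qed

subsection \<open>Weak Jacobians of Lipschitz maps\<close>

text \<open>A bound on each coordinate instead of the Euclidean norm: it survives extension
  coordinate by coordinate and bounds every entry of the Jacobian by \<open>L\<close> itself,
  without a factor from the dimension.\<close>

definition component_lipschitz :: "real \<Rightarrow> (real ^ 'n \<Rightarrow> real ^ 'm) \<Rightarrow> bool" where
  "component_lipschitz L F \<longleftrightarrow> (\<forall>x y j. \<bar>F x $ j - F y $ j\<bar> \<le> L * norm (x - y))"

lemma component_lipschitzD: "component_lipschitz L F \<Longrightarrow> \<bar>F x $ j - F y $ j\<bar> \<le> L * norm (x - y)"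
  by (simp add: component_lipschitz_def)

lemma component_lipschitz_nonneg:
  fixes F :: "real ^ 'n \<Rightarrow> real ^ 'm"
  assumes "component_lipschitz L F"
  shows "0 \<le> L"
proof -
  obtain j :: 'm where True by blast
  obtain i :: 'n where True by blast
  have "0 \<le> L * norm (axis i (1::real) - 0)"
    using component_lipschitzD[OF assms, of "axis i 1" j 0] by linarith
  then show ?thesis by simp
qed

lemma component_lipschitz_norm:
  fixes F :: "real ^ 'n \<Rightarrow> real ^ 'm"
  assumes "component_lipschitz L F"
  shows "norm (F x - F y) \<le> (real CARD('m) * L) * norm (x - y)"
proof -
  have "norm (F x - F y) \<le> (\<Sum>j\<in>UNIV. \<bar>(F x - F y) $ j\<bar>)" by (rule norm_le_l1_cart)
  also have "\<dots> \<le> (\<Sum>j::'m\<in>UNIV. L * norm (x - y))"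
    by (intro sum_mono) (simp add: component_lipschitzD[OF assms])
  finally show ?thesis by simp
qed

lemma component_lipschitz_continuous:
  fixes F :: "real ^ 'n \<Rightarrow> real ^ 'm"
  assumes "component_lipschitz L F"
  shows "continuous_on S F"
proof (rule lipschitz_on_continuous_on)
  show "lipschitz_on (real CARD('m) * L) S F"
    using component_lipschitz_norm[OF assms] component_lipschitz_nonneg[OF assms]
    by (auto simp: lipschitz_on_def dist_norm)
qed

lemma continuous_locally_integrable:
  fixes f :: "'a::euclidean_space \<Rightarrow> 'b::euclidean_space"
  shows "continuous_on UNIV f \<Longrightarrow> locally_integrable f"
  unfolding locally_integrable_def
  by (auto intro!: borel_integrable_compact intro: continuous_on_subset)

lemma bounded_locally_integrable:
  fixes f :: "'a::euclidean_space \<Rightarrow> 'b::euclidean_space"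
  assumes [measurable]: "f \<in> borel_measurable borel" and "\<And>x. norm (f x) \<le> K"
  shows "locally_integrable f"
  unfolding locally_integrable_def
proof
  fix R
  show "integrable lborel (\<lambda>x. indicator (cball 0 R) x *\<^sub>R f x)"
  proof (rule Bochner_Integration.integrable_bound[where f = "\<lambda>x. K * indicator (cball 0 R) x"])
    show "integrable lborel (\<lambda>x. K * indicator (cball (0::'a) R) x)"
      using emeasure_bounded_finite[OF bounded_cball[of "0::'a" R]]
          by (intro integrable_mult_right) simp
    have "0 \<le> K" using assms(2) norm_ge_zero order_trans by blast
    then show "AE x in lborel. norm (indicator (cball 0 R) x *\<^sub>R f x) \<le>
        norm (K * indicator (cball 0 R) x)"
      using assms(2) by (auto simp: indicator_def)
    show "(\<lambda>x. indicator (cball 0 R) x *\<^sub>R f x) \<in> borel_measurable lborel"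
      using assms(1) by (intro borel_measurable_scaleR borel_measurable_indicator) auto
  qed
qed

lemma conv_integrable_local:
  fixes f :: "'a::euclidean_space \<Rightarrow> 'b::euclidean_space"
  assumes "continuous_on UNIV \<rho>" and supp: "\<And>x. s < norm x \<Longrightarrow> \<rho> x = 0" and f: "locally_integrable f"
  shows "integrable lborel (\<lambda>z. \<rho> (x - z) *\<^sub>R f z)"
proof -
  define g where "g = (\<lambda>z. indicator (cball 0 (norm x + s)) z *\<^sub>R f z)"
  have "integrable lborel g" using f by (simp add: g_def locally_integrable_def)
  from integrable_conv_kernel[OF assms(1,2) this]
  have "integrable lborel (\<lambda>z. \<rho> (x - z) *\<^sub>R g z)" .
  also have "(\<lambda>z. \<rho> (x - z) *\<^sub>R g z) = (\<lambda>z. \<rho> (x - z) *\<^sub>R f z)"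
  proof
    fix z
    have "s < norm (x - z)" if "norm x + s < norm z"
      using that norm_triangle_ineq2[of z x] by (simp add: norm_minus_commute)
    then show "\<rho> (x - z) *\<^sub>R g z = \<rho> (x - z) *\<^sub>R f z"
      by (cases "norm z \<le> norm x + s") (auto simp: g_def indicator_def supp)
  qed
  finally show ?thesis .
qed

lemma norm_matrix_le:
  fixes A :: "real ^ 'n ^ 'm"
  assumes "\<And>j i. \<bar>A $ j $ i\<bar> \<le> L"
  shows "norm A \<le> real CARD('m) * (real CARD('n) * L)"
proof -
  have "norm A \<le> (\<Sum>j\<in>UNIV. norm (A $ j))" by (simp add: norm_vec_def L2_set_le_sum)
  also have "\<dots> \<le> (\<Sum>j::'m\<in>UNIV. \<Sum>i::'n\<in>UNIV. L)"
    by (intro sum_mono order_trans[OF norm_le_l1_cart]) (rule assms)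
  finally show ?thesis by simp
qed

text \<open>The matrix \<open>G\<close> is a limit of convex combinations of difference quotients of \<open>F\<close>.\<close>

lemma weak_jacobian_exists:
  fixes F :: "real ^ 'n \<Rightarrow> real ^ 'm"
  assumes F: "component_lipschitz L F"
  obtains G :: "real ^ 'n \<Rightarrow> real ^ 'n ^ 'm" where "G \<in> borel_measurable borel"
    "\<And>x j i. \<bar>G x $ j $ i\<bar> \<le> L"
    "\<And>\<rho> s x i j. smooth \<rho> \<Longrightarrow> (\<And>x. s < norm x \<Longrightarrow> \<rho> x = 0) \<Longrightarrow> partial i (conv \<rho> F) x $ j =
        conv \<rho> G x $ j $ i"
proof -
  note L = component_lipschitz_nonneg[OF F]
  have contF: "continuous_on UNIV F" by (rule component_lipschitz_continuous[OF F])
  have [measurable]: "F \<in> borel_measurable borel" using contF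
      by (rule borel_measurable_continuous_onI)
  define h where "h m = inverse (real (Suc m))" for m
  have h: "0 < h m" for m by (simp add: h_def)
  have h_lim: "h \<longlonglongrightarrow> 0" using LIMSEQ_inverse_real_of_nat by (simp add: h_def[abs_def])
  define v where "v m x = (\<chi> j i. (F (x + h m *\<^sub>R axis i 1) $ j - F x $ j) / h m)" for m x
  have v_bd: "\<bar>v m x $ j $ i\<bar> \<le> L" for m x j i
  proof -
    have "\<bar>F (x + h m *\<^sub>R axis i 1) $ j - F x $ j\<bar> \<le> L * h m"
      using component_lipschitzD[OF F, of "x + h m *\<^sub>R axis i 1" j x] h[of m] by simp
    then show ?thesis using h[of m] by (simp add: v_def divide_le_eq)
  qed
  define K where "K = real CARD('m) * (real CARD('n) * L)"
  have normK: "norm A \<le> K" if "\<And>j i. \<bar>A $ j $ i\<bar> \<le> L" for A :: "real ^ 'n ^ 'm"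
    unfolding K_def using that by (rule norm_matrix_le)
  have v_meas [measurable]: "v m \<in> borel_measurable borel" for m
  proof -
    have "continuous_on UNIV (v m)"
      unfolding v_def
      by (intro continuous_intros continuous_on_compose2[OF contF]) (use h[of m] in auto)
    then show ?thesis by (rule borel_measurable_continuous_onI)
  qed
  obtain w where w: "\<And>k. w k \<in> midpoint_hull v k" and wc: "AE x in lborel. convergent (\<lambda>k. w k x)"
    using midpoint_hull_AE_convergent_lborel[of v K, OF v_meas normK[OF v_bd]] by blast
  have hull_meas: "f \<in> borel_measurable borel" if "f \<in> midpoint_hull v m" for f m
    using that by induction auto
  have hull_bd: "\<bar>f x $ j $ i\<bar> \<le> L" if "f \<in> midpoint_hull v m" for f m x j i
    using that
  proof induction
    case (mid f g)
    have "\<bar>((1 / 2) *\<^sub>R (f x + g x)) $ j $ i\<bar> \<le> (1 / 2) * (\<bar>f x $ j $ i\<bar> + \<bar>g x $ j $ i\<bar>)"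
      by simp
    also have "\<dots> \<le> (1 / 2) * (L + L)"
      by (intro mult_left_mono add_mono mid.IH) simp
    finally show ?case by simp
  qed (rule v_bd)
  \<comment> \<open>Where the limit does not obey the entry bound, which happens only on a null set,
    the value is 0. The bound then holds everywhere and not just almost everywhere.\<close>
  define G where "G x = (if \<forall>j i. \<bar>lim (\<lambda>k. w k x) $ j $ i\<bar> \<le> L then lim (\<lambda>k. w k x) else 0)" for x
  have lim_meas [measurable]: "(\<lambda>x. lim (\<lambda>k. w k x)) \<in> borel_measurable borel"
    by (rule borel_measurable_lim_metric) (rule hull_meas[OF w])
  have [measurable]: "(\<lambda>x. lim (\<lambda>k. w k x) $ j $ i) \<in> borel_measurable borel" for j i
    using borel_measurable_continuous_on[of "\<lambda>A::real ^ 'n ^ 'm. A $ j $ i", OF _ lim_meas]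
    by (simp add: continuous_on_component)
  have G_meas [measurable]: "G \<in> borel_measurable borel"
    unfolding G_def by measurable
  have G_bd: "\<bar>G x $ j $ i\<bar> \<le> L" for x j i
    using L by (auto simp: G_def)
  have wG: "AE x in lborel. (\<lambda>k. w k x) \<longlonglongrightarrow> G x"
    using wc
  proof eventually_elim
    fix x assume "convergent (\<lambda>k. w k x)"
    then have l: "(\<lambda>k. w k x) \<longlonglongrightarrow> lim (\<lambda>k. w k x)" by (simp add: convergent_LIMSEQ_iff)
    have "\<bar>lim (\<lambda>k. w k x) $ j $ i\<bar> \<le> L" for j i
      by (rule Lim_bounded[where M = 0, OF tendsto_rabs[OF tendsto_vec_nth[OF tendsto_vec_nth[OF
          l]]]])
        (simp add: hull_bd[OF w])
    then show "(\<lambda>k. w k x) \<longlonglongrightarrow> G x" using l by (simp add: G_def)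
  qed
  have key: "partial i (conv \<rho> F) x $ j = conv \<rho> G x $ j $ i"
    if sm: "smooth \<rho>" and supp: "\<And>x. s < norm x \<Longrightarrow> \<rho> x = 0" for \<rho> s x i j
  proof -
    note cont = smooth_continuous_on[OF sm]
    have [measurable]: "\<rho> \<in> borel_measurable borel" using cont
        by (rule borel_measurable_continuous_onI)
    have li: "locally_integrable f" if "f \<in> midpoint_hull v m" for f m
      using bounded_locally_integrable[OF hull_meas normK] hull_bd that by metis
    define \<Lambda> where "\<Lambda> f = conv \<rho> f x" for f :: "real ^ 'n \<Rightarrow> real ^ 'n ^ 'm"
    define c where "c = (\<chi> j i. partial i (conv \<rho> F) x $ j)"
    have intF: "integrable lborel (\<lambda>z. \<rho> (y - z) *\<^sub>R F z)" for y
      by (rule conv_integrable_local[OF cont supp continuous_locally_integrable[OF contF]])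
    \<comment> \<open>Translating the integration variable turns the averaged difference quotient of
      \<open>F\<close> into the difference quotient of \<open>conv \<rho> F\<close>, whose limit is
      a classical derivative.\<close>
    have shift: "conv \<rho> F (x + t) = (LINT z|lborel. \<rho> (x - z) *\<^sub>R F (z + t))"
      and shift_int: "integrable lborel (\<lambda>z. \<rho> (x - z) *\<^sub>R F (z + t))" for t
    proof -
      have d: "distr lborel borel ((+) t) = (lborel :: (real ^ 'n) measure)"
          by (rule lborel_distr_plus)
      have "conv \<rho> F (x + t) = (LINT z|distr lborel borel ((+) t). \<rho> (x + t - z) *\<^sub>R F z)"
        by (simp add: conv_def d)
      also have "\<dots> = (LINT z|lborel. \<rho> (x - z) *\<^sub>R F (z + t))"
        by (subst integral_distr) (simp_all add: add.commute)
      finally show "conv \<rho> F (x + t) = (LINT z|lborel. \<rho> (x - z) *\<^sub>R F (z + t))" .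
      have "integrable (distr lborel borel ((+) t)) (\<lambda>z. \<rho> (x + t - z) *\<^sub>R F z)"
        using intF[of "x + t"] by (simp add: d)
      then show "integrable lborel (\<lambda>z. \<rho> (x - z) *\<^sub>R F (z + t))"
        by (subst (asm) integrable_distr_eq) (simp_all add: add.commute)
    qed
    have \<Lambda>v: "\<Lambda> (v m) $ j $ i = (conv \<rho> F (x + h m *\<^sub>R axis i 1) $ j - conv \<rho> F x $ j) / h m"
        for m j i
    proof -
      have "integrable lborel (\<lambda>z. \<rho> (x - z) *\<^sub>R v m z)"
        by (rule conv_integrable_local[OF cont supp li[OF midpoint_hull.base[OF order_refl]]])
      then have "\<Lambda> (v m) $ j $ i = (LINT z|lborel. (\<rho> (x - z) *\<^sub>R v m z) $ j $ i)"
        unfolding \<Lambda>_def conv_def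
        by (subst integral_bounded_linear[where T = "\<lambda>A. A $ j $ i", symmetric])
          (auto intro: bounded_linear_compose[OF bounded_linear_vec_nth bounded_linear_vec_nth])
      also have "\<dots> = (LINT z|lborel. ((\<rho> (x - z) *\<^sub>R F (z +
          h m *\<^sub>R axis i 1)) $ j - (\<rho> (x - z) *\<^sub>R F (z + 0)) $ j) / h m)"
        by (simp add: v_def right_diff_distrib)
      also have "\<dots> = ((LINT z|lborel. \<rho> (x - z) *\<^sub>R F (z +
          h m *\<^sub>R axis i 1)) $ j - (LINT z|lborel. \<rho> (x - z) *\<^sub>R F (z + 0)) $ j) / h m"
        using shift_int[of "h m *\<^sub>R axis i 1"] shift_int[of 0]
        by (simp add: integral_bounded_linear[OF bounded_linear_vec_nth, symmetric]
            integrable_bounded_linear[OF bounded_linear_vec_nth] del: vector_scaleR_component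
                add_0_right)
      finally show ?thesis by (simp add: shift[of "h m *\<^sub>R axis i 1"] shift[of 0, simplified])
    qed
    have "(\<lambda>m. \<Lambda> (v m)) \<longlonglongrightarrow> c"
    proof (intro vec_tendstoI)
      fix j i
      have "((conv \<rho> F) has_derivative (\<lambda>k. \<Sum>i\<in>UNIV. k $ i *\<^sub>R partial i (conv \<rho> F) x)) (at x)"
        by (rule smooth_has_derivative[OF smooth_conv(1)[OF sm supp
            continuous_locally_integrable[OF contF]]])
      then have "((\<lambda>t. conv \<rho> F (x + t *\<^sub>R axis i 1) $ j) has_derivative
          (\<lambda>t. (\<Sum>k\<in>UNIV. (t *\<^sub>R axis i 1) $ k *\<^sub>R partial k (conv \<rho> F) x) $ j)) (at 0)"
        by (intro bounded_linear.has_derivative[OF bounded_linear_vec_nth]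
            has_derivative_compose[where g = "conv \<rho> F" and f = "\<lambda>t. x + t *\<^sub>R axis i 1"])
          (auto intro!: derivative_eq_intros)
      moreover have "(\<lambda>t. (\<Sum>k\<in>UNIV. (t *\<^sub>R axis i 1) $ k *\<^sub>R partial k (conv \<rho> F) x) $ j) =
          (*) (c $ j $ i)"
        by (rule ext) (simp add: c_def axis_def if_distrib[of "(*) _"] if_distrib[of "\<lambda>c. c *
            _"] cong: if_cong)
      ultimately have "((\<lambda>t. conv \<rho> F (x + t *\<^sub>R axis i 1) $ j) has_real_derivative c $ j $ i) (at
          0)"
        by (simp add: has_field_derivative_def)
      then have "((\<lambda>t. (conv \<rho> F (x + t *\<^sub>R axis i 1) $ j - conv \<rho> F x $ j) / t) \<longlongrightarrow> c $ j $ i) (at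
          0)"
        by (simp add: DERIV_def)
      then have "(\<lambda>m. (conv \<rho> F (x + h m *\<^sub>R axis i 1) $ j - conv \<rho> F x $ j) / h m) \<longlonglongrightarrow> c $ j $ i"
        by (rule filterlim_compose) (use h h_lim in \<open>auto simp: filterlim_at
            less_imp_neq[symmetric]\<close>)
      then show "(\<lambda>m. \<Lambda> (v m) $ j $ i) \<longlonglongrightarrow> c $ j $ i" by (simp add: \<Lambda>v)
    qed
    \<comment> \<open>Each \<open>w k\<close> comes from the tail starting at \<open>k\<close>, so
      the limit known for the difference quotients is also the limit for their convex
      combinations.\<close>
    have wc: "(\<lambda>k. \<Lambda> (w k)) \<longlonglongrightarrow> c"
    proof (rule LIMSEQ_I)
      fix e :: real assume "0 < e"
      then obtain N where N: "\<And>m. N \<le> m \<Longrightarrow> norm (\<Lambda> (v m) - c) < e / 2"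
        using LIMSEQ_D[OF \<open>(\<lambda>m. \<Lambda> (v m)) \<longlonglongrightarrow> c\<close>, of "e / 2"] by auto
      have "norm (\<Lambda> (w k) - c) < e" if "N \<le> k" for k
      proof -
        have "norm (\<Lambda> (w k) - c) \<le> e / 2"
        proof (rule midpoint_hull_functional_bound[OF w])
          fix f g assume fg: "f \<in> midpoint_hull v k" "g \<in> midpoint_hull v k"
          have "integrable lborel (\<lambda>z. \<rho> (x - z) *\<^sub>R f z)"
              "integrable lborel (\<lambda>z. \<rho> (x - z) *\<^sub>R g z)"
            using conv_integrable_local[OF cont supp li] fg by auto
          then have "(LINT z|lborel. (1 / 2) *\<^sub>R (\<rho> (x - z) *\<^sub>R f z + \<rho> (x - z) *\<^sub>R g z)) =
              (1 / 2) *\<^sub>R (\<Lambda> f + \<Lambda> g)"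
            by (simp add: \<Lambda>_def conv_def del: scaleR_add_right scaleR_half_double)
          moreover have "\<rho> (x - z) *\<^sub>R (1 / 2) *\<^sub>R (f z + g z) =
              (1 / 2) *\<^sub>R (\<rho> (x - z) *\<^sub>R f z + \<rho> (x - z) *\<^sub>R g z)" for z
            by (simp add: scaleR_add_right)
          ultimately show "\<Lambda> (\<lambda>x. (1 / 2) *\<^sub>R (f x + g x)) = (1 / 2) *\<^sub>R (\<Lambda> f + \<Lambda> g)"
            unfolding \<Lambda>_def conv_def by presburger
        qed (use N that in \<open>force intro: less_imp_le\<close>)
        then show ?thesis using \<open>0 < e\<close> by simp
      qed
      then show "\<exists>N. \<forall>k\<ge>N. norm (\<Lambda> (w k) - c) < e" by blast
    qed
    have "(\<lambda>k. \<Lambda> (w k)) \<longlonglongrightarrow> \<Lambda> G"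
      unfolding \<Lambda>_def conv_def
    proof (rule integral_dominated_convergence[where w = "\<lambda>z. norm (\<rho> (x - z)) * K"])
      have "integrable lborel (\<lambda>z. \<rho> (x - z) *\<^sub>R K)"
        by (rule conv_integrable_local[OF cont supp continuous_locally_integrable[OF
            continuous_on_const]])
      then show "integrable lborel (\<lambda>z. norm (\<rho> (x - z)) * K)"
        using integrable_norm[of lborel "\<lambda>z. \<rho> (x - z) *\<^sub>R K"] L by (simp add: abs_mult K_def)
      show "AE z in lborel. (\<lambda>k. \<rho> (x - z) *\<^sub>R w k z) \<longlonglongrightarrow> \<rho> (x - z) *\<^sub>R G z"
        using wG by eventually_elim (intro tendsto_intros)
      show "AE z in lborel. norm (\<rho> (x - z) *\<^sub>R w k z) \<le> norm (\<rho> (x - z)) * K" for k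
        by (intro AE_I2) (simp add: mult_left_mono normK hull_bd[OF w])
      show "(\<lambda>z. \<rho> (x - z) *\<^sub>R w k z) \<in> borel_measurable lborel" for k
        using hull_meas[OF w[of k]] by simp
    qed simp
    then have "\<Lambda> G = c" by (rule LIMSEQ_unique[OF _ wc])
    then show ?thesis by (simp add: \<Lambda>_def c_def)
  qed
  show thesis by (rule that[OF G_meas G_bd key])
qed

text \<open>Convergence in the mean gives pointwise convergence only along fast sequences. The
  kernels are therefore chosen with errors \<open>(1 / 2) ^ m\<close> on growing balls, which makes
  the errors summable almost everywhere.\<close>

lemma mollify_AE_tendsto:
  fixes f :: "real ^ 'n \<Rightarrow> 'b::euclidean_space"
  assumes f: "locally_integrable f"
  obtains \<rho> where "\<And>m. mollifier (inverse (real (Suc m))) (\<rho> m)"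
    "AE x in lborel. (\<lambda>m. conv (\<rho> m) f x) \<longlonglongrightarrow> f x"
proof -
  \<comment> \<open>Kernels of radius at most 1, evaluated at points with
    \<open>norm x \<le> m\<close>, do not notice a truncation at radius
    \<open>m + 1\<close>.\<close>
  define g where "g m x = indicator (cball 0 (real m + 1)) x *\<^sub>R f x" for m :: nat and x
  have g: "integrable lborel (g m)" for m
    using f by (simp add: g_def[abs_def] locally_integrable_def)
  have \<delta>: "\<exists>\<delta>>0. \<forall>r \<rho>. r < \<delta> \<longrightarrow> mollifier r \<rho> \<longrightarrow>
    integrable lborel (\<lambda>x. conv \<rho> (g m) x - g m x) \<and> (LINT x|lborel. norm (conv \<rho> (g m) x - g m x))
        \<le> (1 / 2) ^ m" for m
  proof -
    have "(0::real) < (1 / 2) ^ m" by simp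
    from mollify_L1[OF g this] show ?thesis by blast
  qed
  define Q where "Q m \<rho> \<longleftrightarrow> mollifier (inverse (real (Suc m))) \<rho> \<and>
      integrable lborel (\<lambda>x. conv \<rho> (g m) x - g m x) \<and>
     (LINT x|lborel. norm (conv \<rho> (g m) x - g m x)) \<le> (1 / 2) ^ m" for m \<rho>
  have "\<exists>\<rho>. Q m \<rho>" for m
  proof -
    obtain d where d: "d > 0" "\<And>r \<rho>. r < d \<Longrightarrow> mollifier r \<rho> \<Longrightarrow>
      integrable lborel (\<lambda>x. conv \<rho> (g m) x - g m x) \<and> (LINT x|lborel. norm (conv \<rho> (g m) x - g m
          x)) \<le> (1 / 2) ^ m"
      using \<delta>[of m] by blast
    define r where "r = min (d / 2) (inverse (real (Suc m)))"
    have r: "0 < r" "r < d" "r \<le> inverse (real (Suc m))"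
      using d(1) by (auto simp: r_def min_def)
    obtain \<rho> :: "real ^ 'n \<Rightarrow> real" where \<rho>: "mollifier r \<rho>" by (rule mollifier_exists[OF r(1)])
    then have "mollifier (inverse (real (Suc m))) \<rho>"
      using r(3) unfolding mollifier_def by (meson order_trans)
    then show ?thesis using d(2)[OF r(2) \<rho>] unfolding Q_def by blast
  qed
  then obtain \<rho> where "\<And>m. Q m (\<rho> m)" by metis
  then have \<rho>: "\<And>m. mollifier (inverse (real (Suc m))) (\<rho> m)"
    "\<And>m. integrable lborel (\<lambda>x. conv (\<rho> m) (g m) x - g m x)"
    "\<And>m. (LINT x|lborel. norm (conv (\<rho> m) (g m) x - g m x)) \<le> (1 / 2) ^ m"
    unfolding Q_def by auto
  have "AE x in lborel. summable (\<lambda>m. norm (conv (\<rho> m) (g m) x - g m x))"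
  proof (rule AE_summable_of_nn_integral_bound)
    show "summable (\<lambda>m. (1 / 2 :: real) ^ m)" by (intro summable_geometric) simp
    show "(\<lambda>x. norm (conv (\<rho> m) (g m) x - g m x)) \<in> borel_measurable lborel" for m
      using borel_measurable_integrable[OF integrable_norm[OF \<rho>(2)[of m]]] .
    show "(\<integral>\<^sup>+x. ennreal (norm (conv (\<rho> m) (g m) x - g m x)) \<partial>lborel) \<le> ennreal ((1 / 2) ^ m)" for m
      using \<rho>(3)[of m] by (subst nn_integral_eq_integral[OF integrable_norm[OF \<rho>(2)]]) (auto intro:
          ennreal_leI)
  qed auto
  then have "AE x in lborel. (\<lambda>m. conv (\<rho> m) f x) \<longlonglongrightarrow> f x"
  proof eventually_elim
    fix x assume "summable (\<lambda>m. norm (conv (\<rho> m) (g m) x - g m x))"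
    then have l: "(\<lambda>m. conv (\<rho> m) (g m) x - g m x) \<longlonglongrightarrow> 0"
      by (rule tendsto_norm_zero_cancel[OF summable_LIMSEQ_zero])
    have "conv (\<rho> m) (g m) x - g m x = conv (\<rho> m) f x - f x" if "nat \<lceil>norm x\<rceil> \<le> m" for m
    proof -
      have x: "norm x \<le> real m" using that by linarith
      have le: "inverse (real (Suc m)) \<le> 1"
        by (simp add: inverse_le_1_iff)
      have "\<rho> m z = 0" if "1 < norm z" for z
        using mollifierD(3)[OF \<rho>(1)[of m], of z] that le by linarith
      from conv_restrict[where \<rho> = "\<rho> m" and s = 1 and R = "real m" and f = f, OF this x]
      have "conv (\<rho> m) f x = conv (\<rho> m) (g m) x" by (simp add: g_def[abs_def])
      moreover have "g m x = f x" using x by (simp add: g_def indicator_def)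
      ultimately show ?thesis by simp
    qed
    then have "\<forall>\<^sub>F m in sequentially. conv (\<rho> m) (g m) x - g m x = conv (\<rho> m) f x - f x"
      unfolding eventually_sequentially by blast
    then have "(\<lambda>m. conv (\<rho> m) f x - f x) \<longlonglongrightarrow> 0" using l by (rule Lim_transform_eventually[rotated])
    then show "(\<lambda>m. conv (\<rho> m) f x) \<longlonglongrightarrow> f x" by (rule LIM_zero_cancel)
  qed
  with \<rho>(1) show thesis using that by blast
qed

text \<open>An average of values within \<open>K\<close> of \<open>c\<close> is itself within
  \<open>K\<close> of \<open>c\<close>. With \<open>c = F x\<close> this gives uniform closeness of
  the mollified map, with \<open>c = 0\<close> the preservation of entry bounds.\<close>

lemma conv_mollifier_diff_bound:
  fixes f :: "real ^ 'n \<Rightarrow> 'b::euclidean_space"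
  assumes \<rho>: "mollifier r \<rho>" and f: "locally_integrable f" "f \<in> borel_measurable borel"
    and bd: "\<And>y. norm (y - x) \<le> r \<Longrightarrow> norm (f y - c) \<le> K"
  shows "norm (conv \<rho> f x - c) \<le> K"
proof -
  note m = mollifierD[OF \<rho>]
  note [measurable] = m(6) f(2)
  have int: "integrable lborel (\<lambda>z. \<rho> (x - z) *\<^sub>R f z)"
    by (rule conv_integrable_local[OF smooth_continuous_on[OF m(1)] m(3) f(1)])
  have one: "(LINT z|lborel. \<rho> (x - z)) = 1"
    using integral_lborel_reflect[of \<rho> x] m(5) by simp
  then have one_int: "integrable lborel (\<lambda>z. \<rho> (x - z))"
    using not_integrable_integral_eq by fastforce
  have "conv \<rho> f x - c = (LINT z|lborel. \<rho> (x - z) *\<^sub>R (f z - c))"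
    using int one_int one by (simp add: conv_def scaleR_diff_right)
  also have "norm \<dots> \<le> (LINT z|lborel. \<rho> (x - z) * K)"
  proof (rule order_trans[OF integral_norm_bound integral_mono])
    show "integrable lborel (\<lambda>z. norm (\<rho> (x - z) *\<^sub>R (f z - c)))"
      using int one_int by (intro integrable_norm) (simp add: scaleR_diff_right)
    show "integrable lborel (\<lambda>z. \<rho> (x - z) * K)" using one_int by simp
    show "norm (\<rho> (x - z) *\<^sub>R (f z - c)) \<le> \<rho> (x - z) * K" for z
    proof (cases "norm (z - x) \<le> r")
      case True
      then show ?thesis using bd[OF True] m(2) by (simp add: mult_left_mono)
    next
      case False
      then show ?thesis using m(3)[of "x - z"] by (simp add: norm_minus_commute)
    qed
  qed
  also have "\<dots> = K" using one by simp
  finally show ?thesis .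
qed

text \<open>Mollifying \<open>F\<close> mollifies its weak Jacobian with the same kernel, so the
  Jacobians of the approximations converge almost everywhere. The bound is transferred entry by
  entry, which keeps the constant \<open>L\<close>.\<close>

lemma lipschitz_smooth_approximation:
  fixes F :: "real ^ 'n \<Rightarrow> real ^ 'm"
  assumes F: "component_lipschitz L F"
  obtains G :: "real ^ 'n \<Rightarrow> real ^ 'n ^ 'm" and Fm :: "nat \<Rightarrow> real ^ 'n \<Rightarrow> real ^ 'm" and K
  where "G \<in> borel_measurable borel" "\<And>x j i. \<bar>G x $ j $ i\<bar> \<le> L"
    "\<And>m. smooth (Fm m)" "\<And>x. (\<lambda>m. Fm m x) \<longlonglongrightarrow> F x" "\<And>m x. norm (Fm m x - F x) \<le> K"
    "\<And>m x i j. \<bar>partial i (Fm m) x $ j\<bar> \<le> L"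
    "AE x in lborel. \<forall>i j. (\<lambda>m. partial i (Fm m) x $ j) \<longlonglongrightarrow> G x $ j $ i"
proof -
  obtain G :: "real ^ 'n \<Rightarrow> real ^ 'n ^ 'm" where G: "G \<in> borel_measurable borel"
    "\<And>x j i. \<bar>G x $ j $ i\<bar> \<le> L"
    and GF: "\<And>\<rho> s x i j. smooth \<rho> \<Longrightarrow> (\<And>x. s < norm x \<Longrightarrow> \<rho> x = 0) \<Longrightarrow> partial i (conv \<rho> F) x $ j =
        conv \<rho> G x $ j $ i"
    using weak_jacobian_exists[OF F] by metis
  have "norm (G x) \<le> real CARD('m) * (real CARD('n) * L)" for x
    using G(2) by (rule norm_matrix_le)
  then have lG: "locally_integrable G" by (rule bounded_locally_integrable[OF G(1)])
  have cF: "continuous_on UNIV F" by (rule component_lipschitz_continuous[OF F])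
  have lF: "locally_integrable F" by (rule continuous_locally_integrable[OF cF])
  have mF: "F \<in> borel_measurable borel" by (rule borel_measurable_continuous_onI[OF cF])
  obtain \<rho> where \<rho>: "\<And>m. mollifier (inverse (real (Suc m))) (\<rho> m)"
    and lim: "AE x in lborel. (\<lambda>m. conv (\<rho> m) G x) \<longlonglongrightarrow> G x"
    using mollify_AE_tendsto[OF lG] by blast
  define Fm where "Fm m = conv (\<rho> m) F" for m
  note md = mollifierD[OF \<rho>]
  have p: "partial i (Fm m) x $ j = conv (\<rho> m) G x $ j $ i" for m x i j
    unfolding Fm_def by (rule GF[OF md(1) md(3)])
  define K where "K = real CARD('m) * L"
  have K: "0 \<le> K" using component_lipschitz_nonneg[OF F] by (simp add: K_def)
  have d: "norm (Fm m x - F x) \<le> K * inverse (real (Suc m))" for m x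
    unfolding Fm_def
  proof (rule conv_mollifier_diff_bound[OF \<rho> lF mF])
    fix y assume y: "norm (y - x) \<le> inverse (real (Suc m))"
    have "norm (F y - F x) \<le> K * norm (y - x)"
      unfolding K_def by (rule component_lipschitz_norm[OF F])
    also have "\<dots> \<le> K * inverse (real (Suc m))" by (intro mult_left_mono y K)
    finally show "norm (F y - F x) \<le> K * inverse (real (Suc m))" .
  qed
  show thesis
  proof (rule that[OF G])
    show "smooth (Fm m)" for m
      unfolding Fm_def by (rule smooth_conv(1)[OF md(1) md(3) lF])
    show "(\<lambda>m. Fm m x) \<longlonglongrightarrow> F x" for x
    proof (rule LIM_zero_cancel, rule Lim_null_comparison[OF always_eventually[OF allI[OF d]]])
      show "(\<lambda>m. K * inverse (real (Suc m))) \<longlonglongrightarrow> 0"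
        by (rule tendsto_mult_right_zero[OF LIMSEQ_inverse_real_of_nat])
    qed
    show "norm (Fm m x - F x) \<le> K" for m x
    proof (rule order_trans[OF d])
      show "K * inverse (real (Suc m)) \<le> K" using K by (intro mult_left_le) (auto simp:
          inverse_le_1_iff)
    qed
    show "\<bar>partial i (Fm m) x $ j\<bar> \<le> L" for m x i j
    proof -
      have m [measurable]: "(\<lambda>z. G z $ j $ i) \<in> borel_measurable borel"
        using borel_measurable_continuous_on[of "\<lambda>A::real ^ 'n ^ 'm. A $ j $ i", OF _ G(1)]
        by (simp add: continuous_on_component)
      have "integrable lborel (\<lambda>z. \<rho> m (x - z) *\<^sub>R G z)"
        by (rule conv_integrable_local[OF smooth_continuous_on[OF md(1)] md(3) lG])
      then have "conv (\<rho> m) G x $ j $ i = (LINT z|lborel. (\<rho> m (x - z) *\<^sub>R G z) $ j $ i)"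
        unfolding conv_def
        by (subst integral_bounded_linear[where T = "\<lambda>A. A $ j $ i", symmetric])
          (auto intro: bounded_linear_compose[OF bounded_linear_vec_nth bounded_linear_vec_nth])
      also have "\<dots> = conv (\<rho> m) (\<lambda>z. G z $ j $ i) x" by (simp add: conv_def)
      finally have "partial i (Fm m) x $ j = conv (\<rho> m) (\<lambda>z. G z $ j $ i) x - 0" by (simp add: p)
      moreover have "norm (conv (\<rho> m) (\<lambda>z. G z $ j $ i) x - 0) \<le> L"
        by (rule conv_mollifier_diff_bound[OF \<rho> bounded_locally_integrable[OF m] m]) (use G(2) in
            auto)
      ultimately show ?thesis by simp
    qed
    show "AE x in lborel. \<forall>i j. (\<lambda>m. partial i (Fm m) x $ j) \<longlonglongrightarrow> G x $ j $ i"
      using lim unfolding p by eventually_elim (intro allI tendsto_vec_nth)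
  qed
qed

subsection \<open>The weak exterior derivative\<close>

definition grad :: "(real ^ 'n \<Rightarrow> real) \<Rightarrow> real ^ 'n \<Rightarrow> real ^ 'n" where
  "grad u x = (\<chi> i. partial i u x)"

definition global_test_form :: "nat \<Rightarrow> 'n::finite form \<Rightarrow> bool" where
  "global_test_form m \<phi> \<longleftrightarrow> smooth \<phi> \<and> (\<forall>x. homog m (\<phi> x)) \<and> (\<exists>R. \<forall>x. R < norm x \<longrightarrow> \<phi> x = 0)"

lemma test_form_global: "test_form W m \<phi> \<Longrightarrow> global_test_form m \<phi>"
proof -
  assume t: "test_form W m \<phi>"
  then have "bounded (closure {x. \<phi> x \<noteq> 0})"
    by (simp add: test_form_def compact_imp_bounded)
  then obtain R where "\<forall>x\<in>closure {x. \<phi> x \<noteq> 0}. norm x \<le> R" by (auto simp: bounded_iff)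
  then have "\<forall>x. R < norm x \<longrightarrow> \<phi> x = 0"
    using closure_subset[of "{x. \<phi> x \<noteq> 0}"] by force
  with t show ?thesis
    by (auto simp: global_test_form_def test_form_def is_form_def homog_def)
qed

lemma partial_sum:
  assumes "finite I" "\<And>i. i \<in> I \<Longrightarrow> f i differentiable (at x)"
  shows "partial j (\<lambda>x. \<Sum>i\<in>I. f i x) x = (\<Sum>i\<in>I. partial j (f i) x)"
  using assms
proof (induction I rule: finite_induct)
  case empty
  then show ?case by (simp add: partial_eqI[OF has_derivative_const])
next
  case (insert i I)
  then show ?case by (simp add: partial_add differentiable_sum)
qed

text \<open>In this form the identities for \<open>ext_deriv\<close> follow from the algebra of
  \<open>lw\<close> and the calculus of \<open>partial\<close>.\<close>

lemma ext_deriv_lw: "ext_deriv \<phi> x = (\<Sum>i\<in>UNIV. lw (axis i 1) (partial i \<phi> x))"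
proof -
  have "ext_deriv \<phi> x $ K = (\<Sum>i\<in>UNIV. lw (axis i 1) (partial i \<phi> x) $ K)" for K
  proof -
    have "(\<Sum>i\<in>UNIV. lw (axis i 1) (partial i \<phi> x) $ K) =
        (\<Sum>i\<in>K. merge_sign {i} (K - {i}) * partial i \<phi> x $ (K - {i}))"
    proof (intro sum.mono_neutral_cong_right ballI)
      fix i assume "i \<in> UNIV - K"
      then show "lw (axis i 1) (partial i \<phi> x) $ K = 0"
        unfolding lw_def vec_lambda_beta by (intro sum.neutral) (auto simp: axis_def)
    next
      fix i assume i: "i \<in> K"
      have "lw (axis i 1) (partial i \<phi> x) $ K =
          (\<Sum>j\<in>K. if j = i then merge_sign {i} (K - {i}) * partial i \<phi> x $ (K - {i}) else 0)"
        unfolding lw_def vec_lambda_beta by (rule sum.cong) (auto simp: axis_def)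
      then show "lw (axis i 1) (partial i \<phi> x) $ K = merge_sign {i} (K - {i}) *
          partial i \<phi> x $ (K - {i})"
        using i by simp
    qed auto
    then show ?thesis by (simp add: ext_deriv_def)
  qed
  then show ?thesis by (simp add: vec_eq_iff)
qed

lemma homog_partial:
  assumes "smooth \<phi>" "\<And>x. homog m (\<phi> x)"
  shows "homog m (partial i \<phi> x)"
  unfolding homog_def
proof (intro allI impI)
  fix I :: "'b set" assume I: "card I \<noteq> m"
  have "partial i \<phi> x $ I = partial i (\<lambda>x. \<phi> x $ I) x"
    by (rule partial_bounded_linear[OF bounded_linear_vec_nth smooth_differentiable[OF assms(1)],
        symmetric])
  also have "(\<lambda>x. \<phi> x $ I) = (\<lambda>x. 0)" using assms(2) I by (auto simp: homog_def)
  finally show "partial i \<phi> x $ I = 0" by (simp add: partial_eqI[OF has_derivative_const])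
qed

lemma bounded_linear_lw: "bounded_linear (lw u)"
  by (rule bounded_bilinear.bounded_linear_right[OF bounded_bilinear_lw])

lemma smooth_ext_deriv: "smooth \<phi> \<Longrightarrow> smooth (ext_deriv \<phi>)"
  unfolding ext_deriv_lw[abs_def]
  by (intro smooth_sum smooth_bounded_linear[OF bounded_linear_lw] smooth_partial) auto

lemma global_test_form_ext_deriv:
  assumes "global_test_form m \<phi>"
  shows "global_test_form (Suc m) (ext_deriv \<phi>)"
proof -
  obtain R where R: "\<And>x. R < norm x \<Longrightarrow> \<phi> x = 0" using assms by (auto simp: global_test_form_def)
  have "ext_deriv \<phi> x = 0" if "R < norm x" for x
    using partial_support[where \<rho> = \<phi> and s = R, OF R that]
        by (simp add: ext_deriv_lw lw.zero_right)
  moreover have "homog (Suc m) (ext_deriv \<phi> x)" for x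
    unfolding ext_deriv_lw using assms by (intro homog_sum homog_lw homog_partial) (auto simp:
        global_test_form_def)
  ultimately show ?thesis
    using assms smooth_ext_deriv by (auto simp: global_test_form_def)
qed

text \<open>Mixed partial derivatives are symmetric and \<open>lw\<close> is antisymmetric, so
  exchanging the two summation indices shows that the double sum equals its negative.\<close>

lemma ext_deriv_ext_deriv:
  assumes "smooth \<phi>"
  shows "ext_deriv (ext_deriv \<phi>) x = 0"
proof -
  let ?e = "\<lambda>i. axis i (1::real)"
  have "partial i (ext_deriv \<phi>) x = (\<Sum>j\<in>UNIV. lw (?e j) (partial i (partial j \<phi>) x))" for i
  proof -
    have "partial i (ext_deriv \<phi>) x = (\<Sum>j\<in>UNIV. partial i (\<lambda>x. lw (?e j) (partial j \<phi> x)) x)"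
      unfolding ext_deriv_lw[abs_def]
      by (rule partial_sum) (auto intro!: smooth_differentiable smooth_bounded_linear[OF
          bounded_linear_lw] smooth_partial assms)
    then show ?thesis
      by (simp add: partial_bounded_linear[OF bounded_linear_lw smooth_differentiable[OF
          smooth_partial[OF assms]]])
  qed
  then have e: "ext_deriv (ext_deriv \<phi>) x = (\<Sum>i\<in>UNIV. \<Sum>j\<in>UNIV. lw (?e i) (lw (?e j) (partial i
      (partial j \<phi>) x)))"
    by (simp add: ext_deriv_lw[of "ext_deriv \<phi>"] lw.sum_right)
  also have "\<dots> = (\<Sum>i\<in>UNIV. \<Sum>j\<in>UNIV. - lw (?e j) (lw (?e i) (partial j (partial i \<phi>) x)))"
    by (intro sum.cong refl) (subst lw_anticommute, simp add: smooth_partial_commute[OF assms])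
  also have "\<dots> = - (\<Sum>j\<in>UNIV. \<Sum>i\<in>UNIV. lw (?e j) (lw (?e i) (partial j (partial i \<phi>) x)))"
    by (subst sum.swap) (simp add: sum_negf)
  finally show ?thesis using e by (simp add: vec_eq_iff)
qed

lemma ext_deriv_scaleR:
  assumes u: "smooth u" and \<phi>: "smooth \<phi>"
  shows "ext_deriv (\<lambda>x. u x *\<^sub>R \<phi> x) x = u x *\<^sub>R ext_deriv \<phi> x + lw (grad u x) (\<phi> x)"
proof -
  have "grad u x = (\<Sum>i\<in>UNIV. partial i u x *\<^sub>R axis i 1)"
    using basis_expansion[of "grad u x"] by (simp add: grad_def scalar_mult_eq_scaleR)
  then show ?thesis
    by (simp add: ext_deriv_lw partial_bilinear[OF bounded_bilinear_scaleR smooth_differentiable[OF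
        u] smooth_differentiable[OF \<phi>]]
        lw_add_right lw_scaleR_right sum.distrib lw.sum_left lw_scaleR_left scaleR_sum_right)
qed

lemma global_test_form_scaleR:
  assumes "smooth u" "global_test_form m \<phi>"
  shows "global_test_form m (\<lambda>x. u x *\<^sub>R \<phi> x)"
  using assms by (auto simp: global_test_form_def intro: smooth_scaleR homog_scaleR)

section \<open>Product rules for the weak differential\<close>

lemma wedge_top_integrable:
  fixes \<alpha> \<phi> :: "'n::{finite,linorder} form"
  assumes \<alpha>: "locally_integrable \<alpha>" "\<alpha> \<in> borel_measurable borel"
    and \<phi>: "continuous_on UNIV \<phi>" "\<And>x. R < norm x \<Longrightarrow> \<phi> x = 0"
  shows "integrable lborel (\<lambda>x. wedge_top (\<alpha> x) (\<phi> x))"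
proof -
  obtain M where M: "0 \<le> M" "\<And>x. norm (\<phi> x) \<le> M" using compact_support_bounded[OF \<phi>] by blast
  obtain K where K: "0 \<le> K" "\<And>a b :: (real, 'n set) vec. norm (wedge_top a b) \<le> norm a * norm b * K"
    using wedge_top.nonneg_bounded by blast
  note [measurable] = \<alpha>(2) borel_measurable_continuous_onI[OF \<phi>(1)]
  have m: "(\<lambda>x. wedge_top (\<alpha> x) (\<phi> x)) \<in> borel_measurable borel"
    by (rule borel_measurable_continuous_Pair) (auto intro!: continuous_intros
        bounded_bilinear.continuous_on[OF bounded_bilinear_wedge_top])
  show ?thesis
  proof (rule Bochner_Integration.integrable_bound[where f =
      "\<lambda>x. (M * K) *\<^sub>R (indicator (cball 0 R) x *\<^sub>R \<alpha> x)"])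
    show "integrable lborel (\<lambda>x. (M * K) *\<^sub>R (indicator (cball 0 R) x *\<^sub>R \<alpha> x))"
      using \<alpha>(1) unfolding locally_integrable_def by (intro integrable_scaleR_right) auto
    show "AE x in lborel. norm (wedge_top (\<alpha> x) (\<phi> x)) \<le>
        norm ((M * K) *\<^sub>R (indicator (cball 0 R) x *\<^sub>R \<alpha> x))"
    proof (rule AE_I2)
      fix x
      have "norm (wedge_top (\<alpha> x) (\<phi> x)) \<le> norm (\<alpha> x) * M * K"
        by (rule order_trans[OF K(2)]) (intro mult_right_mono mult_left_mono M K norm_ge_zero)
      then show "norm (wedge_top (\<alpha> x) (\<phi> x)) \<le> norm ((M *
          K) *\<^sub>R (indicator (cball 0 R) x *\<^sub>R \<alpha> x))"
        using \<phi>(2)[of x] M K by (cases "norm x \<le> R") (auto simp: indicator_def abs_mult mult_ac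
            wedge_top.zero_right)
    qed
  qed (use m in simp)
qed

text \<open>The analogue of \<open>weak_d\<close> on the whole space, with \<open>lborel\<close> in
  place of Lebesgue measure. Smooth forms pulled back by an extended map are treated here, where no
  domain intervenes.\<close>

definition weak_ext_deriv :: "nat \<Rightarrow> 'n::{finite,linorder} form \<Rightarrow> 'n form \<Rightarrow> bool" where
  "weak_ext_deriv k \<alpha> \<beta> \<longleftrightarrow> (\<forall>m \<phi>. m + k + 1 = CARD('n) \<longrightarrow> global_test_form m \<phi> \<longrightarrow>
     (LINT x|lborel. wedge_top (\<alpha> x) (ext_deriv \<phi> x)) =
         (- 1) ^ (k + 1) * (LINT x|lborel. wedge_top (\<beta> x) (\<phi> x)))"

lemma global_test_formE:
  assumes "global_test_form m \<phi>"
  obtains R where "smooth \<phi>" "\<And>x. homog m (\<phi> x)" "continuous_on UNIV \<phi>" "\<And>x. R < norm x \<Longrightarrow> \<phi> x = 0"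
    "continuous_on UNIV (ext_deriv \<phi>)" "\<And>x. R < norm x \<Longrightarrow> ext_deriv \<phi> x = 0"
proof -
  obtain R where R: "\<And>x. R < norm x \<Longrightarrow> \<phi> x = 0" "smooth \<phi>" "\<And>x. homog m (\<phi> x)"
    using assms by (auto simp: global_test_form_def)
  have "ext_deriv \<phi> x = 0" if "R < norm x" for x
    using partial_support[where \<rho> = \<phi> and s = R, OF R(1) that]
        by (simp add: ext_deriv_lw lw.zero_right)
  then show thesis
    using that R smooth_continuous_on smooth_ext_deriv by blast
qed

text \<open>The form \<alpha> is tested with \<open>u x *\<^sub>R \<phi> x\<close>, whose
  differential splits by the Leibniz rule; \<open>wedge_top_lw\<close> moves the gradient of
  \<open>u\<close> from \<phi> to \<alpha>.\<close>

lemma weak_ext_deriv_smooth_product: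
  assumes \<alpha>: "locally_integrable \<alpha>" "\<alpha> \<in> borel_measurable borel" "\<And>x. homog k (\<alpha> x)"
    and \<beta>: "locally_integrable \<beta>" "\<beta> \<in> borel_measurable borel"
    and w: "weak_ext_deriv k \<alpha> \<beta>" and u: "smooth u"
    and m: "m + k + 1 = CARD('n)" and \<phi>: "global_test_form m (\<phi> :: 'n::{finite,linorder} form)"
  shows "(LINT x|lborel. wedge_top (u x *\<^sub>R \<alpha> x) (ext_deriv \<phi> x)) =
    (- 1) ^ (k + 1) * ((LINT x|lborel. wedge_top (lw (grad u x) (\<alpha> x)) (\<phi> x)) +
        (LINT x|lborel. wedge_top (u x *\<^sub>R \<beta> x) (\<phi> x)))"
proof -
  obtain R where \<phi>': "smooth \<phi>" "continuous_on UNIV \<phi>" "\<And>x. R < norm x \<Longrightarrow> \<phi> x = 0"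
    "continuous_on UNIV (ext_deriv \<phi>)" "\<And>x. R < norm x \<Longrightarrow> ext_deriv \<phi> x = 0"
    using global_test_formE[OF \<phi>] by metis
  have cu: "continuous_on UNIV u" by (rule smooth_continuous_on[OF u])
  have cg: "continuous_on UNIV (grad u)"
    unfolding grad_def by (intro continuous_intros smooth_continuous_on smooth_partial u)
  have i1: "integrable lborel (\<lambda>x. wedge_top (\<alpha> x) (u x *\<^sub>R ext_deriv \<phi> x))"
    by (rule wedge_top_integrable[OF \<alpha>(1,2), where R = R]) (auto intro!: continuous_intros cu \<phi>')
  have i2: "integrable lborel (\<lambda>x. wedge_top (\<alpha> x) (lw (grad u x) (\<phi> x)))"
    by (rule wedge_top_integrable[OF \<alpha>(1,2), where R = R])
      (auto intro!: bounded_bilinear.continuous_on[OF bounded_bilinear_lw] cg \<phi>'(2) simp: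
          lw.zero_right \<phi>'(3))
  have "(LINT x|lborel. wedge_top (\<alpha> x) (ext_deriv (\<lambda>x. u x *\<^sub>R \<phi> x) x)) =
      (- 1) ^ (k + 1) * (LINT x|lborel. wedge_top (\<beta> x) (u x *\<^sub>R \<phi> x))"
    using w m global_test_form_scaleR[OF u \<phi>] unfolding weak_ext_deriv_def by blast
  moreover have "(LINT x|lborel. wedge_top (\<alpha> x) (ext_deriv (\<lambda>x. u x *\<^sub>R \<phi> x) x)) =
     (LINT x|lborel. wedge_top (\<alpha> x) (u x *\<^sub>R ext_deriv \<phi> x)) +
         (LINT x|lborel. wedge_top (\<alpha> x) (lw (grad u x) (\<phi> x)))"
    unfolding ext_deriv_scaleR[OF u \<phi>'(1)] wedge_top.add_right
    by (rule Bochner_Integration.integral_add[OF i1 i2])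
  moreover have "wedge_top (lw (grad u x) (\<alpha> x)) (\<phi> x) =
      (- 1) ^ k * wedge_top (\<alpha> x) (lw (grad u x) (\<phi> x))" for x
    by (rule wedge_top_lw[OF \<alpha>(3)])
  ultimately show ?thesis
    by (simp add: wedge_top.scaleR_left wedge_top.scaleR_right algebra_simps minus_one_power_iff)
qed

lemma AE_bound_integrable_limit:
  fixes s :: "nat \<Rightarrow> real ^ 'n \<Rightarrow> real"
  assumes "\<And>m. s m \<in> borel_measurable borel" "f \<in> borel_measurable borel"
    and "AE x in lborel. (\<lambda>m. s m x) \<longlonglongrightarrow> f x"
    and "\<And>m x. norm x \<le> R \<Longrightarrow> \<bar>s m x\<bar> \<le> K" "\<And>m x. R < norm x \<Longrightarrow> s m x = 0"
  shows "(\<lambda>m. LINT x|lborel. s m x) \<longlonglongrightarrow> (LINT x|lborel. f x)"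
proof (rule integral_dominated_convergence[where w = "\<lambda>x. K * indicator (cball 0 R) x"])
  show "integrable lborel (\<lambda>x. K * indicator (cball (0::real ^ 'n) R) x)"
    using emeasure_bounded_finite[OF bounded_cball[of "0::real ^ 'n" R]]
        by (intro integrable_mult_right) simp
  show "AE x in lborel. norm (s m x) \<le> K * indicator (cball 0 R) x" for m
    using assms(4,5) by (intro AE_I2) (auto simp: indicator_def)
qed (use assms in auto)

lemma borel_measurable_bilinear:
  fixes f :: "'a \<Rightarrow> 'b::euclidean_space" and g :: "'a \<Rightarrow> 'c::euclidean_space"
    and prd :: "'b \<Rightarrow> 'c \<Rightarrow> 'd::euclidean_space"
  assumes "bounded_bilinear prd" "f \<in> borel_measurable M" "g \<in> borel_measurable M"
  shows "(\<lambda>x. prd (f x) (g x)) \<in> borel_measurable M"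
  by (rule borel_measurable_continuous_Pair[OF assms(2,3)])
    (auto intro!: bounded_bilinear.continuous_on[OF assms(1)] continuous_intros)

text \<open>The product rule for the smooth \<open>um m\<close> passes to the limit in three
  integrals. Each is dominated on a ball that contains the support of the test form, and
  \<open>g\<close> takes the role of the gradient of \<open>u\<close>.\<close>

lemma weak_ext_deriv_product:
  fixes \<alpha> \<beta> :: "'n::{finite,linorder} form"
  assumes \<alpha>: "\<alpha> \<in> borel_measurable borel" "\<And>x. norm (\<alpha> x) \<le> Ka" "\<And>x. homog k (\<alpha> x)"
    and \<beta>: "\<beta> \<in> borel_measurable borel" "\<And>x. norm (\<beta> x) \<le> Kb"
    and w: "weak_ext_deriv k \<alpha> \<beta>"
    and um: "\<And>m. smooth (um m)" "\<And>x. (\<lambda>m. um m x) \<longlonglongrightarrow> u x"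
      "\<And>R. \<exists>c. \<forall>m x. norm x \<le> R \<longrightarrow> \<bar>um m x\<bar> \<le> c"
      "\<And>m x. norm (grad (um m) x) \<le> L"
    and g: "g \<in> borel_measurable borel" "AE x in lborel. (\<lambda>m. grad (um m) x) \<longlonglongrightarrow> g x"
  shows "weak_ext_deriv k (\<lambda>x. u x *\<^sub>R \<alpha> x) (\<lambda>x. lw (g x) (\<alpha> x) + u x *\<^sub>R \<beta> x)"
  unfolding weak_ext_deriv_def
proof (intro allI impI)
  fix m \<phi> assume m: "m + k + 1 = CARD('n)" and \<phi>: "global_test_form m (\<phi> :: 'n form)"
  obtain R where \<phi>': "smooth \<phi>" "continuous_on UNIV \<phi>" "\<And>x. R < norm x \<Longrightarrow> \<phi> x = 0"
    "continuous_on UNIV (ext_deriv \<phi>)" "\<And>x. R < norm x \<Longrightarrow> ext_deriv \<phi> x = 0"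
    using global_test_formE[OF \<phi>] by metis
  obtain M1 where M1: "0 \<le> M1" "\<And>x. norm (\<phi> x) \<le> M1" using compact_support_bounded[OF \<phi>'(2,3)]
      by blast
  obtain M2 where M2: "0 \<le> M2" "\<And>x. norm (ext_deriv \<phi> x) \<le> M2"
      using compact_support_bounded[OF \<phi>'(4,5)] by blast
  obtain c where c: "\<And>m x. norm x \<le> R \<Longrightarrow> \<bar>um m x\<bar> \<le> c" using um(3) by meson
  obtain K where K: "0 \<le> K" "\<And>a b :: (real, 'n set) vec. norm (wedge_top a b) \<le> norm a * norm b * K"
    using wedge_top.nonneg_bounded by blast
  obtain K' where K': "0 \<le> K'" "\<And>(a :: (real, 'n) vec) b. norm (lw a b) \<le> norm a * norm b * K'"
    using lw.nonneg_bounded by blast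
  have wt: "\<bar>wedge_top a b\<bar> \<le> A * D * K" if "norm a \<le> A" "norm b \<le> D"
      for a b :: "(real, 'n set) vec" and A D
  proof -
    have "norm a * norm b * K \<le> A * D * K"
      by (intro mult_right_mono mult_mono that K(1) norm_ge_zero order_trans[OF norm_ge_zero
          that(1)])
    then show ?thesis using K(2)[of a b] by simp
  qed
  have sc: "norm (t *\<^sub>R a) \<le> A * D" if "\<bar>t\<bar> \<le> A" "norm a \<le> D"
      for a :: "(real, 'n set) vec" and t A D
    unfolding norm_scaleR by (intro mult_mono that norm_ge_zero order_trans[OF abs_ge_zero that(1)])
  have Ka: "0 \<le> Ka" and Kb: "0 \<le> Kb" and L: "0 \<le> L" 
    using \<alpha>(2) \<beta>(2) um(4) norm_ge_zero order_trans by blast+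
  have um_meas: "um m \<in> borel_measurable borel" for m
    by (rule borel_measurable_continuous_onI[OF smooth_continuous_on[OF um(1)]])
  have u_meas: "u \<in> borel_measurable borel"
    by (rule borel_measurable_LIMSEQ_metric[OF um_meas um(2)])
  have gm: "grad (um m) \<in> borel_measurable borel" for m
  proof (rule borel_measurable_continuous_onI)
    show "continuous_on UNIV (grad (um m))"
      unfolding grad_def by (intro continuous_intros smooth_continuous_on smooth_partial um)
  qed
  note meas = borel_measurable_bilinear[OF bounded_bilinear_wedge_top] borel_measurable_bilinear[OF
      bounded_bilinear_lw]
    borel_measurable_scaleR um_meas u_meas gm \<alpha>(1) \<beta>(1) g(1) borel_measurable_continuous_onI[OF
        \<phi>'(2)]
    borel_measurable_continuous_onI[OF \<phi>'(4)]
  have l\<alpha>: "locally_integrable \<alpha>" by (rule bounded_locally_integrable[OF \<alpha>(1,2)])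
  have l\<beta>: "locally_integrable \<beta>" by (rule bounded_locally_integrable[OF \<beta>])
  have 1: "(\<lambda>m. LINT x|lborel. wedge_top (um m x *\<^sub>R \<alpha> x) (ext_deriv \<phi> x)) \<longlonglongrightarrow>
      (LINT x|lborel. wedge_top (u x *\<^sub>R \<alpha> x) (ext_deriv \<phi> x))"
  proof (rule AE_bound_integrable_limit[where R = R and K = "(c * Ka) * M2 * K"])
    show "AE x in lborel. (\<lambda>m. wedge_top (um m x *\<^sub>R \<alpha> x) (ext_deriv \<phi> x)) \<longlonglongrightarrow>
        wedge_top (u x *\<^sub>R \<alpha> x) (ext_deriv \<phi> x)"
      by (intro AE_I2 wedge_top.tendsto tendsto_intros um)
    show "\<bar>wedge_top (um m x *\<^sub>R \<alpha> x) (ext_deriv \<phi> x)\<bar> \<le> (c * Ka) * M2 * K" if "norm x \<le> R" for m x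
      by (intro wt sc c that \<alpha> M2)
  qed (simp_all add: \<phi>' wedge_top.zero_right meas)
  have 2: "(\<lambda>m. LINT x|lborel. wedge_top (um m x *\<^sub>R \<beta> x) (\<phi> x)) \<longlonglongrightarrow>
      (LINT x|lborel. wedge_top (u x *\<^sub>R \<beta> x) (\<phi> x))"
  proof (rule AE_bound_integrable_limit[where R = R and K = "(c * Kb) * M1 * K"])
    show "AE x in lborel. (\<lambda>m. wedge_top (um m x *\<^sub>R \<beta> x) (\<phi> x)) \<longlonglongrightarrow> wedge_top (u x *\<^sub>R \<beta> x) (\<phi> x)"
      by (intro AE_I2 wedge_top.tendsto tendsto_intros um)
    show "\<bar>wedge_top (um m x *\<^sub>R \<beta> x) (\<phi> x)\<bar> \<le> (c * Kb) * M1 * K" if "norm x \<le> R" for m x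
      by (intro wt sc c that \<beta> M1)
  qed (simp_all add: \<phi>' wedge_top.zero_right meas)
  have 3: "(\<lambda>m. LINT x|lborel. wedge_top (lw (grad (um m) x) (\<alpha> x)) (\<phi> x)) \<longlonglongrightarrow>
      (LINT x|lborel. wedge_top (lw (g x) (\<alpha> x)) (\<phi> x))"
  proof (rule AE_bound_integrable_limit[where R = R and K = "(L * Ka * K') * M1 * K"])
    show "AE x in lborel. (\<lambda>m. wedge_top (lw (grad (um m) x) (\<alpha> x)) (\<phi> x)) \<longlonglongrightarrow>
        wedge_top (lw (g x) (\<alpha> x)) (\<phi> x)"
      using g(2) by eventually_elim (intro wedge_top.tendsto lw.tendsto tendsto_intros)
    show "\<bar>wedge_top (lw (grad (um m) x) (\<alpha> x)) (\<phi> x)\<bar> \<le> (L * Ka * K') * M1 * K" for m x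
    proof -
      have "norm (lw (grad (um m) x) (\<alpha> x)) \<le> L * Ka * K'"
        by (rule order_trans[OF K'(2)]) (intro mult_mono um \<alpha> K' mult_nonneg_nonneg L Ka
            norm_ge_zero order_refl)
      then show ?thesis by (intro wt M1)
    qed
  qed (simp_all add: \<phi>' wedge_top.zero_right meas)
  have "(LINT x|lborel. wedge_top (u x *\<^sub>R \<alpha> x) (ext_deriv \<phi> x)) =
    (- 1) ^ (k + 1) * ((LINT x|lborel. wedge_top (lw (g x) (\<alpha> x)) (\<phi> x)) +
        (LINT x|lborel. wedge_top (u x *\<^sub>R \<beta> x) (\<phi> x)))"
    by (rule LIMSEQ_unique[OF 1], unfold weak_ext_deriv_smooth_product[OF l\<alpha> \<alpha>(1,3) l\<beta> \<beta>(1) w um(1)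
        m \<phi>])
      (intro tendsto_mult tendsto_add 2 3 tendsto_const)
  moreover have "(LINT x|lborel. wedge_top (lw (g x) (\<alpha> x)) (\<phi> x)) +
      (LINT x|lborel. wedge_top (u x *\<^sub>R \<beta> x) (\<phi> x)) =
      (LINT x|lborel. wedge_top (lw (g x) (\<alpha> x) + u x *\<^sub>R \<beta> x) (\<phi> x))"
    unfolding wedge_top.add_left
  proof (rule Bochner_Integration.integral_add[symmetric])
    \<comment> \<open>The limit \<open>g\<close> inherits the bound \<open>L\<close> only almost
      everywhere. Truncation restores it everywhere, so that the integrability lemma for bounded
      forms applies.\<close>
    let ?g = "\<lambda>x. if norm (g x) \<le> L then g x else 0"
    have gb: "?g \<in> borel_measurable borel"
      using g(1) by (intro measurable_If) (simp_all add: measurable_compose[OF _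
          borel_measurable_norm])
    have AEg: "AE x in lborel. g x = ?g x"
      using g(2)
    proof eventually_elim
      fix x assume "(\<lambda>m. grad (um m) x) \<longlonglongrightarrow> g x"
      then have "norm (g x) \<le> L"
        by (intro Lim_bounded[where M = 0, OF tendsto_norm]) (auto simp: um(4))
      then show "g x = ?g x" by simp
    qed
    have gi: "integrable lborel (\<lambda>x. wedge_top (lw (?g x) (\<alpha> x)) (\<phi> x))"
    proof (rule wedge_top_integrable[OF bounded_locally_integrable _ \<phi>'(2,3)])
      show "norm (lw (?g x) (\<alpha> x)) \<le> L * Ka * K'" for x
        by (rule order_trans[OF K'(2)]) (intro mult_mono \<alpha> K' mult_nonneg_nonneg L Ka norm_ge_zero
            order_refl, simp add: L)
    qed (rule meas(2)[OF gb \<alpha>(1)])+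
    have ae: "AE x in lborel. wedge_top (lw (?g x) (\<alpha> x)) (\<phi> x) = wedge_top (lw (g x) (\<alpha> x)) (\<phi> x)"
      using AEg by eventually_elim simp
    show "integrable lborel (\<lambda>x. wedge_top (lw (g x) (\<alpha> x)) (\<phi> x))"
    proof (rule integrable_cong_AE_imp[OF gi _ ae])
      show "(\<lambda>x. wedge_top (lw (g x) (\<alpha> x)) (\<phi> x)) \<in> borel_measurable lborel"
        by (intro meas) (simp_all add: meas)
    qed
    show "integrable lborel (\<lambda>x. wedge_top (u x *\<^sub>R \<beta> x) (\<phi> x))"
    proof -
      have ub: "\<bar>u x\<bar> \<le> c" if "norm x \<le> R" for x
        by (rule Lim_bounded[where M = 0, OF tendsto_rabs[OF um(2)]]) (use c that in auto)
      \<comment> \<open>The function \<open>u\<close> is bounded on the ball containing the support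
        of \<phi>; cutting it off outside changes nothing in the integrand.\<close>
      let ?u = "\<lambda>x. if norm x \<le> R then u x else 0"
      have "integrable lborel (\<lambda>x. wedge_top (?u x *\<^sub>R \<beta> x) (\<phi> x))"
      proof (rule wedge_top_integrable[OF bounded_locally_integrable _ \<phi>'(2,3)])
        show "norm (?u x *\<^sub>R \<beta> x) \<le> max c 0 * Kb" for x
          by (rule sc[OF _ \<beta>(2)]) (use ub[of x] in auto)
        show "(\<lambda>x. ?u x *\<^sub>R \<beta> x) \<in> borel_measurable borel"
          by (intro borel_measurable_scaleR \<beta> measurable_If u_meas) simp_all
        then show "(\<lambda>x. ?u x *\<^sub>R \<beta> x) \<in> borel_measurable borel" .
      qed
      also have "(\<lambda>x. wedge_top (?u x *\<^sub>R \<beta> x) (\<phi> x)) = (\<lambda>x. wedge_top (u x *\<^sub>R \<beta> x) (\<phi> x))"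
        using \<phi>'(3) by (auto simp: fun_eq_iff wedge_top.zero_right)
      finally show ?thesis .
    qed
  qed
  ultimately show "(LINT x|lborel. wedge_top (u x *\<^sub>R \<alpha> x) (ext_deriv \<phi> x)) =
    (- 1) ^ (k + 1) * (LINT x|lborel. wedge_top (lw (g x) (\<alpha> x) + u x *\<^sub>R \<beta> x) (\<phi> x))"
    by simp
qed

text \<open>The identity \<open>d \<circ> d = 0\<close> is transferred from test forms:
  \<open>ext_deriv \<phi>\<close> is itself a test form, of degree one higher, and has differential
  0.\<close>

lemma weak_ext_deriv_closed:
  assumes "weak_ext_deriv k \<alpha> \<beta>"
  shows "weak_ext_deriv (Suc k) \<beta> (\<lambda>x. 0)"
  unfolding weak_ext_deriv_def
proof (intro allI impI)
  fix m and \<phi> :: "'a form" assume m: "m + Suc k + 1 = CARD('a)" and \<phi>: "global_test_form m \<phi>"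
  have "(LINT x|lborel. wedge_top (\<alpha> x) (ext_deriv (ext_deriv \<phi>) x)) =
      (- 1) ^ (k + 1) * (LINT x|lborel. wedge_top (\<beta> x) (ext_deriv \<phi> x))"
    by (rule assms[unfolded weak_ext_deriv_def, rule_format, OF _ global_test_form_ext_deriv[OF \<phi>]])
      (use m in simp)
  moreover have "ext_deriv (ext_deriv \<phi>) x = 0" for x
    using \<phi> by (simp add: ext_deriv_ext_deriv global_test_form_def)
  ultimately show "(LINT x|lborel. wedge_top (\<beta> x) (ext_deriv \<phi> x)) =
      (- 1) ^ (Suc k + 1) * (LINT x|lborel. wedge_top 0 (\<phi> x))"
    by (simp add: wedge_top.zero_right wedge_top.zero_left)
qed

text \<open>The convolution of \<open>f\<close> with the constant function 1 is constant. Its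
  partial derivative is thus 0, and it is also the convolution of \<open>partial i f\<close> with 1,
  which is the integral in question.\<close>

lemma integral_partial_zero:
  fixes f :: "real ^ 'n \<Rightarrow> real"
  assumes sm: "smooth f" and supp: "\<And>x. R < norm x \<Longrightarrow> f x = 0"
  shows "(LINT x|lborel. partial i f x) = 0"
proof -
  have one: "locally_integrable (\<lambda>x::real ^ 'n. 1::real)"
    by (intro continuous_locally_integrable continuous_on_const)
  have "f \<in> borel_measurable borel" "partial i f \<in> borel_measurable borel"
    by (auto intro!: borel_measurable_continuous_onI smooth_continuous_on smooth_partial sm)
  then have "conv f (\<lambda>x. 1::real) x = (LINT z|lborel. f z)"
    "conv (partial i f) (\<lambda>x. 1::real) x = (LINT z|lborel. partial i f z)" for x
    by (simp_all add: conv_def integral_lborel_reflect)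
  moreover from this(1) have "conv f (\<lambda>x. 1::real) = (\<lambda>x. (LINT z|lborel. f z))" by (rule ext)
  moreover have "partial i (conv f (\<lambda>x. 1::real)) 0 = conv (partial i f) (\<lambda>x. 1) 0"
    by (rule smooth_conv(2)[OF sm supp one])
  ultimately have "(LINT z|lborel. partial i f z) = partial i (\<lambda>x. (LINT z|lborel. f z)) 0"
    by simp
  then show ?thesis by (simp add: partial_eqI[OF has_derivative_const])
qed

text \<open>The divergence theorem for compactly supported smooth fields. It is the base case for
  the closedness of exterior products of Jacobian rows.\<close>

lemma weak_ext_deriv_one: "weak_ext_deriv 0 (\<lambda>x. axis {} 1) (\<lambda>x. 0)"
  unfolding weak_ext_deriv_def
proof (intro allI impI)
  fix m and \<phi> :: "'a form" assume m: "m + 0 + 1 = CARD('a)" and \<phi>: "global_test_form m \<phi>"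
  obtain R where \<phi>': "smooth \<phi>" "\<And>x. R < norm x \<Longrightarrow> \<phi> x = 0"
    using global_test_formE[OF \<phi>] by metis
  have w: "wedge_top (axis {} 1) b = b $ UNIV" for b :: "(real, 'a set) vec"
  proof -
    have "wedge_top (axis {} 1) b = (\<Sum>I\<in>UNIV. if I = ({} :: 'a set) then b $ UNIV else 0)"
      unfolding wedge_top_def by (rule sum.cong) (auto simp: axis_def merge_sign_def)
    then show ?thesis by simp
  qed
  have c: "smooth (\<lambda>x. \<phi> x $ I)" for I
    by (rule smooth_bounded_linear[OF bounded_linear_vec_nth \<phi>'(1)])
  have p: "partial i \<phi> x $ I = partial i (\<lambda>x. \<phi> x $ I) x" for i I x
    by (rule partial_bounded_linear[OF bounded_linear_vec_nth smooth_differentiable[OF \<phi>'(1)],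
        symmetric])
  have int: "integrable lborel (partial i (\<lambda>x. \<phi> x $ I))" for i I
    by (rule integrable_continuous_compact_support[where K = "cball 0 R"])
      (auto intro!: smooth_continuous_on smooth_partial c partial_support[where s = R] simp: \<phi>'(2))
  have "(LINT x|lborel. ext_deriv \<phi> x $ UNIV) =
      (\<Sum>i\<in>UNIV. merge_sign {i} (UNIV - {i}) * (LINT x|lborel. partial i (\<lambda>x. \<phi> x $ (UNIV - {i}))
          x))"
    by (simp add: ext_deriv_def p int)
  also have "\<dots> = 0"
  proof (intro sum.neutral ballI)
    fix i
    have "(LINT x|lborel. partial i (\<lambda>x. \<phi> x $ (UNIV - {i})) x) = 0"
      by (rule integral_partial_zero[where R = R, OF c]) (simp add: \<phi>'(2))
    then show "merge_sign {i} (UNIV - {i}) * (LINT x|lborel. partial i (\<lambda>x. \<phi> x $ (UNIV - {i})) x)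
        = 0" by simp
  qed
  finally show "(LINT x|lborel. wedge_top (axis {} 1) (ext_deriv \<phi> x)) =
      (- 1) ^ (0 + 1) * (LINT x|lborel. wedge_top 0 (\<phi> x))"
    by (simp add: w wedge_top.zero_left)
qed

section \<open>Bounded Borel forms and pullback of smooth forms\<close>

definition bounded_borel :: "('a::euclidean_space \<Rightarrow> 'b::euclidean_space) \<Rightarrow> bool" where
  "bounded_borel f \<longleftrightarrow> f \<in> borel_measurable borel \<and> (\<exists>K. \<forall>x. norm (f x) \<le> K)"

lemma bounded_borel_locally_integrable: "bounded_borel f \<Longrightarrow> locally_integrable f"
  unfolding bounded_borel_def using bounded_locally_integrable by blast

lemma bounded_borel_const: "bounded_borel (\<lambda>x. c)"
  by (auto simp: bounded_borel_def)

lemma bounded_borel_bilinear: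
  fixes prd :: "'b::euclidean_space \<Rightarrow> 'c::euclidean_space \<Rightarrow> 'd::euclidean_space"
  assumes b: "bounded_bilinear prd" and f: "bounded_borel f" and g: "bounded_borel g"
  shows "bounded_borel (\<lambda>x. prd (f x) (g x))"
proof -
  obtain A D where A: "\<And>x. norm (f x) \<le> A" and D: "\<And>x. norm (g x) \<le> D"
    using f g by (auto simp: bounded_borel_def)
  obtain K where K: "0 \<le> K" "\<And>a b. norm (prd a b) \<le> norm a * norm b * K"
    using bounded_bilinear.nonneg_bounded[OF b] by blast
  have "norm (prd (f x) (g x)) \<le> A * D * K" for x
    by (rule order_trans[OF K(2)])
      (intro mult_right_mono mult_mono A D K(1) norm_ge_zero order_trans[OF norm_ge_zero A])
  then show ?thesis
    using f g by (auto simp: bounded_borel_def intro: borel_measurable_bilinear[OF b])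
qed

lemma bounded_borel_add:
  assumes "bounded_borel f" "bounded_borel g"
  shows "bounded_borel (\<lambda>x. f x + g x)"
proof -
  obtain A D where A: "\<And>x. norm (f x) \<le> A" and D: "\<And>x. norm (g x) \<le> D"
    using assms by (auto simp: bounded_borel_def)
  have "norm (f x + g x) \<le> A + D" for x
    using norm_triangle_ineq[of "f x" "g x"] A[of x] D[of x] by linarith
  then show ?thesis using assms by (auto simp: bounded_borel_def)
qed

lemma bounded_borel_sum: "(\<And>i. i \<in> I \<Longrightarrow> bounded_borel (f i)) \<Longrightarrow> bounded_borel (\<lambda>x. \<Sum>i\<in>I. f i x)"
  by (induction I rule: infinite_finite_induct) (auto intro: bounded_borel_add bounded_borel_const)

lemma weak_ext_deriv_zero: "weak_ext_deriv k (\<lambda>x. 0) (\<lambda>x. 0)"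
  by (simp add: weak_ext_deriv_def wedge_top.zero_left)

lemma weak_ext_deriv_add:
  fixes \<alpha> \<beta> :: "'n::{finite,linorder} form"
  assumes "weak_ext_deriv k \<alpha> \<beta>" "weak_ext_deriv k \<alpha>' \<beta>'"
    and b: "bounded_borel \<alpha>" "bounded_borel \<beta>" "bounded_borel \<alpha>'" "bounded_borel \<beta>'"
  shows "weak_ext_deriv k (\<lambda>x. \<alpha> x + \<alpha>' x) (\<lambda>x. \<beta> x + \<beta>' x)"
  unfolding weak_ext_deriv_def
proof (intro allI impI)
  fix m and \<phi> :: "'n form" assume m: "m + k + 1 = CARD('n)" and \<phi>: "global_test_form m \<phi>"
  obtain R where \<phi>': "continuous_on UNIV \<phi>" "\<And>x. R < norm x \<Longrightarrow> \<phi> x = 0"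
    "continuous_on UNIV (ext_deriv \<phi>)" "\<And>x. R < norm x \<Longrightarrow> ext_deriv \<phi> x = 0"
    using global_test_formE[OF \<phi>] by metis
  have i: "integrable lborel (\<lambda>x. wedge_top (\<gamma> x) (ext_deriv \<phi> x))"
      "integrable lborel (\<lambda>x. wedge_top (\<gamma> x) (\<phi> x))"
    if "bounded_borel \<gamma>" for \<gamma>
    using that wedge_top_integrable[OF bounded_borel_locally_integrable _ \<phi>'(1,2), of \<gamma>]
      wedge_top_integrable[OF bounded_borel_locally_integrable _ \<phi>'(3,4), of \<gamma>]
    by (auto simp: bounded_borel_def)
  have "(LINT x|lborel. wedge_top (\<alpha> x) (ext_deriv \<phi> x)) =
      (- 1) ^ (k + 1) * (LINT x|lborel. wedge_top (\<beta> x) (\<phi> x))"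
    "(LINT x|lborel. wedge_top (\<alpha>' x) (ext_deriv \<phi> x)) =
        (- 1) ^ (k + 1) * (LINT x|lborel. wedge_top (\<beta>' x) (\<phi> x))"
    using assms(1,2) m \<phi> unfolding weak_ext_deriv_def by blast+
  then show "(LINT x|lborel. wedge_top (\<alpha> x + \<alpha>' x) (ext_deriv \<phi> x)) =
      (- 1) ^ (k + 1) * (LINT x|lborel. wedge_top (\<beta> x + \<beta>' x) (\<phi> x))"
    by (simp add: wedge_top.add_left i b distrib_left)
qed

lemma weak_ext_deriv_sum:
  fixes \<alpha> \<beta> :: "'i \<Rightarrow> 'n::{finite,linorder} form"
  assumes "\<And>i. i \<in> S \<Longrightarrow> weak_ext_deriv k (\<alpha> i) (\<beta> i) \<and> bounded_borel (\<alpha> i) \<and> bounded_borel (\<beta> i)"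
  shows "weak_ext_deriv k (\<lambda>x. \<Sum>i\<in>S. \<alpha> i x) (\<lambda>x. \<Sum>i\<in>S. \<beta> i x)"
  using assms
  by (induction S rule: infinite_finite_induct)
    (auto intro!: weak_ext_deriv_add weak_ext_deriv_zero bounded_borel_sum)

text \<open>The approximating sequence belongs to the notion: the product rule needs smooth maps
  whose Jacobians converge almost everywhere within the entry bound. Rows are indexed by components
  of \<open>F\<close>, as \<open>ext_pow\<close> expects, so the partial derivatives appear
  transposed.\<close>

definition weak_jacobian :: "real \<Rightarrow> (real ^ 'n \<Rightarrow> real ^ 'm) \<Rightarrow> (real ^ 'n \<Rightarrow> real ^ 'n ^ 'm) \<Rightarrow> bool"
    where
  "weak_jacobian L F G \<longleftrightarrow> component_lipschitz L F \<and> G \<in> borel_measurable borel \<and>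
      (\<forall>x j i. \<bar>G x $ j $ i\<bar> \<le> L) \<and>
    (\<exists>Fm K. (\<forall>m. smooth (Fm m)) \<and> (\<forall>x. (\<lambda>m::nat. Fm m x) \<longlonglongrightarrow> F x) \<and> (\<forall>m x. norm (Fm m x - F x) \<le> K) \<and>
      (\<forall>m x i j. \<bar>partial i (Fm m) x $ j\<bar> \<le> L) \<and>
      (AE x in lborel. \<forall>i j. (\<lambda>m. partial i (Fm m) x $ j) \<longlonglongrightarrow> G x $ j $ i))"

lemma lipschitz_weak_jacobian:
  fixes F :: "real ^ 'n \<Rightarrow> real ^ 'm"
  assumes "component_lipschitz L F"
  obtains G where "weak_jacobian L F G"
proof -
  obtain G :: "real ^ 'n \<Rightarrow> real ^ 'n ^ 'm" and Fm :: "nat \<Rightarrow> real ^ 'n \<Rightarrow> real ^ 'm" and K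
  where p: "G \<in> borel_measurable borel" "\<And>x j i. \<bar>G x $ j $ i\<bar> \<le> L"
    "\<And>m. smooth (Fm m)" "\<And>x. (\<lambda>m. Fm m x) \<longlonglongrightarrow> F x" "\<And>m x. norm (Fm m x - F x) \<le> K"
    "\<And>m x i j. \<bar>partial i (Fm m) x $ j\<bar> \<le> L"
    "AE x in lborel. \<forall>i j. (\<lambda>m. partial i (Fm m) x $ j) \<longlonglongrightarrow> G x $ j $ i"
    by (rule lipschitz_smooth_approximation[OF assms]) (rule that)
  then show thesis
    by (intro that[of G], unfold weak_jacobian_def) (intro conjI exI[of _ Fm] exI[of _ K] allI p
        assms)
qed

lemma weak_jacobian_nonneg: "weak_jacobian L F G \<Longrightarrow> 0 \<le> L"
  unfolding weak_jacobian_def by (meson component_lipschitz_nonneg)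

lemma bounded_borel_vec_nth:
  assumes "bounded_borel (f :: 'a::euclidean_space \<Rightarrow> 'b::euclidean_space ^ 'n)"
  shows "bounded_borel (\<lambda>x. f x $ i)"
proof -
  obtain A where A: "\<And>x. norm (f x) \<le> A"
    using assms by (auto simp: bounded_borel_def)
  have "norm (f x $ i) \<le> A" for x by (rule order_trans[OF Finite_Cartesian_Product.norm_nth_le A])
  moreover have "(\<lambda>x. f x $ i) \<in> borel_measurable borel"
    using assms borel_measurable_continuous_on[where f = "\<lambda>A. A $ i" and g = f]
    by (auto simp: bounded_borel_def continuous_on_component)
  ultimately show ?thesis by (auto simp: bounded_borel_def)
qed

lemma weak_jacobian_bounded_borel:
  fixes G :: "real ^ 'n \<Rightarrow> real ^ 'n ^ 'm"
  assumes "weak_jacobian L F G"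
  shows "bounded_borel G"
proof -
  have G: "\<And>x j i. \<bar>G x $ j $ i\<bar> \<le> L" "G \<in> borel_measurable borel"
    using assms by (auto simp: weak_jacobian_def)
  have "norm (G x) \<le> real CARD('m) * (real CARD('n) * L)" for x
    using G(1) by (rule norm_matrix_le)
  then show ?thesis using G(2) by (auto simp: bounded_borel_def)
qed

lemma bounded_borel_ext_pow:
  fixes G :: "(real, 'n::{finite,linorder}) vec \<Rightarrow> ((real, 'n) vec, 'n) vec"
  assumes G: "bounded_borel G"
  shows "bounded_borel (\<lambda>x. ext_pow (G x) I)"
proof -
  have "finite I" by simp
  then show ?thesis
  proof (induction I rule: finite_linorder_min_induct)
    case empty
    then show ?case by (simp add: bounded_borel_const)
  next
    case (insert b I)
    then show ?case
      by (simp add: ext_pow_insert_min bounded_borel_bilinear[OF bounded_bilinear_lw]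
          bounded_borel_vec_nth G)
  qed
qed

lemma bounded_bilinear_vector_matrix_mult:
  "bounded_bilinear (\<lambda>(v::real ^ 'm) (M::real ^ 'n ^ 'm). v v* M)"
proof -
  have "bilinear (\<lambda>(v::real ^ 'm) (M::real ^ 'n ^ 'm). v v* M)"
    unfolding bilinear_def
    by (auto intro!: linearI simp: vector_matrix_mult_def vec_eq_iff algebra_simps sum.distrib
        sum_distrib_left)
  then show ?thesis by (simp add: bilinear_conv_bounded_bilinear)
qed

text \<open>Applying the product rule to \<open>a \<circ> F\<^sub>m\<close> with \<open>F\<^sub>m\<close> smooth avoids a separate chain rule for \<open>a \<circ> F\<close>.\<close>

lemma weak_ext_deriv_compose_product:
  fixes F :: "(real, 'n::{finite,linorder}) vec \<Rightarrow> (real, 'n) vec" and \<alpha> :: "'n form"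
  assumes J: "weak_jacobian L F G"
    and a: "smooth a" "\<And>R. \<exists>c. \<forall>y. norm y \<le> R \<longrightarrow> \<bar>a y\<bar> \<le> c" "\<And>j y. \<bar>partial j a y\<bar> \<le> A"
    and \<alpha>: "bounded_borel \<alpha>" "\<And>x. homog k (\<alpha> x)" "weak_ext_deriv k \<alpha> (\<lambda>x. 0)"
  shows "weak_ext_deriv k (\<lambda>x. a (F x) *\<^sub>R \<alpha> x) (\<lambda>x. lw (grad a (F x) v* G x) (\<alpha> x))"
proof -
  have L: "0 \<le> L" by (rule weak_jacobian_nonneg[OF J])
  have F: "component_lipschitz L F" and G: "G \<in> borel_measurable borel" "\<And>x j i. \<bar>G x $ j $ i\<bar> \<le> L"
    using J by (auto simp: weak_jacobian_def)
  obtain Fm K where Fm: "\<And>m. smooth (Fm m)" "\<And>x. (\<lambda>m::nat. Fm m x) \<longlonglongrightarrow> F x"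
      "\<And>m x. norm (Fm m x - F x) \<le> K"
      "\<And>m x i j. \<bar>partial i (Fm m) x $ j\<bar> \<le> L"
      "AE x in lborel. \<forall>i j. (\<lambda>m. partial i (Fm m) x $ j) \<longlonglongrightarrow> G x $ j $ i"
    using J unfolding weak_jacobian_def by blast
  have A: "0 \<le> A" using a(3)[of undefined undefined] by linarith
  have ca: "continuous_on UNIV a" by (rule smooth_continuous_on[OF a(1)])
  have cpa: "continuous_on UNIV (partial j a)" for j by (rule smooth_continuous_on[OF
      smooth_partial[OF a(1)]])
  have cF: "continuous_on S F" for S by (rule component_lipschitz_continuous[OF F])
  obtain Ka where Ka: "\<And>x. norm (\<alpha> x) \<le> Ka" using \<alpha>(1) by (auto simp: bounded_borel_def)
  define um where "um m x = a (Fm m x)" for m x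
  have gum: "grad (um m) x = (\<chi> i. \<Sum>j\<in>UNIV. partial i (Fm m) x $ j * partial j a (Fm m x))" for m x
    by (simp add: grad_def um_def[abs_def] smooth_compose(2)[OF Fm(1) a(1)])
  have gv: "grad a (F x) v* G x = (\<chi> i. \<Sum>j\<in>UNIV. G x $ j $ i * partial j a (F x))" for x
    by (simp add: vector_matrix_mult_def grad_def mult.commute)
  have "weak_ext_deriv k (\<lambda>x. a (F x) *\<^sub>R \<alpha> x) (\<lambda>x. lw (grad a (F x) v* G x) (\<alpha> x) + a (F x) *\<^sub>R 0)"
  proof (rule weak_ext_deriv_product[where um = um and L =
      "real CARD('n) * (real CARD('n) * (L * A))"])
    show "\<alpha> \<in> borel_measurable borel" using \<alpha>(1) by (simp add: bounded_borel_def)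
    show "norm (\<alpha> x) \<le> Ka" for x by (rule Ka)
    show "smooth (um m)" for m
      unfolding um_def by (rule smooth_compose(1)[OF Fm(1) a(1)])
    show "(\<lambda>m. um m x) \<longlonglongrightarrow> a (F x)" for x
      unfolding um_def by (rule continuous_on_tendsto_compose[OF ca Fm(2)]) auto
    show "\<exists>c. \<forall>m x. norm x \<le> R \<longrightarrow> \<bar>um m x\<bar> \<le> c" for R
    proof -
      have "compact (F ` cball 0 R)"
        by (intro compact_continuous_image cF compact_cball)
      then obtain D where D: "\<forall>y\<in>F ` cball 0 R. norm y \<le> D"
        using compact_imp_bounded bounded_iff by metis
      obtain c where c: "\<And>y. norm y \<le> D + K \<Longrightarrow> \<bar>a y\<bar> \<le> c" using a(2) by meson
      have "\<bar>um m x\<bar> \<le> c" if "norm x \<le> R" for m x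
      proof -
        have "norm (F x) \<le> D" using D that by auto
        then have "norm (Fm m x) \<le> D + K"
          using norm_triangle_ineq[of "F x" "Fm m x - F x"] Fm(3)[of m x] by simp
        then show ?thesis unfolding um_def by (rule c)
      qed
      then show ?thesis by blast
    qed
    show "norm (grad (um m) x) \<le> real CARD('n) * (real CARD('n) * (L * A))" for m x
    proof -
      have "norm (grad (um m) x) \<le> (\<Sum>i\<in>UNIV. \<bar>grad (um m) x $ i\<bar>)" by (rule norm_le_l1_cart)
      also have "\<dots> \<le> (\<Sum>i::'n\<in>UNIV. real CARD('n) * (L * A))"
      proof (rule sum_mono)
        fix i
        have "\<bar>grad (um m) x $ i\<bar> \<le> (\<Sum>j\<in>UNIV. \<bar>partial i (Fm m) x $ j * partial j a (Fm m x)\<bar>)"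
          unfolding gum vec_lambda_beta by (rule sum_abs)
        also have "\<dots> \<le> (\<Sum>j::'n\<in>UNIV. L * A)"
          unfolding abs_mult by (intro sum_mono mult_mono Fm a L abs_ge_zero)
        finally show "\<bar>grad (um m) x $ i\<bar> \<le> real CARD('n) * (L * A)" by simp
      qed
      finally show ?thesis by simp
    qed
    show "(\<lambda>x. grad a (F x) v* G x) \<in> borel_measurable borel"
    proof -
      have "(\<lambda>x. grad a (F x)) \<in> borel_measurable borel"
        unfolding grad_def
        by (intro borel_measurable_continuous_onI continuous_intros continuous_on_compose2[OF cpa
            cF]) auto
      then show ?thesis by (intro borel_measurable_bilinear[OF bounded_bilinear_vector_matrix_mult]
          G)
    qed
    show "AE x in lborel. (\<lambda>m. grad (um m) x) \<longlonglongrightarrow> grad a (F x) v* G x"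
      using Fm(5)
    proof eventually_elim
      fix x assume lim: "\<forall>i j. (\<lambda>m. partial i (Fm m) x $ j) \<longlonglongrightarrow> G x $ j $ i"
      have "(\<lambda>m. partial j a (Fm m x)) \<longlonglongrightarrow> partial j a (F x)" for j
        by (rule continuous_on_tendsto_compose[OF cpa Fm(2)]) auto
      with lim show "(\<lambda>m. grad (um m) x) \<longlonglongrightarrow> grad a (F x) v* G x"
        unfolding gum gv by (intro tendsto_vec_lambda tendsto_sum tendsto_mult) auto
    qed
  qed (use \<alpha> in \<open>auto simp: bounded_borel_def\<close>)
  then show ?thesis by simp
qed

text \<open>The product for \<open>insert b I\<close> has the primitive \<open>F x $ b\<close> times
  the product for \<open>I\<close>. By induction the latter is closed, so only the differential of
  the coordinate survives in the product rule, and a weak differential is closed.\<close>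

lemma weak_jacobian_ext_pow_closed:
  fixes F :: "(real, 'n::{finite,linorder}) vec \<Rightarrow> (real, 'n) vec"
  assumes J: "weak_jacobian L F G"
  shows "weak_ext_deriv (card I) (\<lambda>x. ext_pow (G x) I) (\<lambda>x. 0)"
proof -
  have "finite I" by simp
  then show ?thesis
  proof (induction I rule: finite_linorder_min_induct)
    case empty
    then show ?case by (simp add: weak_ext_deriv_one)
  next
    case (insert b I)
    have b: "b \<notin> I" using insert by auto
    have d: "partial j (\<lambda>y::(real, 'n) vec. y $ b) y = axis b 1 $ j" for j y
      by (rule trans[OF partial_eqI[OF bounded_linear.has_derivative[OF bounded_linear_vec_nth
          has_derivative_ident]]])
        (auto simp: axis_def)
    have "weak_ext_deriv (card I) (\<lambda>x. (F x $ b) *\<^sub>R ext_pow (G x) I)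
        (\<lambda>x. lw (grad (\<lambda>y. y $ b) (F x) v* G x) (ext_pow (G x) I))"
    proof (rule weak_ext_deriv_compose_product[OF J, where A = 1])
      show "smooth (\<lambda>y::(real, 'n) vec. y $ b)" by (rule smooth_bounded_linear[OF
          bounded_linear_vec_nth smooth_id])
      show "\<exists>c. \<forall>y::(real, 'n) vec. norm y \<le> R \<longrightarrow> \<bar>y $ b\<bar> \<le> c" for R
        using component_le_norm_cart order_trans by blast
      show "\<bar>partial j (\<lambda>y::(real, 'n) vec. y $ b) y\<bar> \<le> 1" for j y
        by (simp add: d axis_def)
    qed (rule bounded_borel_ext_pow[OF weak_jacobian_bounded_borel[OF J]] homog_ext_pow insert.IH)+
    from weak_ext_deriv_closed[OF this]
    have "weak_ext_deriv (Suc (card I)) (\<lambda>x. lw (grad (\<lambda>y. y $ b) (F x) v* G x) (ext_pow (G x) I))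
        (\<lambda>x. 0)" .
    moreover have "grad (\<lambda>y. y $ b) (F x) v* G x = G x $ b" for x
      by (simp add: grad_def d vector_matrix_mult_def vec_eq_iff axis_def if_distrib[of "(*) _"]
          if_distrib[of "\<lambda>c. c * _"] cong: if_cong)
    moreover have "card (insert b I) = Suc (card I)" using b by simp
    ultimately show ?case by (simp add: ext_pow_insert_min[OF insert(2)])
  qed
qed

text \<open>Grouped by coefficients, the differential is a sum of gradients of coefficients wedged
  with basis forms. This is the shape in which the product rule delivers the differential of a
  pulled back form.\<close>

lemma pull_ext_deriv:
  fixes \<theta> :: "'n::{finite,linorder} form"
  assumes \<theta>: "smooth \<theta>"
  shows "pull A (ext_deriv \<theta> y) = (\<Sum>I\<in>UNIV. lw (grad (\<lambda>y. \<theta> y $ I) y v* A) (ext_pow A I))"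
proof -
  have p: "partial i \<theta> y $ I = partial i (\<lambda>x. \<theta> x $ I) y" for i I
    by (rule partial_bounded_linear[OF bounded_linear_vec_nth smooth_differentiable[OF \<theta>],
        symmetric])
  have e: "(\<Sum>i\<in>UNIV. b $ i *\<^sub>R axis i 1) = b" for b :: "(real, 'n) vec"
    using basis_expansion[of b] by (simp add: scalar_mult_eq_scaleR)
  have e2: "(\<Sum>i\<in>UNIV. b $ i *\<^sub>R axis i 1) = b" for b :: "(real, 'n set) vec"
    using basis_expansion[of b] by (simp add: scalar_mult_eq_scaleR)
  have "ext_deriv \<theta> y = (\<Sum>i\<in>UNIV. lw (axis i 1) (\<Sum>I\<in>UNIV. partial i \<theta> y $ I *\<^sub>R axis I 1))"
    by (simp add: ext_deriv_lw e2)
  also have "\<dots> = (\<Sum>I\<in>UNIV. lw (\<Sum>i\<in>UNIV. grad (\<lambda>y. \<theta> y $ I) y $ i *\<^sub>R axis i 1) (axis I 1))"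
    by (simp add: lw.sum_right lw.sum_left lw_scaleR_left lw_scaleR_right p grad_def) (rule
        sum.swap)
  also have "\<dots> = (\<Sum>I\<in>UNIV. lw (grad (\<lambda>y. \<theta> y $ I) y) (axis I 1))" by (simp add: e)
  finally have x: "ext_deriv \<theta> y = (\<Sum>I\<in>UNIV. lw (grad (\<lambda>y. \<theta> y $ I) y) (axis I 1))" .
  have "linear (pull A)" by (auto intro!: linearI simp: pull_add pull_scaleR)
  then show ?thesis by (simp add: x linear_sum pull_lw pull_axis)
qed

text \<open>The claim is checked term by term: a coefficient composed with \<open>F\<close>
  multiplies the closed form \<open>ext_pow (G x) I\<close>. Closedness is available in degree
  \<open>card I\<close>, and the terms where this is not \<open>k\<close> vanish together with their
  coefficients.\<close>

lemma weak_ext_deriv_pull_smooth: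
  fixes F :: "(real, 'n::{finite,linorder}) vec \<Rightarrow> (real, 'n) vec"
  assumes J: "weak_jacobian L F G" and \<theta>: "smooth \<theta>" "\<And>y. homog k (\<theta> y)"
    "\<And>y. norm (\<theta> y) \<le> A" "\<And>j y. norm (partial j \<theta> y) \<le> A"
  shows "weak_ext_deriv k (\<lambda>x. pull (G x) (\<theta> (F x))) (\<lambda>x. pull (G x) (ext_deriv \<theta> (F x)))"
proof -
  have cF: "continuous_on UNIV F"
    using J component_lipschitz_continuous by (auto simp: weak_jacobian_def)
  note bG = weak_jacobian_bounded_borel[OF J]
  have sm: "smooth (\<lambda>y. \<theta> y $ I)" for I by (rule smooth_bounded_linear[OF bounded_linear_vec_nth
      \<theta>(1)])
  have p: "partial i (\<lambda>x. \<theta> x $ I) y = partial i \<theta> y $ I" for i I y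
    by (rule partial_bounded_linear[OF bounded_linear_vec_nth smooth_differentiable[OF \<theta>(1)]])
  have A0: "\<bar>\<theta> y $ I\<bar> \<le> A" for y I using \<theta>(3)[of y] component_le_norm_cart[of "\<theta> y" I] by linarith
  have A1: "\<bar>partial j (\<lambda>x. \<theta> x $ I) y\<bar> \<le> A" for y I j
    unfolding p using \<theta>(4)[of j y] component_le_norm_cart[of "partial j \<theta> y" I] by linarith
  have bF: "bounded_borel (\<lambda>x. a (F x))" if "continuous_on UNIV a" "\<exists>D. \<forall>y. norm (a y) \<le> D"
      for a :: "(real, 'n) vec \<Rightarrow> 'b::euclidean_space"
    unfolding bounded_borel_def using that
    by (auto intro!: borel_measurable_continuous_onI continuous_on_compose2[OF that(1) cF])
  have bg: "bounded_borel (\<lambda>x. grad (\<lambda>y. \<theta> y $ I) (F x))" for I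
  proof (rule bF)
    show "continuous_on UNIV (grad (\<lambda>y. \<theta> y $ I))"
      unfolding grad_def by (intro continuous_intros smooth_continuous_on smooth_partial sm)
    have "norm (grad (\<lambda>y. \<theta> y $ I) y) \<le> real CARD('n) * A" for y
    proof -
      have "norm (grad (\<lambda>y. \<theta> y $ I) y) \<le> (\<Sum>i\<in>UNIV. \<bar>grad (\<lambda>y. \<theta> y $ I) y $ i\<bar>)"
          by (rule norm_le_l1_cart)
      also have "\<dots> \<le> (\<Sum>i::'n\<in>UNIV. A)" by (intro sum_mono) (simp add: grad_def A1)
      finally show ?thesis by simp
    qed
    then show "\<exists>D. \<forall>y. norm (grad (\<lambda>y. \<theta> y $ I) y) \<le> D" by blast
  qed
  have "weak_ext_deriv k (\<lambda>x. \<Sum>I\<in>UNIV. \<theta> (F x) $ I *\<^sub>R ext_pow (G x) I)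
    (\<lambda>x. \<Sum>I\<in>UNIV. lw (grad (\<lambda>y. \<theta> y $ I) (F x) v* G x) (ext_pow (G x) I))"
  proof (rule weak_ext_deriv_sum, intro conjI)
    fix I :: "'n set"
    show "weak_ext_deriv k (\<lambda>x. \<theta> (F x) $ I *\<^sub>R ext_pow (G x) I) (\<lambda>x. lw (grad (\<lambda>y. \<theta> y $ I) (F x)
        v* G x) (ext_pow (G x) I))"
    proof (cases "card I = k")
      case True
      show ?thesis
        unfolding True[symmetric]
        by (rule weak_ext_deriv_compose_product[OF J sm _ A1 bounded_borel_ext_pow[OF bG]
            homog_ext_pow
              weak_jacobian_ext_pow_closed[OF J]]) (use A0 in blast)
    next
      case False
      then have z: "(\<lambda>y. \<theta> y $ I) = (\<lambda>y. 0)" using \<theta>(2) by (auto simp: homog_def)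
      have g: "grad (\<lambda>y. \<theta> y $ I) y = 0" for y
        unfolding z by (simp add: grad_def vec_eq_iff partial_eqI[OF has_derivative_const])
      have "\<theta> y $ I = 0" for y using fun_cong[OF z] .
      then show ?thesis using g[unfolded z] by (simp add: z lw.zero_left weak_ext_deriv_zero)
    qed
    have "bounded_borel (\<lambda>x. \<theta> (F x) $ I)"
      by (rule bF[OF smooth_continuous_on[OF sm]]) (use A0 in auto)
    then show "bounded_borel (\<lambda>x. \<theta> (F x) $ I *\<^sub>R ext_pow (G x) I)"
      by (intro bounded_borel_bilinear[OF bounded_bilinear_scaleR] bounded_borel_ext_pow bG)
    show "bounded_borel (\<lambda>x. lw (grad (\<lambda>y. \<theta> y $ I) (F x) v* G x) (ext_pow (G x) I))"
      by (intro bounded_borel_bilinear[OF bounded_bilinear_lw] bounded_borel_bilinear[OF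
          bounded_bilinear_vector_matrix_mult] bg bG bounded_borel_ext_pow)
  qed
  then show ?thesis
    by (simp add: pull_ext_deriv[OF \<theta>(1)]) (simp add: pull_def)
qed

subsection \<open>Lipschitz extension and change of variables\<close>

text \<open>McShane's formula, the infimum over \<open>y\<close> of
  \<open>f y $ j + C * norm (x - y)\<close>, applied to each coordinate separately. The constant
  \<open>C\<close> is retained for every coordinate.\<close>

lemma component_lipschitz_extension:
  fixes f :: "real ^ 'n \<Rightarrow> real ^ 'm"
  assumes C: "0 \<le> C" and f: "\<And>x y. x \<in> U \<Longrightarrow> y \<in> U \<Longrightarrow> norm (f x - f y) \<le> C * norm (x - y)"
  obtains F where "component_lipschitz C F" "\<And>x. x \<in> U \<Longrightarrow> F x = f x"
proof (cases "U = {}")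
  case True
  have "component_lipschitz C (\<lambda>x::real ^ 'n. 0 :: real ^ 'm)"
    using C by (simp add: component_lipschitz_def)
  then show thesis using that True by blast
next
  case False
  define v where "v x j y = f y $ j + C * norm (x - y)" for x j y
  have fj: "\<bar>f x $ j - f y $ j\<bar> \<le> C * norm (x - y)" if "x \<in> U" "y \<in> U" for x y j
    using f[OF that] component_le_norm_cart[of "f x - f y" j] by simp
  obtain y0 where y0: "y0 \<in> U" using False by blast
  \<comment> \<open>A lower bound independent of \<open>y\<close>, from one fixed point of
    \<open>U\<close>; it makes the infimum a genuine greatest lower bound.\<close>
  have low: "f y0 $ j - C * norm (x - y0) \<le> v x j y" if "y \<in> U" for x j y
  proof -
    have "norm (y0 - y) \<le> norm (x - y0) + norm (x - y)"
      using norm_triangle_ineq4[of "x - y" "x - y0"] by (simp add: norm_minus_commute)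
    then have "C * norm (y0 - y) \<le> C * norm (x - y0) + C * norm (x - y)"
      using mult_left_mono[OF _ C] by (simp flip: distrib_left)
    then show ?thesis using fj[OF y0 that, of j] unfolding v_def by linarith
  qed
  have bdd: "bdd_below (v x j ` U)" for x j
    using low by (intro bdd_belowI2)
  define F where "F x = (\<chi> j. Inf (v x j ` U))" for x
  have ineq: "F x $ j \<le> F x' $ j + C * norm (x - x')" for x x' j
  proof -
    have "F x $ j - C * norm (x - x') \<le> Inf (v x' j ` U)"
    proof (rule cINF_greatest[OF False])
      fix y assume y: "y \<in> U"
      have "F x $ j \<le> v x j y" unfolding F_def by (simp add: cINF_lower[OF bdd y])
      also have "\<dots> \<le> v x' j y + C * norm (x - x')"
      proof -
        have "norm (x - y) \<le> norm (x' - y) + norm (x - x')"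
          using norm_triangle_ineq[of "x' - y" "x - x'"] by simp
        then have "C * norm (x - y) \<le> C * norm (x' - y) + C * norm (x - x')"
          using mult_left_mono[OF _ C] by (simp flip: distrib_left)
        then show ?thesis by (simp add: v_def)
      qed
      finally show "F x $ j - C * norm (x - x') \<le> v x' j y" by simp
    qed
    then show ?thesis by (simp add: F_def)
  qed
  have "component_lipschitz C F"
    unfolding component_lipschitz_def
  proof (intro allI)
    fix x y j
    show "\<bar>F x $ j - F y $ j\<bar> \<le> C * norm (x - y)"
      using ineq[of x j y] ineq[of y j x] by (simp add: abs_le_iff norm_minus_commute)
  qed
  moreover have "F x = f x" if x: "x \<in> U" for x
  proof -
    have "F x $ j = f x $ j" for j
    proof (rule antisym)
      show "F x $ j \<le> f x $ j"
        using cINF_lower[OF bdd x, of x j] by (simp add: F_def v_def)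
      have "f x $ j \<le> Inf (v x j ` U)"
      proof (rule cINF_greatest[OF False])
        fix y assume "y \<in> U"
        then show "f x $ j \<le> v x j y" using fj[OF x, of y j] by (simp add: v_def abs_le_iff)
      qed
      then show "f x $ j \<le> F x $ j" by (simp add: F_def)
    qed
    then show ?thesis by (simp add: vec_eq_iff)
  qed
  ultimately show thesis using that by blast
qed

text \<open>Vitali's theorem fills an open set slightly larger than \<open>E\<close> with disjoint
  balls up to a null set. Each ball is mapped into a ball of radius multiplied by \<open>C\<close>,
  and null sets go to null sets. Balls are what gives the exact factor \<open>C ^ n\<close> for a
  map that is Lipschitz in the Euclidean norm.\<close>

lemma lipschitz_image_emeasure:
  fixes g :: "'a::euclidean_space \<Rightarrow> 'a"
  assumes V: "open V" and C: "0 < C"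
    and g: "\<And>x y. x \<in> V \<Longrightarrow> y \<in> V \<Longrightarrow> dist (g x) (g y) \<le> C * dist x y"
    and E: "E \<in> sets borel" "E \<subseteq> V" and gE: "g ` E \<in> sets borel"
  shows "emeasure lborel (g ` E) \<le> ennreal (C ^ DIM('a)) * emeasure lborel E"
proof (rule ennreal_le_epsilon)
  fix e :: real assume e: "0 < e"
  have Cn: "0 < C ^ DIM('a)" using C by simp
  obtain W where W: "open W" "E \<subseteq> W" "emeasure lborel (W - E) < ennreal (e / C ^ DIM('a))"
    by (rule outer_regular_lborel[OF E(1), of "e / C ^ DIM('a)"]) (use e Cn in auto)
  define W' where "W' = W \<inter> V"
  have W': "open W'" "E \<subseteq> W'" "W' \<subseteq> V" using W V E by (auto simp: W'_def)
  define S where "S = {(a, r). 0 < r \<and> ball a r \<subseteq> W'}"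
  have "\<exists>i. i \<in> S \<and> x \<in> ball (fst i) (snd i) \<and> snd i < d" if xd: "x \<in> W'" "0 < d" for x d
  proof -
    obtain r where r: "r > 0" "ball x r \<subseteq> W'" by (rule openE[OF W'(1) xd(1)])
    have "ball x (min r (d / 2)) \<subseteq> W'" using r(2) by auto
    then show ?thesis using r that
      by (intro exI[of _ "(x, min r (d / 2))"]) (auto simp: S_def min_def)
  qed
  then obtain I where I: "countable I" "I \<subseteq> S"
    "pairwise (\<lambda>i j. disjnt (ball (fst i) (snd i)) (ball (fst j) (snd j))) I"
    "negligible (W' - (\<Union>i\<in>I. ball (fst i) (snd i)))"
    by (rule Vitali_covering_theorem_balls[of W' S fst snd])
  \<comment> \<open>The countable Vitali family is renumbered by all natural numbers; an index that
    is not attained receives radius 0, hence an empty ball.\<close>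
  define a where "a n = fst (SOME i. i \<in> I \<and> to_nat_on I i = n)" for n
  define r where "r n = (if \<exists>i\<in>I. to_nat_on I i = n then snd (SOME i. i \<in> I \<and> to_nat_on I i =
      n) else 0)" for n
  have ar: "(a n, r n) \<in> I \<and> to_nat_on I (a n, r n) = n \<or> r n = 0" for n
  proof (cases "\<exists>i\<in>I. to_nat_on I i = n")
    case True
    then have "\<exists>i. i \<in> I \<and> to_nat_on I i = n" by blast
    from someI_ex[OF this] True show ?thesis by (simp add: a_def r_def)
  qed (auto simp: r_def)
  have ar': "a (to_nat_on I i) = fst i \<and> r (to_nat_on I i) = snd i" if "i \<in> I" for i
  proof -
    have "(SOME i'. i' \<in> I \<and> to_nat_on I i' = to_nat_on I i) = i"
      using that I(1) by (intro some_equality) (auto simp: to_nat_on_inj)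
    then show ?thesis using that by (auto simp: a_def r_def)
  qed
  have r0: "0 \<le> r n" for n using ar[of n] I(2) by (auto simp: S_def)
  have bW: "ball (a n) (r n) \<subseteq> W'" for n using ar[of n] I(2) by (auto simp: S_def)
  have disj: "disjoint_family (\<lambda>n. ball (a n) (r n))"
    unfolding disjoint_family_on_def
  proof (intro ballI impI)
    fix m n :: nat assume "m \<noteq> n"
    show "ball (a m) (r m) \<inter> ball (a n) (r n) = {}"
    proof (cases "r m = 0 \<or> r n = 0")
      case False
      then have "(a m, r m) \<in> I" "(a n, r n) \<in> I" "(a m, r m) \<noteq> (a n, r n)"
        using ar[of m] ar[of n] \<open>m \<noteq> n\<close> by auto
      then show ?thesis using pairwiseD[OF I(3), of "(a m, r m)" "(a n, r n)"]
          by (simp add: disjnt_def)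
    qed auto
  qed
  define N where "N = W' - (\<Union>n. ball (a n) (r n))"
  have "(\<Union>i\<in>I. ball (fst i) (snd i)) \<subseteq> (\<Union>n. ball (a n) (r n))"
  proof (rule UN_least)
    fix i assume "i \<in> I"
    then have "ball (fst i) (snd i) = ball (a (to_nat_on I i)) (r (to_nat_on I i))"
        by (simp add: ar')
    then show "ball (fst i) (snd i) \<subseteq> (\<Union>n. ball (a n) (r n))"
      using UN_upper[of "to_nat_on I i" UNIV "\<lambda>n. ball (a n) (r n)"] by simp
  qed
  then have N: "negligible N" unfolding N_def by (intro negligible_subset[OF I(4)]) blast
  have gN: "negligible (g ` N)"
  proof (rule negligible_locally_Lipschitz_image[OF order_refl N])
    fix x assume "x \<in> N"
    then have x: "x \<in> V" using W' by (auto simp: N_def)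
    show "\<exists>T B. open T \<and> x \<in> T \<and> (\<forall>y\<in>N \<inter> T. norm (g y - g x) \<le> B * norm (y - x))"
      using V x g by (intro exI[of _ V] exI[of _ C]) (simp add: dist_norm)
  qed
  have gb: "g ` ball (a n) (r n) \<subseteq> ball (g (a n)) (C * r n)" for n
  proof
    fix z assume "z \<in> g ` ball (a n) (r n)"
    then obtain y where y: "y \<in> ball (a n) (r n)" "z = g y" by blast
    then have "0 < r n" using le_less_trans[OF zero_le_dist[of "a n" y], of "r n"] by simp
    then have "a n \<in> ball (a n) (r n)" by simp
    then have "a n \<in> V" "y \<in> V" using y(1) bW[of n] W'(3) by blast+
    then have "dist (g (a n)) (g y) \<le> C * dist (a n) y" by (rule g)
    also have "\<dots> < C * r n" using y C by simp
    finally show "z \<in> ball (g (a n)) (C * r n)" using y by simp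
  qed
  have sub: "g ` E \<subseteq> (\<Union>n. ball (g (a n)) (C * r n)) \<union> g ` N"
  proof
    fix z assume "z \<in> g ` E"
    then obtain y where y: "y \<in> E" "z = g y" by blast
    then have "y \<in> W'" using W' by blast
    show "z \<in> (\<Union>n. ball (g (a n)) (C * r n)) \<union> g ` N"
    proof (cases "y \<in> N")
      case False
      with \<open>y \<in> W'\<close> obtain n where "y \<in> ball (a n) (r n)" by (auto simp: N_def)
      then have "g y \<in> ball (g (a n)) (C * r n)" using gb[of n] by blast
      then show ?thesis using y(2) by blast
    qed (use y(2) in blast)
  qed
  have "emeasure lborel (g ` E) = emeasure lebesgue (g ` E)" using gE by simp
  also have "\<dots> \<le> emeasure lebesgue ((\<Union>n. ball (g (a n)) (C * r n)) \<union> g ` N)"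
    using sub gN by (intro emeasure_mono sets.Un) (simp_all add: negligible_iff_null_sets
        null_setsD2)
  also have "\<dots> = emeasure lebesgue (\<Union>n. ball (g (a n)) (C * r n))"
    using gN by (intro emeasure_Un_null_set) (simp_all add: negligible_iff_null_sets null_setsD2)
  also have "\<dots> = emeasure lborel (\<Union>n. ball (g (a n)) (C * r n))" by simp
  also have "\<dots> \<le> (\<Sum>n. emeasure lborel (ball (g (a n)) (C * r n)))"
    by (rule emeasure_subadditive_countably) auto
  also have "\<dots> = (\<Sum>n. ennreal (C ^ DIM('a)) * emeasure lborel (ball (a n) (r n)))"
    using r0 C by (intro suminf_cong)
      (simp add: emeasure_ball power_mult_distrib ennreal_mult[symmetric] mult_ac)
  also have "\<dots> = ennreal (C ^ DIM('a)) * emeasure lborel (\<Union>n. ball (a n) (r n))"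
    by (subst ennreal_suminf_cmult, subst suminf_emeasure[OF _ disj]) auto
  also have "\<dots> \<le> ennreal (C ^ DIM('a)) * (emeasure lborel E + ennreal (e / C ^ DIM('a)))"
  proof (rule mult_left_mono)
    have "emeasure lborel (\<Union>n. ball (a n) (r n)) \<le> emeasure lborel (E \<union> (W - E))"
      using bW W E by (intro emeasure_mono) (auto simp: W'_def)
    also have "\<dots> \<le> emeasure lborel E + emeasure lborel (W - E)"
      using W E by (intro emeasure_subadditive) auto
    also have "\<dots> \<le> emeasure lborel E + ennreal (e / C ^ DIM('a))"
      using W(3) by (intro add_left_mono) simp
    finally show "emeasure lborel (\<Union>n. ball (a n) (r n)) \<le>
        emeasure lborel E + ennreal (e / C ^ DIM('a))" .
  qed simp
  also have "\<dots> = ennreal (C ^ DIM('a)) * emeasure lborel E + ennreal e"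
    using Cn C e by (simp add: distrib_left ennreal_mult[symmetric])
  finally show "emeasure lborel (g ` E) \<le> ennreal (C ^ DIM('a)) * emeasure lborel E + ennreal e" .
qed

text \<open>Within \<open>U\<close>, the preimage of \<open>E\<close> under \<open>F\<close> is the
  image of \<open>E \<inter> V\<close> under the Lipschitz map \<open>g\<close>. The measure of
  \<open>U\<close> pushed forward by \<open>F\<close> is therefore at most \<open>C ^ n\<close>
  times Lebesgue measure on \<open>V\<close>, and an inequality of measures is inherited by
  integrals.\<close>

lemma bilipschitz_nn_integral:
  fixes F g :: "'a::euclidean_space \<Rightarrow> 'a"
  assumes U: "open U" and V: "open V" and F: "continuous_on UNIV F"
    and FU: "\<And>x. x \<in> U \<Longrightarrow> F x \<in> V \<and> g (F x) = x" and gV: "\<And>y. y \<in> V \<Longrightarrow> g y \<in> U \<and> F (g y) = y"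
    and C: "0 < C" and g: "\<And>x y. x \<in> V \<Longrightarrow> y \<in> V \<Longrightarrow> dist (g x) (g y) \<le> C * dist x y"
    and h [measurable]: "h \<in> borel_measurable borel"
  shows "(\<integral>\<^sup>+x. h (F x) * indicator U x \<partial>lborel) \<le> ennreal (C ^ DIM('a)) * (\<integral>\<^sup>+y. h y *
      indicator V y \<partial>lborel)"
proof -
  have [measurable]: "F \<in> borel_measurable borel" by (rule borel_measurable_continuous_onI[OF F])
  have [measurable]: "U \<in> sets borel" "V \<in> sets borel" using U V by auto
  let ?N = "density lborel (\<lambda>y. ennreal (C ^ DIM('a)) * indicator V y)"
  let ?M = "distr (density lborel (indicator U)) borel F"
  have "emeasure ?M E \<le> emeasure ?N E" for E
  proof (cases "E \<in> sets borel")
    case True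
    note [measurable] = True
    have "F -` E \<inter> U = g ` (E \<inter> V)"
    proof (intro equalityI subsetI)
      fix x assume "x \<in> F -` E \<inter> U"
      then have "F x \<in> E \<inter> V" "x = g (F x)" using FU[of x] by auto
      then show "x \<in> g ` (E \<inter> V)" by blast
    next
      fix x assume "x \<in> g ` (E \<inter> V)"
      then show "x \<in> F -` E \<inter> U" using gV by auto
    qed
    moreover have "F -` E \<inter> U \<in> sets borel"
      using measurable_sets[of F borel borel E] by simp
    ultimately have "emeasure lborel (F -` E \<inter> U) \<le> ennreal (C ^ DIM('a)) * emeasure lborel (E \<inter> V)"
      using lipschitz_image_emeasure[OF V C g, of "E \<inter> V"] by auto
    moreover have "emeasure ?M E = emeasure lborel (F -` E \<inter> U)"
    proof -
      have "emeasure ?M E = (\<integral>\<^sup>+x. indicator U x * indicator (F -` E) x \<partial>lborel)"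
        using measurable_sets[of F borel borel E] by (simp add: emeasure_distr emeasure_density)
      also have "\<dots> = (\<integral>\<^sup>+x. indicator (F -` E \<inter> U) x \<partial>lborel)"
        by (intro nn_integral_cong) (auto simp: indicator_def)
      also have "\<dots> = emeasure lborel (F -` E \<inter> U)"
        using \<open>F -` E \<inter> U \<in> sets borel\<close> by simp
      finally show ?thesis .
    qed
    moreover have "emeasure ?N E = ennreal (C ^ DIM('a)) * emeasure lborel (E \<inter> V)"
    proof -
      have "emeasure ?N E = (\<integral>\<^sup>+x. ennreal (C ^ DIM('a)) * indicator (E \<inter> V) x \<partial>lborel)"
        by (simp add: emeasure_density) (intro nn_integral_cong, auto simp: indicator_def)
      also have "\<dots> = ennreal (C ^ DIM('a)) * emeasure lborel (E \<inter> V)"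
        by (rule nn_integral_cmult_indicator) simp
      finally show ?thesis .
    qed
    ultimately show ?thesis by simp
  next
    case False
    then show ?thesis by (simp add: emeasure_notin_sets)
  qed
  then have "?M \<le> ?N" by (subst le_measure) simp_all
  then have "(\<integral>\<^sup>+y. h y \<partial>?M) \<le> (\<integral>\<^sup>+y. h y \<partial>?N)"
    by (intro nn_integral_mono_measure) simp_all
  moreover have "(\<integral>\<^sup>+y. h y \<partial>?M) = (\<integral>\<^sup>+x. h (F x) * indicator U x \<partial>lborel)"
    by (simp add: nn_integral_distr nn_integral_density mult.commute)
  moreover have "(\<integral>\<^sup>+y. h y \<partial>?N) = ennreal (C ^ DIM('a)) * (\<integral>\<^sup>+y. h y * indicator V y \<partial>lborel)"
    by (simp add: nn_integral_density nn_integral_cmult[symmetric] mult_ac)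
  ultimately show ?thesis by simp
qed

subsection \<open>Pullback by bi-Lipschitz maps\<close>

lemma partial_zero_outside_support:
  assumes "x \<notin> closure {x. \<phi> x \<noteq> 0}"
  shows "partial i \<phi> x = 0"
proof -
  have "((\<lambda>x. 0) has_derivative (\<lambda>h. 0)) (at x)" by simp
  then have "(\<phi> has_derivative (\<lambda>h. 0)) (at x)"
  proof (rule has_derivative_transform_within_open[where s = "- closure {x. \<phi> x \<noteq> 0}"])
    show "0 = \<phi> y" if "y \<in> - closure {x. \<phi> x \<noteq> 0}" for y
      using that closure_subset[of "{x. \<phi> x \<noteq> 0}"] by auto
  qed (use assms in auto)
  then show ?thesis by (simp add: partial_eqI)
qed

lemma ext_deriv_zero_outside_support:
  "x \<notin> closure {x. \<phi> x \<noteq> 0} \<Longrightarrow> ext_deriv \<phi> x = 0"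
  by (simp add: ext_deriv_lw partial_zero_outside_support lw.zero_right)

lemma form_integral_wedge:
  fixes \<alpha> \<psi> :: "'n::{finite,linorder} form"
  assumes "open W" and "\<And>x. x \<notin> W \<Longrightarrow> \<psi> x = 0"
  shows "form_integral W (wedge \<alpha> \<psi>) = (LINT x|lebesgue. wedge_top (\<alpha> x) (\<psi> x))"
proof -
  have "form_integral W (wedge \<alpha> \<psi>) = (LINT x|lebesgue. indicator W x *\<^sub>R wedge_top (\<alpha> x) (\<psi> x))"
    unfolding form_integral_def wedge_UNIV using assms(1) by (intro integral_restrict_space) auto
  also have "\<dots> = (LINT x|lebesgue. wedge_top (\<alpha> x) (\<psi> x))"
    using assms(2) by (intro Bochner_Integration.integral_cong refl) (auto simp: indicator_def
        wedge_top.zero_right)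
  finally show ?thesis .
qed

text \<open>Test forms and their differentials vanish outside \<open>W\<close>, so both integrals
  may be taken over the whole space, where they can be compared with
  \<open>weak_ext_deriv\<close>.\<close>

lemma weak_d_iff:
  fixes \<omega> \<eta> :: "'n::{finite,linorder} form"
  assumes W: "open W"
  shows "weak_d W k \<omega> \<eta> \<longleftrightarrow> (\<forall>m \<phi>. m + k + 1 = CARD('n) \<longrightarrow> test_form W m \<phi> \<longrightarrow>
    (LINT x|lebesgue. wedge_top (\<omega> x) (ext_deriv \<phi> x)) =
        (- 1) ^ (k + 1) * (LINT x|lebesgue. wedge_top (\<eta> x) (\<phi> x)))"
proof -
  have "form_integral W (wedge \<omega> (ext_deriv \<phi>)) = (LINT x|lebesgue. wedge_top (\<omega> x) (ext_deriv \<phi>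
      x))"
    "form_integral W (wedge \<eta> \<phi>) = (LINT x|lebesgue. wedge_top (\<eta> x) (\<phi> x))" if "test_form W m \<phi>"
        for m \<phi>
  proof -
    have "closure {x. \<phi> x \<noteq> 0} \<subseteq> W" using that by (simp add: test_form_def)
    then have o: "x \<notin> closure {x. \<phi> x \<noteq> 0}" if "x \<notin> W" for x using that by blast
    show "form_integral W (wedge \<omega> (ext_deriv \<phi>)) = (LINT x|lebesgue. wedge_top (\<omega> x) (ext_deriv \<phi>
        x))"
      by (rule form_integral_wedge[OF W ext_deriv_zero_outside_support[OF o]])
    have "\<phi> x = 0" if "x \<notin> W" for x
      using o[OF that] closure_subset[of "{x. \<phi> x \<noteq> 0}"] by blast
    then show "form_integral W (wedge \<eta> \<phi>) = (LINT x|lebesgue. wedge_top (\<eta> x) (\<phi> x))"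
      by (rule form_integral_wedge[OF W])
  qed
  then show ?thesis
    unfolding weak_d_def by (intro iff_allI imp_cong refl) simp
qed

lemma wedge_top_axis_right: "wedge_top b (axis J 1) = merge_sign (- J) J * b $ (- J)"
proof -
  have "wedge_top b (axis J 1) = (\<Sum>I\<in>UNIV. if I = - J then merge_sign (- J) J * b $ (- J) else 0)"
    unfolding wedge_top_def by (rule sum.cong) (auto simp: axis_def)
  then show ?thesis by simp
qed

lemma test_form_mollifier:
  fixes \<rho> :: "(real, 'n::{finite,linorder}) vec \<Rightarrow> real"
  assumes \<rho>: "mollifier r \<rho>" and W: "cball y r \<subseteq> W"
  shows "test_form W (card J) (\<lambda>z. \<rho> (y - z) *\<^sub>R axis J 1)"
proof -
  note m = mollifierD[OF \<rho>]
  have "{z. \<rho> (y - z) *\<^sub>R axis J (1::real) \<noteq> 0} \<subseteq> cball y r"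
    using m(3) by (force simp: dist_norm)
  then have "closure {z. \<rho> (y - z) *\<^sub>R axis J (1::real) \<noteq> 0} \<subseteq> cball y r"
    by (intro closure_minimal) auto
  moreover from this have "compact (closure {z. \<rho> (y - z) *\<^sub>R axis J (1::real) \<noteq> 0})"
    by (meson bounded_cball bounded_subset closed_closure compact_eq_bounded_closed)
  moreover have "smooth (\<lambda>z. \<rho> (y - z) *\<^sub>R axis J (1::real))"
    by (intro smooth_scaleR smooth_reflect(1)[OF m(1)] smooth_const)
  moreover have "is_form UNIV (card J) (\<lambda>z. \<rho> (y - z) *\<^sub>R axis J (1::real))"
    by (auto simp: is_form_def axis_def)
  ultimately show ?thesis using W unfolding test_form_def by blast
qed

text \<open>The weak differential is tested with the kernel centred at \<open>y\<close> times the
  basis form of the complement of \<open>I\<close>; this reads off the coefficient at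
  \<open>I\<close> of the mollified forms. Cutting off with \<open>K\<close> makes the forms
  integrable everywhere and is invisible at \<open>y\<close>, because \<open>K\<close> contains the
  support of the kernel.\<close>

lemma mollified_ext_deriv:
  fixes \<theta> \<omega> :: "'n::{finite,linorder} form"
  assumes V: "open V" and d: "weak_d V k \<theta> \<omega>"
    and \<theta>: "integrable lborel (\<lambda>x. indicator K x *\<^sub>R \<theta> x)" "\<And>x. homog k (\<theta> x)"
    and \<omega>: "integrable lborel (\<lambda>x. indicator K x *\<^sub>R \<omega> x)" "\<And>x. homog (Suc k) (\<omega> x)"
    and \<rho>: "mollifier r \<rho>" and y: "cball y r \<subseteq> V" "cball y r \<subseteq> K"
  shows "ext_deriv (conv \<rho> (\<lambda>x. indicator K x *\<^sub>R \<theta> x)) y = conv \<rho> (\<lambda>x. indicator K x *\<^sub>R \<omega> x) y"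
proof -
  note m = mollifierD[OF \<rho>]
  define \<theta>' where "\<theta>' = (\<lambda>x. indicator K x *\<^sub>R \<theta> x)"
  define \<omega>' where "\<omega>' = (\<lambda>x. indicator K x *\<^sub>R \<omega> x)"
  have i: "integrable lborel \<theta>'" "integrable lborel \<omega>'" using \<theta> \<omega> by (simp_all add: \<theta>'_def \<omega>'_def)
  have h: "homog k (\<theta>' x)" for x unfolding \<theta>'_def by (intro homog_scaleR \<theta>)
  have "integrable lborel (\<lambda>x. indicator (cball 0 R) x *\<^sub>R \<theta>' x)" for R
    by (rule integrable_mult_indicator[OF _ i(1)]) simp
  then have li: "locally_integrable \<theta>'" by (simp add: locally_integrable_def)
  define v where "v z = (\<chi> i. partial i \<rho> (y - z))" for z
  have intp: "integrable lborel (\<lambda>z. partial i \<rho> (y - z) *\<^sub>R \<theta>' z)" for i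
    by (rule integrable_conv_kernel[OF smooth_continuous_on[OF smooth_partial[OF m(1)]]
        partial_support[OF m(3)] i(1)])
  have v: "lw (v z) b = (\<Sum>i\<in>UNIV. lw (axis i 1) (partial i \<rho> (y - z) *\<^sub>R b))" for z b
  proof -
    have "v z = (\<Sum>i\<in>UNIV. partial i \<rho> (y - z) *\<^sub>R axis i 1)"
      using basis_expansion[of "v z"] by (simp add: v_def scalar_mult_eq_scaleR)
    then show ?thesis by (simp add: lw.sum_left lw_scaleR_left lw_scaleR_right)
  qed
  have intv: "integrable lborel (\<lambda>z. lw (v z) (\<theta>' z))"
    unfolding v by (intro Bochner_Integration.integrable_sum integrable_bounded_linear[OF
        bounded_linear_lw] intp)
  have E: "ext_deriv (conv \<rho> \<theta>') y = (LINT z|lborel. lw (v z) (\<theta>' z))"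
  proof -
    have "ext_deriv (conv \<rho> \<theta>') y = (\<Sum>i\<in>UNIV. lw (axis i 1) (LINT z|lborel. partial i \<rho> (y - z) *\<^sub>R
        \<theta>' z))"
      unfolding ext_deriv_lw by (intro sum.cong refl) (simp add: smooth_conv(2)[OF m(1) m(3) li]
          conv_def)
    also have "\<dots> = (\<Sum>i\<in>UNIV. (LINT z|lborel. lw (axis i 1) (partial i \<rho> (y - z) *\<^sub>R \<theta>' z)))"
      by (intro sum.cong refl integral_bounded_linear[OF bounded_linear_lw, symmetric] intp)
    also have "\<dots> = (LINT z|lborel. (\<Sum>i\<in>UNIV. lw (axis i 1) (partial i \<rho> (y - z) *\<^sub>R \<theta>' z)))"
      by (intro Bochner_Integration.integral_sum[symmetric] integrable_bounded_linear[OF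
          bounded_linear_lw] intp)
    finally show ?thesis by (simp add: v)
  qed
  have into: "integrable lborel (\<lambda>z. \<rho> (y - z) *\<^sub>R \<omega>' z)"
    by (rule integrable_conv_kernel[OF smooth_continuous_on[OF m(1)] m(3) i(2)])
  have "ext_deriv (conv \<rho> \<theta>') y $ I = conv \<rho> \<omega>' y $ I" for I
  proof (cases "card I = Suc k")
    case False
    have "homog (Suc k) (lw (v z) (\<theta>' z))" for z by (rule homog_lw[OF h])
    then have "ext_deriv (conv \<rho> \<theta>') y $ I = (LINT z|(lborel :: (real, 'n) vec measure). 0 :: real)"
      using False unfolding E integral_bounded_linear[OF bounded_linear_vec_nth intv, symmetric]
      by (intro Bochner_Integration.integral_cong) (auto simp: homog_def)
    moreover have "conv \<rho> \<omega>' y $ I = (LINT z|(lborel :: (real, 'n) vec measure). 0 :: real)"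
      using False \<omega>(2) unfolding conv_def integral_bounded_linear[OF bounded_linear_vec_nth into,
          symmetric]
      by (intro Bochner_Integration.integral_cong) (auto simp: homog_def \<omega>'_def)
    ultimately show ?thesis by simp
  next
    case True
    define J where "J = - I"
    have card: "card J + k + 1 = CARD('n)"
      using True card_mono[of UNIV I] by (simp add: J_def Compl_eq_Diff_UNIV card_Diff_subset)
    define \<phi> where "\<phi> = (\<lambda>z. \<rho> (y - z) *\<^sub>R axis J (1::real))"
    have "test_form V (card J) \<phi>" unfolding \<phi>_def by (rule test_form_mollifier[OF \<rho> y(1)])
    then have w: "(LINT z|lebesgue. wedge_top (\<theta> z) (ext_deriv \<phi> z)) =
        (- 1) ^ (k + 1) * (LINT z|lebesgue. wedge_top (\<omega> z) (\<phi> z))"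
      using d card unfolding weak_d_iff[OF V] by blast
    \<comment> \<open>Differentiating the reflected kernel produces a minus sign. Together with the
      sign of \<open>wedge_top_lw\<close> it cancels the factor \<open>(- 1) ^ (k + 1)\<close> of
      the weak differential.\<close>
    have d\<phi>: "ext_deriv \<phi> z = lw (- v z) (axis J 1)" for z
    proof -
      have c: "ext_deriv (\<lambda>z. axis J (1::real)) z = 0"
        by (simp add: ext_deriv_lw partial_eqI[OF has_derivative_const] lw.zero_right)
      have g: "grad (\<lambda>z. \<rho> (y - z)) z = - v z"
        by (simp add: grad_def v_def smooth_reflect(2)[OF m(1)] vec_eq_iff)
      show ?thesis
        unfolding \<phi>_def by (simp add: ext_deriv_scaleR[OF smooth_reflect(1)[OF m(1)] smooth_const]
            c g)
    qed
    have out: "\<rho> (y - z) = 0" "v z = 0" if "z \<notin> K" for z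
    proof -
      have "z \<notin> cball y r" using that y(2) by blast
      then have "r < norm (y - z)" by (simp add: dist_norm)
      then show "\<rho> (y - z) = 0" "v z = 0"
        using m(3) partial_support[where \<rho> = \<rho> and s = r, OF m(3)] by (auto simp: v_def vec_eq_iff)
    qed
    have 1: "wedge_top (\<theta> z) (ext_deriv \<phi> z) = ((- 1) ^ (k + 1) * merge_sign I J) *
        lw (v z) (\<theta>' z) $ I" for z
    proof -
      have "wedge_top (\<theta> z) (ext_deriv \<phi> z) = wedge_top (\<theta>' z) (ext_deriv \<phi> z)"
        using out[of z] by (cases "z \<in> K") (simp_all add: d\<phi> \<theta>'_def lw.zero_left
            wedge_top.zero_right)
      also have "\<dots> = - wedge_top (\<theta>' z) (lw (v z) (axis J 1))"
        by (simp add: d\<phi> lw.minus_left wedge_top.minus_right)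
      also have "wedge_top (\<theta>' z) (lw (v z) (axis J 1)) =
          (- 1) ^ k * wedge_top (lw (v z) (\<theta>' z)) (axis J 1)"
        by (simp add: wedge_top_lw[OF h] flip: mult.assoc power_add)
      finally show ?thesis by (simp add: wedge_top_axis_right J_def)
    qed
    have 2: "wedge_top (\<omega> z) (\<phi> z) = merge_sign I J * (\<rho> (y - z) *\<^sub>R \<omega>' z) $ I" for z
      using out[of z] by (cases "z \<in> K")
        (simp_all add: \<phi>_def \<omega>'_def wedge_top.scaleR_right wedge_top_axis_right J_def
            wedge_top.zero_right)
    have [measurable]: "(\<lambda>z. lw (v z) (\<theta>' z) $ I) \<in> borel_measurable lborel"
        "(\<lambda>z. (\<rho> (y - z) *\<^sub>R \<omega>' z) $ I) \<in> borel_measurable lborel"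
      using integrable_bounded_linear[OF bounded_linear_vec_nth intv] integrable_bounded_linear[OF
          bounded_linear_vec_nth into]
      by (auto intro: borel_measurable_integrable)
    have "(LINT z|lebesgue. wedge_top (\<theta> z) (ext_deriv \<phi> z)) =
        ((- 1) ^ (k + 1) * merge_sign I J) * (LINT z|lborel. lw (v z) (\<theta>' z) $ I)"
      unfolding 1 by (subst integral_completion) simp_all
    moreover have "(LINT z|lebesgue. wedge_top (\<omega> z) (\<phi> z)) =
        merge_sign I J * (LINT z|lborel. (\<rho> (y - z) *\<^sub>R \<omega>' z) $ I)"
      unfolding 2 by (subst integral_completion) (simp_all del: vector_scaleR_component)
    moreover have "merge_sign I J \<noteq> 0" using abs_merge_sign[of I J] by force
    ultimately have "(LINT z|lborel. lw (v z) (\<theta>' z) $ I) =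
        (LINT z|lborel. (\<rho> (y - z) *\<^sub>R \<omega>' z) $ I)"
      using w by (simp del: vector_scaleR_component)
    then show ?thesis
      unfolding E conv_def
      by (simp only: integral_bounded_linear[OF bounded_linear_vec_nth intv]
          integral_bounded_linear[OF bounded_linear_vec_nth into])
  qed
  then show ?thesis by (simp add: vec_eq_iff \<theta>'_def \<omega>'_def)
qed

section \<open>Pullback of locally integrable forms\<close>

lemma norm_pull_le:
  fixes G :: "(real, 'n::{finite,linorder}) vec \<Rightarrow> ((real, 'n) vec, 'n) vec"
  assumes "bounded_borel G"
  obtains D where "0 \<le> D" "\<And>x b. norm (pull (G x) b) \<le> D * norm b"
proof -
  have "\<exists>K. \<forall>x. norm (ext_pow (G x) I) \<le> K" for I
    using bounded_borel_ext_pow[OF assms, of I] by (simp add: bounded_borel_def)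
  then obtain K where K: "\<And>I x. norm (ext_pow (G x) I) \<le> K I" by metis
  have K0: "0 \<le> K I" for I by (rule order_trans[OF norm_ge_zero K])
  have "norm (pull (G x) b) \<le> (\<Sum>I\<in>UNIV. K I) * norm b" for x b
  proof -
    have "norm (pull (G x) b) \<le> (\<Sum>I\<in>UNIV. K I * norm b)"
      unfolding pull_def
    proof (rule sum_norm_le)
      fix I
      show "norm (b $ I *\<^sub>R ext_pow (G x) I) \<le> K I * norm b"
        using mult_mono[OF component_le_norm_cart[of b I] K[where I = I and x =
            x] norm_ge_zero norm_ge_zero]
        by (simp add: mult.commute)
    qed
    then show ?thesis by (simp add: sum_distrib_right)
  qed
  then show thesis using that[of "\<Sum>I\<in>UNIV. K I"] K0 by (simp add: sum_nonneg)
qed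

lemma borel_measurable_pull:
  fixes G :: "'a \<Rightarrow> ((real, 'n::{finite,linorder}) vec, 'n) vec"
  assumes "\<And>I. (\<lambda>x. ext_pow (G x) I) \<in> borel_measurable M" "h \<in> borel_measurable M"
  shows "(\<lambda>x. pull (G x) (h x)) \<in> borel_measurable M"
proof -
  have "(\<lambda>x. h x $ I) \<in> borel_measurable M" for I
    using borel_measurable_continuous_on[where f = "\<lambda>A. A $ I", OF _ assms(2)]
        by (simp add: continuous_on_component)
  then show ?thesis
    unfolding pull_def by (intro borel_measurable_sum borel_measurable_scaleR assms(1))
qed

text \<open>Forms on \<open>V\<close> are pulled back to \<open>U\<close> by the globally defined
  \<open>F\<close> with weak Jacobian \<open>G\<close>. The inverse \<open>g\<close> matters only on
  \<open>V\<close>, and its Lipschitz bound enters only through volumes. The locale is used for the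
  homeomorphism and for its inverse.\<close>

locale bilipschitz_chart =
  fixes U V :: "(real, 'n::{finite,linorder}) vec set"
    and F g :: "(real, 'n) vec \<Rightarrow> (real, 'n) vec"
    and G :: "(real, 'n) vec \<Rightarrow> ((real, 'n) vec, 'n) vec"
    and C :: real
  assumes open_U: "open U" and open_V: "open V" and C_pos: "0 < C"
    and jac: "weak_jacobian C F G"
    and F_in: "\<And>x. x \<in> U \<Longrightarrow> F x \<in> V \<and> g (F x) = x"
    and g_in: "\<And>y. y \<in> V \<Longrightarrow> g y \<in> U \<and> F (g y) = y"
    and g_lip: "\<And>x y. x \<in> V \<Longrightarrow> y \<in> V \<Longrightarrow> dist (g x) (g y) \<le> C * dist x y"
begin

lemma cont_F: "continuous_on S F"
  using jac component_lipschitz_continuous by (auto simp: weak_jacobian_def)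

lemma meas_F [measurable]: "F \<in> borel_measurable borel"
  by (rule borel_measurable_continuous_onI[OF cont_F])

lemma nn_integral_F:
  assumes "h \<in> borel_measurable borel"
  shows "(\<integral>\<^sup>+x. h (F x) * indicator U x \<partial>lborel) \<le> ennreal (C ^ CARD('n)) * (\<integral>\<^sup>+y. h y *
      indicator V y \<partial>lborel)"
  using bilipschitz_nn_integral[OF open_U open_V cont_F F_in g_in C_pos g_lip assms] by simp

lemma pull_meas:
  assumes "\<eta> \<in> borel_measurable borel"
  shows "(\<lambda>x. pull (G x) (\<eta> (F x))) \<in> borel_measurable borel"
proof (rule borel_measurable_pull)
  show "(\<lambda>x. ext_pow (G x) I) \<in> borel_measurable borel" for I
    using bounded_borel_ext_pow[OF weak_jacobian_bounded_borel[OF jac], of I]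
        by (simp add: bounded_borel_def)
  show "(\<lambda>x. \<eta> (F x)) \<in> borel_measurable borel"
    using measurable_compose[OF meas_F assms] .
qed

text \<open>Against a fixed compactly supported \<psi> the pulled back form is integrated with a
  bound by the mean norm of \<eta>: the entries of \<open>G\<close> are bounded and
  \<open>nn_integral_F\<close> moves the integral from \<open>U\<close> to \<open>V\<close>. This
  continuity is what carries mollified identities to the limit.\<close>

lemma pull_functional:
  assumes \<psi>: "continuous_on UNIV \<psi>" "\<And>x. R < norm x \<Longrightarrow> \<psi> x = 0" "\<And>x. x \<notin> U \<Longrightarrow> \<psi> x = 0"
  obtains K where "0 \<le> K" "\<And>\<eta> :: 'n form. integrable lborel \<eta> \<Longrightarrow>
    integrable lborel (\<lambda>x. wedge_top (pull (G x) (\<eta> (F x))) (\<psi> x)) \<and>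
    \<bar>LINT x|lborel. wedge_top (pull (G x) (\<eta> (F x))) (\<psi> x)\<bar> \<le> K * (LINT y|lborel. norm (\<eta> y))"
proof -
  obtain M where M: "0 \<le> M" "\<And>x. norm (\<psi> x) \<le> M" using compact_support_bounded[OF \<psi>(1,2)] by blast
  obtain D where D: "0 \<le> D" "\<And>x b. norm (pull (G x) b) \<le> D * norm b"
    using norm_pull_le[OF weak_jacobian_bounded_borel[OF jac]] by blast
  obtain K where K: "0 \<le> K" "\<And>a b :: (real, 'n set) vec. norm (wedge_top a b) \<le> norm a * norm b * K"
    using wedge_top.nonneg_bounded by blast
  define Q where "Q = D * M * K"
  have Q: "0 \<le> Q" using M D K by (simp add: Q_def)
  have "integrable lborel (\<lambda>x. wedge_top (pull (G x) (\<eta> (F x))) (\<psi> x)) \<and>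
    \<bar>LINT x|lborel. wedge_top (pull (G x) (\<eta> (F x))) (\<psi> x)\<bar> \<le>
        (Q * C ^ CARD('n)) * (LINT y|lborel. norm (\<eta> y))"
    if i: "integrable lborel \<eta>" for \<eta> :: "'n form"
  proof -
    have \<eta> [measurable]: "\<eta> \<in> borel_measurable borel" using i by auto
    let ?h = "\<lambda>x. wedge_top (pull (G x) (\<eta> (F x))) (\<psi> x)"
    have hm: "?h \<in> borel_measurable borel"
      by (intro borel_measurable_bilinear[OF bounded_bilinear_wedge_top] pull_meas \<eta>
          borel_measurable_continuous_onI[OF \<psi>(1)])
    have "(\<integral>\<^sup>+x. ennreal (norm (?h x)) \<partial>lborel) \<le> (\<integral>\<^sup>+x. ennreal Q * (ennreal (norm (\<eta> (F x))) *
        indicator U x) \<partial>lborel)"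
    proof (rule nn_integral_mono)
      fix x
      have "norm (?h x) \<le> norm (pull (G x) (\<eta> (F x))) * norm (\<psi> x) * K" by (rule K(2))
      also have "\<dots> \<le> (D * norm (\<eta> (F x))) * M * K"
        by (intro mult_right_mono mult_mono D M K(1) mult_nonneg_nonneg norm_ge_zero)
      finally have "norm (?h x) \<le> Q * norm (\<eta> (F x))" by (simp add: Q_def mult_ac)
      then show "ennreal (norm (?h x)) \<le> ennreal Q * (ennreal (norm (\<eta> (F x))) * indicator U x)"
        using \<psi>(3)[of x] Q by (cases "x \<in> U") (auto simp: wedge_top.zero_right
            ennreal_mult[symmetric] intro!: ennreal_leI)
    qed
    also have "\<dots> = ennreal Q * (\<integral>\<^sup>+x. ennreal (norm (\<eta> (F x))) * indicator U x \<partial>lborel)"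
      using open_U by (intro nn_integral_cmult) simp
    also have "\<dots> \<le> ennreal Q * (ennreal (C ^ CARD('n)) * (\<integral>\<^sup>+y. ennreal (norm (\<eta> y)) *
        indicator V y \<partial>lborel))"
      by (intro mult_left_mono nn_integral_F[of "\<lambda>y. ennreal (norm (\<eta> y))"]) auto
    also have "\<dots> \<le> ennreal Q * (ennreal (C ^ CARD('n)) * (\<integral>\<^sup>+y. ennreal (norm (\<eta> y)) \<partial>lborel))"
      by (intro mult_left_mono nn_integral_mono) (auto simp: indicator_def)
    also have "\<dots> = ennreal ((Q * C ^ CARD('n)) * (LINT y|lborel. norm (\<eta> y)))"
      using Q C_pos by (simp add: nn_integral_eq_integral[OF integrable_norm[OF i]]
          ennreal_mult[symmetric] mult.assoc)
    finally have le: "(\<integral>\<^sup>+x. ennreal (norm (?h x)) \<partial>lborel) \<le>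
        ennreal ((Q * C ^ CARD('n)) * (LINT y|lborel. norm (\<eta> y)))" .
    have int: "integrable lborel ?h"
      by (rule integrableI_bounded) (use hm le in \<open>auto intro: le_less_trans\<close>)
    have "ennreal \<bar>LINT x|lborel. ?h x\<bar> \<le> (\<integral>\<^sup>+x. ennreal (norm (?h x)) \<partial>lborel)"
      using integral_norm_bound_ennreal[OF int] by simp
    with le have "ennreal \<bar>LINT x|lborel. ?h x\<bar> \<le> ennreal ((Q * C ^ CARD('n)) *
        (LINT y|lborel. norm (\<eta> y)))"
      by (rule order_trans[rotated])
    moreover have "0 \<le> (Q * C ^ CARD('n)) * (LINT y|lborel. norm (\<eta> y))"
      using Q C_pos by simp
    ultimately show ?thesis using int by (simp only: ennreal_le_iff)
  qed
  moreover have "0 \<le> Q * C ^ CARD('n)" using Q C_pos by simp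
  ultimately show thesis using that by blast
qed

lemma pull_functional_tendsto:
  assumes \<psi>: "continuous_on UNIV \<psi>" "\<And>x. R < norm x \<Longrightarrow> \<psi> x = 0" "\<And>x. x \<notin> U \<Longrightarrow> \<psi> x = 0"
    and \<eta>: "integrable lborel \<eta>" and d: "\<And>m. integrable lborel (\<lambda>y. \<eta>m m y - \<eta> y)"
      "(\<lambda>m. LINT y|lborel. norm (\<eta>m m y - \<eta> y)) \<longlonglongrightarrow> 0"
  shows "(\<lambda>m::nat. LINT x|lborel. wedge_top (pull (G x) (\<eta>m m (F x))) (\<psi> x)) \<longlonglongrightarrow>
    (LINT x|lborel. wedge_top (pull (G x) (\<eta> (F x))) (\<psi> x))"
proof -
  obtain K where K: "0 \<le> K" "\<And>\<eta> :: 'n form. integrable lborel \<eta> \<Longrightarrow>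
    integrable lborel (\<lambda>x. wedge_top (pull (G x) (\<eta> (F x))) (\<psi> x)) \<and>
    \<bar>LINT x|lborel. wedge_top (pull (G x) (\<eta> (F x))) (\<psi> x)\<bar> \<le> K * (LINT y|lborel. norm (\<eta> y))"
    by (rule pull_functional[where R = R and \<psi> = \<psi>]) (rule \<psi>(1), erule \<psi>(2), erule \<psi>(3), rule that)
  have im: "integrable lborel (\<eta>m m)" for m
    using Bochner_Integration.integrable_add[OF d(1)[of m] \<eta>] by simp
  have "(LINT x|lborel. wedge_top (pull (G x) (\<eta>m m (F x))) (\<psi> x)) - (LINT x|lborel. wedge_top
      (pull (G x) (\<eta> (F x))) (\<psi> x)) =
     (LINT x|lborel. wedge_top (pull (G x) (\<eta>m m (F x) - \<eta> (F x))) (\<psi> x))" for m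
  proof -
    have "pull A (a - b) = pull A a - pull A b" for A :: "((real, 'n) vec, 'n) vec" and a b
      using pull_add[of A "a - b" b] by simp
    then show ?thesis
      using K(2)[OF im[of m]] K(2)[OF \<eta>] by (simp add: wedge_top.diff_left)
  qed
  then have "\<bar>(LINT x|lborel. wedge_top (pull (G x) (\<eta>m m (F x))) (\<psi> x)) - (LINT x|lborel.
      wedge_top (pull (G x) (\<eta> (F x))) (\<psi> x))\<bar>
     \<le> K * (LINT y|lborel. norm (\<eta>m m y - \<eta> y))" for m
    using K(2)[OF d(1)[of m]] by simp
  then show ?thesis
    by (intro LIM_zero_cancel[OF Lim_null_comparison[OF always_eventually[OF allI]
        tendsto_mult_right_zero[OF d(2)]]]) simp
qed

text \<open>Mollified forms fall under the smooth case, and near the image of the support of \<phi>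
  the differential of the mollified \<theta> is the mollified \<omega>. Both sides converge by
  \<open>pull_functional_tendsto\<close>.\<close>

lemma pull_weak_d_borel:
  fixes \<theta> \<omega> :: "'n form"
  assumes \<theta>: "\<theta> \<in> borel_measurable borel" "\<And>x. homog k (\<theta> x)"
    "\<And>K. compact K \<Longrightarrow> K \<subseteq> V \<Longrightarrow> integrable lborel (\<lambda>x. indicator K x *\<^sub>R \<theta> x)"
    and \<omega>: "\<omega> \<in> borel_measurable borel" "\<And>x. homog (Suc k) (\<omega> x)"
    "\<And>K. compact K \<Longrightarrow> K \<subseteq> V \<Longrightarrow> integrable lborel (\<lambda>x. indicator K x *\<^sub>R \<omega> x)"
    and d: "weak_d V k \<theta> \<omega>"
  shows "weak_d U k (\<lambda>x. pull (G x) (\<theta> (F x))) (\<lambda>x. pull (G x) (\<omega> (F x)))"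
  unfolding weak_d_iff[OF open_U]
proof (intro allI impI)
  fix m \<phi> assume m: "m + k + 1 = CARD('n)" and t: "test_form U m (\<phi> :: 'n form)"
  define S where "S = closure {x. \<phi> x \<noteq> 0}"
  have S: "compact S" "S \<subseteq> U" using t by (auto simp: test_form_def S_def)
  have \<phi>S: "\<phi> x = 0" "ext_deriv \<phi> x = 0" if "x \<notin> S" for x
    using that closure_subset[of "{x. \<phi> x \<noteq> 0}"] ext_deriv_zero_outside_support[of x \<phi>]
        by (auto simp: S_def)
  have tg: "global_test_form m \<phi>" by (rule test_form_global[OF t])
  obtain R where \<phi>': "smooth \<phi>" "continuous_on UNIV \<phi>" "\<And>x. R < norm x \<Longrightarrow> \<phi> x = 0"
    "continuous_on UNIV (ext_deriv \<phi>)" "\<And>x. R < norm x \<Longrightarrow> ext_deriv \<phi> x = 0"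
    using global_test_formE[OF tg] by metis
  show "(LINT x|lebesgue. wedge_top (pull (G x) (\<theta> (F x))) (ext_deriv \<phi> x)) =
    (- 1) ^ (k + 1) * (LINT x|lebesgue. wedge_top (pull (G x) (\<omega> (F x))) (\<phi> x))"
  proof (cases "S = {}")
    case True
    then show ?thesis using \<phi>S by (simp add: wedge_top.zero_right)
  next
    case False
    have FS: "compact (F ` S)" "F ` S \<noteq> {}" "F ` S \<subseteq> V"
      using S False F_in by (auto intro!: compact_continuous_image cont_F)
    obtain e where e: "e > 0" "{y. infdist y (F ` S) \<le> e} \<subseteq> V"
      by (rule compact_in_open_separated[OF FS(2,1) open_V FS(3)])
    \<comment> \<open>A compact neighbourhood of \<open>F\<close>
      S\<open>inside\<close>V\<open>: kernels of radius at most\<close>e\<open>centred at points of\<close>F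
      \<open>S\<close> stay within \<open>K\<close>.\<close>
    define K where "K = {y. infdist y (F ` S) \<le> e}"
    have K: "compact K" "K \<subseteq> V"
      using e compact_infdist_le[OF FS(2,1) e(1)] by (auto simp: K_def)
    define \<theta>' where "\<theta>' = (\<lambda>x. indicator K x *\<^sub>R \<theta> x)"
    define \<omega>' where "\<omega>' = (\<lambda>x. indicator K x *\<^sub>R \<omega> x)"
    have i: "integrable lborel \<theta>'" "integrable lborel \<omega>'" using \<theta>(3)[OF K] \<omega>(3)[OF K]
        by (simp_all add: \<theta>'_def \<omega>'_def)
    \<comment> \<open>One kernel has to serve both forms, because the identity for smooth forms
      couples the mollified \<theta> with the mollified \<omega>.\<close>
    have ex: "\<exists>\<rho>. \<exists>r\<le>e. mollifier r \<rho> \<and>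
      (integrable lborel (\<lambda>x. conv \<rho> \<theta>' x - \<theta>' x) \<and> (LINT x|lborel. norm (conv \<rho> \<theta>' x - \<theta>' x)) \<le>
          inverse (real (Suc j))) \<and>
      (integrable lborel (\<lambda>x. conv \<rho> \<omega>' x - \<omega>' x) \<and> (LINT x|lborel. norm (conv \<rho> \<omega>' x - \<omega>' x)) \<le>
          inverse (real (Suc j)))" for j :: nat
    proof -
      have pos: "0 < inverse (real (Suc j))" by simp
      obtain d1 where d1: "d1 > 0" "\<And>r \<rho>. r < d1 \<Longrightarrow> mollifier r \<rho> \<Longrightarrow>
        integrable lborel (\<lambda>x. conv \<rho> \<theta>' x - \<theta>' x) \<and> (LINT x|lborel. norm (conv \<rho> \<theta>' x - \<theta>' x)) \<le>
            inverse (real (Suc j))"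
        by (rule mollify_L1[OF i(1) pos]) (rule that)
      obtain d2 where d2: "d2 > 0" "\<And>r \<rho>. r < d2 \<Longrightarrow> mollifier r \<rho> \<Longrightarrow>
        integrable lborel (\<lambda>x. conv \<rho> \<omega>' x - \<omega>' x) \<and> (LINT x|lborel. norm (conv \<rho> \<omega>' x - \<omega>' x)) \<le>
            inverse (real (Suc j))"
        by (rule mollify_L1[OF i(2) pos]) (rule that)
      define r where "r = min e (min (d1 / 2) (d2 / 2))"
      have r: "0 < r" "r \<le> e" "r < d1" "r < d2" using e d1(1) d2(1) by (auto simp: r_def)
      obtain \<rho> :: "(real, 'n) vec \<Rightarrow> real" where \<rho>: "mollifier r \<rho>"
          by (rule mollifier_exists[OF r(1)])
      from d1(2)[OF r(3) \<rho>] d2(2)[OF r(4) \<rho>] \<rho> r(2) show ?thesis by blast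
    qed
    define Q where "Q j \<rho> \<longleftrightarrow> (\<exists>r\<le>e. mollifier r \<rho> \<and>
      (integrable lborel (\<lambda>x. conv \<rho> \<theta>' x - \<theta>' x) \<and> (LINT x|lborel. norm (conv \<rho> \<theta>' x - \<theta>' x)) \<le>
          inverse (real (Suc j))) \<and>
      (integrable lborel (\<lambda>x. conv \<rho> \<omega>' x - \<omega>' x) \<and> (LINT x|lborel. norm (conv \<rho> \<omega>' x - \<omega>' x)) \<le>
          inverse (real (Suc j))))"
      for j \<rho>
    have "\<exists>\<rho>. Q j \<rho>" for j using ex[of j] unfolding Q_def .
    then obtain \<rho> where "\<And>j. Q j (\<rho> j)" by metis
    note \<rho> = this[unfolded Q_def]
    have lim: "(\<lambda>j. LINT x|lborel. norm (conv (\<rho> j) \<theta>' x - \<theta>' x)) \<longlonglongrightarrow> 0"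
      "(\<lambda>j. LINT x|lborel. norm (conv (\<rho> j) \<omega>' x - \<omega>' x)) \<longlonglongrightarrow> 0"
      by (rule Lim_null_comparison[OF always_eventually[OF allI] LIMSEQ_inverse_real_of_nat], use \<rho>
          in force)+
    have h\<theta>: "homog k (\<theta>' x)" for x unfolding \<theta>'_def by (intro homog_scaleR \<theta>)
    have eqm: "(LINT x|lborel. wedge_top (pull (G x) (conv (\<rho> j) \<theta>' (F x))) (ext_deriv \<phi> x)) =
        (- 1) ^ (k + 1) * (LINT x|lborel. wedge_top (pull (G x) (conv (\<rho> j) \<omega>' (F x))) (\<phi> x))" for j
    proof -
      obtain r where r: "r \<le> e" "mollifier r (\<rho> j)" using \<rho>[of j] by blast
      note md = mollifierD[OF r(2)]
      have "integrable lborel (\<lambda>x. indicator (cball 0 R) x *\<^sub>R \<theta>' x)" for R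
        by (rule integrable_mult_indicator[OF _ i(1)]) simp
      then have li: "locally_integrable \<theta>'" by (simp add: locally_integrable_def)
      \<comment> \<open>The smooth case asks for global bounds on the form and its partial
        derivatives; they come from integrability of \<open>\<theta>'\<close> and boundedness of the
        kernel and its derivatives.\<close>
      have bd: "\<exists>A. \<forall>y. norm (conv \<kappa> \<theta>' y) \<le> A" if \<kappa>: "continuous_on UNIV \<kappa>" "\<And>x. r < norm x \<Longrightarrow>
          \<kappa> x = 0" for \<kappa>
      proof -
        obtain M where M: "0 \<le> M" "\<And>x. norm (\<kappa> x) \<le> M"
          by (rule compact_support_bounded[where \<rho> = \<kappa> and s =
              r]) (rule \<kappa>(1), erule \<kappa>(2), rule that)
        have "norm (conv \<kappa> \<theta>' y) \<le> (LINT z|lborel. M * norm (\<theta>' z))" for y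
          unfolding conv_def
          by (rule order_trans[OF integral_norm_bound integral_mono])
            (use i(1) M integrable_norm[OF integrable_conv_kernel[OF \<kappa> i(1)]] in \<open>auto intro!:
                mult_right_mono\<close>)
        then show ?thesis by blast
      qed
      have sm: "smooth (conv (\<rho> j) \<theta>')" by (rule smooth_conv(1)[OF md(1,3) li])
      have pt: "partial i (conv (\<rho> j) \<theta>') y = conv (partial i (\<rho> j)) \<theta>' y" for i y
        by (rule smooth_conv(2)[OF md(1,3) li])
      obtain A0 where A0: "\<And>y. norm (conv (\<rho> j) \<theta>' y) \<le> A0"
        using bd[OF smooth_continuous_on[OF md(1)] md(3)] by blast
      have "\<exists>A. \<forall>y. norm (conv (partial i (\<rho> j)) \<theta>' y) \<le> A" for i
        by (rule bd[OF smooth_continuous_on[OF smooth_partial[OF md(1)]] partial_support[OF md(3)]])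
      then obtain A1 where A1: "\<And>i y. norm (partial i (conv (\<rho> j) \<theta>') y) \<le> A1 i"
        unfolding pt by metis
      define A where "A = Max (insert A0 (range A1))"
      have A: "norm (conv (\<rho> j) \<theta>' y) \<le> A" "norm (partial i (conv (\<rho> j) \<theta>') y) \<le> A" for i y
        unfolding A_def by (rule order_trans[OF A0 Max_ge] order_trans[OF A1 Max_ge]; simp)+
      have hc: "homog k (conv (\<rho> j) \<theta>' y)" for y
        unfolding homog_def
      proof (intro allI impI)
        fix I :: "'n set" assume I: "card I \<noteq> k"
        have "conv (\<rho> j) \<theta>' y $ I = (LINT z|lborel. (\<rho> j (y - z) *\<^sub>R \<theta>' z) $ I)"
          unfolding conv_def
          by (rule integral_bounded_linear[OF bounded_linear_vec_nth integrable_conv_kernel[OF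
              smooth_continuous_on[OF md(1)] md(3) i(1)], symmetric])
        also have "\<dots> = 0" using h\<theta> I by (simp add: homog_def)
        finally show "conv (\<rho> j) \<theta>' y $ I = 0" .
      qed
      have "weak_ext_deriv k (\<lambda>x. pull (G x) (conv (\<rho> j) \<theta>' (F x))) (\<lambda>x. pull (G x) (ext_deriv
          (conv (\<rho> j) \<theta>') (F x)))"
        by (rule weak_ext_deriv_pull_smooth[OF jac sm hc A])
      then have "(LINT x|lborel. wedge_top (pull (G x) (conv (\<rho> j) \<theta>' (F x))) (ext_deriv \<phi> x)) =
        (- 1) ^ (k + 1) * (LINT x|lborel. wedge_top (pull (G x) (ext_deriv (conv (\<rho> j) \<theta>') (F x)))
            (\<phi> x))"
        using m tg unfolding weak_ext_deriv_def by blast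
      moreover have "wedge_top (pull (G x) (ext_deriv (conv (\<rho> j) \<theta>') (F x))) (\<phi> x) =
        wedge_top (pull (G x) (conv (\<rho> j) \<omega>' (F x))) (\<phi> x)" for x
      proof (cases "x \<in> S")
        case True
        have "cball (F x) r \<subseteq> K"
        proof
          fix z assume "z \<in> cball (F x) r"
          then have "dist z (F x) \<le> e" using r(1) by (simp add: dist_commute)
          moreover have "infdist z (F ` S) \<le> dist z (F x)" using True by (intro infdist_le) simp
          ultimately show "z \<in> K" by (simp add: K_def)
        qed
        then have "ext_deriv (conv (\<rho> j) \<theta>') (F x) = conv (\<rho> j) \<omega>' (F x)"
          unfolding \<theta>'_def \<omega>'_def
          using K(2) by (intro mollified_ext_deriv[OF open_V d i(1)[unfolded \<theta>'_def] \<theta>(2)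
              i(2)[unfolded \<omega>'_def] \<omega>(2) r(2)]) auto
        then show ?thesis by simp
      next
        case False
        then show ?thesis using \<phi>S by (simp add: wedge_top.zero_right)
      qed
      ultimately show ?thesis by simp
    qed
    have "(\<lambda>j. LINT x|lborel. wedge_top (pull (G x) (conv (\<rho> j) \<theta>' (F x))) (ext_deriv \<phi> x)) \<longlonglongrightarrow>
      (LINT x|lborel. wedge_top (pull (G x) (\<theta>' (F x))) (ext_deriv \<phi> x))"
      by (rule pull_functional_tendsto[OF \<phi>'(4,5) _ i(1) _ lim(1)]) (use \<rho> S \<phi>S in blast)+
    moreover have "(\<lambda>j. LINT x|lborel. wedge_top (pull (G x) (conv (\<rho> j) \<omega>' (F x))) (\<phi> x)) \<longlonglongrightarrow>
      (LINT x|lborel. wedge_top (pull (G x) (\<omega>' (F x))) (\<phi> x))"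
      by (rule pull_functional_tendsto[OF \<phi>'(2,3) _ i(2) _ lim(2)]) (use \<rho> S \<phi>S in blast)+
    then have "(\<lambda>j. LINT x|lborel. wedge_top (pull (G x) (conv (\<rho> j) \<theta>' (F x))) (ext_deriv \<phi> x)) \<longlonglongrightarrow>
      (- 1) ^ (k + 1) * (LINT x|lborel. wedge_top (pull (G x) (\<omega>' (F x))) (\<phi> x))"
      unfolding eqm by (intro tendsto_mult tendsto_const)
    ultimately have eq: "(LINT x|lborel. wedge_top (pull (G x) (\<theta>' (F x))) (ext_deriv \<phi> x)) =
      (- 1) ^ (k + 1) * (LINT x|lborel. wedge_top (pull (G x) (\<omega>' (F x))) (\<phi> x))"
      by (rule LIMSEQ_unique)
    have FK: "F x \<in> K" if "x \<in> S" for x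
      using that e(1) by (simp add: K_def)
    have 1: "wedge_top (pull (G x) (\<theta>' (F x))) (ext_deriv \<phi> x) =
        wedge_top (pull (G x) (\<theta> (F x))) (ext_deriv \<phi> x)"
      and 2: "wedge_top (pull (G x) (\<omega>' (F x))) (\<phi> x) = wedge_top (pull (G x) (\<omega> (F x))) (\<phi> x)"
          for x
      using \<phi>S[of x] FK[of x] by (cases "x \<in> S"; simp add: \<theta>'_def \<omega>'_def wedge_top.zero_right)+
    have "(\<lambda>x. wedge_top (pull (G x) (\<theta> (F x))) (ext_deriv \<phi> x)) \<in> borel_measurable borel"
      "(\<lambda>x. wedge_top (pull (G x) (\<omega> (F x))) (\<phi> x)) \<in> borel_measurable borel"
      by (intro borel_measurable_bilinear[OF bounded_bilinear_wedge_top] pull_meas \<theta> \<omega>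
          borel_measurable_continuous_onI[OF \<phi>'(2)] borel_measurable_continuous_onI[OF \<phi>'(4)])+
    then show ?thesis using eq unfolding 1 2 by (simp add: integral_completion)
  qed
qed

end

section \<open>Uniqueness of weak differentials and the chain rule\<close>

lemma locally_integrable_bounded_set:
  assumes "locally_integrable f" "K \<in> sets borel" "bounded K"
  shows "integrable lborel (\<lambda>x. indicator K x *\<^sub>R f x)"
proof -
  obtain R where R: "\<forall>x\<in>K. norm x \<le> R" using assms(3) by (auto simp: bounded_iff)
  have "integrable lborel (\<lambda>x. indicator (cball 0 R) x *\<^sub>R f x)"
    using assms(1) by (simp add: locally_integrable_def)
  from integrable_mult_indicator[OF _ this, of K] assms(2)
  have "integrable lborel (\<lambda>x. indicator K x *\<^sub>R indicator (cball 0 R) x *\<^sub>R f x)" by simp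
  also have "(\<lambda>x. indicator K x *\<^sub>R indicator (cball 0 R) x *\<^sub>R f x) = (\<lambda>x. indicator K x *\<^sub>R f x)"
    using R by (auto simp: indicator_def)
  finally show ?thesis .
qed

lemma weak_d_cong:
  assumes "\<And>x. x \<in> W \<Longrightarrow> \<omega> x = \<omega>' x" "\<And>x. x \<in> W \<Longrightarrow> \<eta> x = \<eta>' x"
  shows "weak_d W k \<omega> \<eta> \<longleftrightarrow> weak_d W k \<omega>' \<eta>'"
proof -
  have "form_integral W (wedge \<omega> \<psi>) = form_integral W (wedge \<omega>' \<psi>)"
    "form_integral W (wedge \<eta> \<psi>) = form_integral W (wedge \<eta>' \<psi>)" for \<psi>
    unfolding form_integral_def wedge_UNIV
    by (intro Bochner_Integration.integral_cong refl; simp add: assms)+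
  then show ?thesis by (simp add: weak_d_def)
qed

lemma weak_ext_deriv_imp_weak_d:
  fixes \<alpha> \<beta> :: "'n::{finite,linorder} form"
  assumes W: "open W" and w: "weak_ext_deriv k \<alpha> \<beta>" and m: "\<alpha> \<in> borel_measurable borel"
      "\<beta> \<in> borel_measurable borel"
  shows "weak_d W k \<alpha> \<beta>"
  unfolding weak_d_iff[OF W]
proof (intro allI impI)
  fix m \<phi> assume "m + k + 1 = CARD('n)" and t: "test_form W m (\<phi> :: 'n form)"
  then have "(LINT x|lborel. wedge_top (\<alpha> x) (ext_deriv \<phi> x)) =
      (- 1) ^ (k + 1) * (LINT x|lborel. wedge_top (\<beta> x) (\<phi> x))"
    using w test_form_global[OF t] unfolding weak_ext_deriv_def by blast
  moreover have sm: "smooth \<phi>" using t by (simp add: test_form_def)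
  have "(\<lambda>x. wedge_top (\<alpha> x) (ext_deriv \<phi> x)) \<in> borel_measurable borel"
      "(\<lambda>x. wedge_top (\<beta> x) (\<phi> x)) \<in> borel_measurable borel"
    by (intro borel_measurable_bilinear[OF bounded_bilinear_wedge_top] m
        borel_measurable_continuous_onI[OF smooth_continuous_on[OF sm]]
        borel_measurable_continuous_onI[OF smooth_continuous_on[OF smooth_ext_deriv[OF sm]]])+
  ultimately show "(LINT x|lebesgue. wedge_top (\<alpha> x) (ext_deriv \<phi> x)) =
      (- 1) ^ (k + 1) * (LINT x|lebesgue. wedge_top (\<beta> x) (\<phi> x))"
    by (simp add: integral_completion)
qed

text \<open>Well inside \<open>U\<close> the mollifications of both differentials equal the
  classical differential of the mollified \<theta>, so the mollified difference vanishes and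
  converges to the difference itself. Restricting to balls gives integrability; countably many of
  them exhaust the space.\<close>

lemma weak_d_unique_AE:
  fixes \<theta> \<omega> \<omega>' :: "'n::{finite,linorder} form"
  assumes U: "open U" and d: "weak_d U k \<theta> \<omega>" "weak_d U k \<theta> \<omega>'"
    and h: "\<And>x. homog k (\<theta> x)" "\<And>x. homog (Suc k) (\<omega> x)" "\<And>x. homog (Suc k) (\<omega>' x)"
    and li: "locally_integrable \<theta>" "locally_integrable \<omega>" "locally_integrable \<omega>'"
  shows "AE x in lborel. x \<in> U \<longrightarrow> \<omega> x = \<omega>' x"
proof -
  have "AE x in lborel. x \<in> U \<longrightarrow> norm x < real R \<longrightarrow> \<omega> x = \<omega>' x" for R :: nat
  proof -
    define K where "K = U \<inter> cball 0 (real R)"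
    have K: "K \<in> sets borel" "bounded K" using U by (auto simp: K_def intro: bounded_subset[OF
        bounded_cball])
    note i = li[THEN locally_integrable_bounded_set, OF K]
    define f where "f x = indicator K x *\<^sub>R \<omega> x - indicator K x *\<^sub>R \<omega>' x" for x
    have "integrable lborel f" unfolding f_def by (intro Bochner_Integration.integrable_diff i)
    then have "integrable lborel (\<lambda>x. indicator (cball 0 S) x *\<^sub>R f x)" for S
      by (intro integrable_mult_indicator) auto
    then have "locally_integrable f" by (simp add: locally_integrable_def)
    then obtain \<rho> where \<rho>: "\<And>m. mollifier (inverse (real (Suc m))) (\<rho> m)"
      and lim: "AE x in lborel. (\<lambda>m. conv (\<rho> m) f x) \<longlonglongrightarrow> f x"
      by (rule mollify_AE_tendsto) (rule that)
    show ?thesis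
      using lim
    proof (eventually_elim, intro impI)
      fix x assume l: "(\<lambda>m. conv (\<rho> m) f x) \<longlonglongrightarrow> f x" and x: "x \<in> U" "norm x < real R"
      have "open (U \<inter> ball 0 (real R))" "x \<in> U \<inter> ball 0 (real R)" using U x by auto
      then obtain e where e: "e > 0" "cball x e \<subseteq> U \<inter> ball 0 (real R)"
        unfolding open_contains_cball by blast
      have "conv (\<rho> m) f x = 0" if m: "inverse (real (Suc m)) < e" for m
      proof -
        have c: "cball x (inverse (real (Suc m))) \<subseteq> cball x e" using m by (intro subset_cball) simp
        then have s: "cball x (inverse (real (Suc m))) \<subseteq> U" "cball x (inverse (real (Suc m))) \<subseteq> K"
          using e(2) by (auto simp: K_def intro: less_imp_le)
        note md = mollifierD[OF \<rho>[of m]]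
        have iz: "integrable lborel (\<lambda>z. \<rho> m (x - z) *\<^sub>R \<eta> z)" if "integrable lborel \<eta>"
            for \<eta> :: "'n form"
          by (rule integrable_conv_kernel[OF smooth_continuous_on[OF md(1)] md(3) that])
        have "conv (\<rho> m) f x = conv (\<rho> m) (\<lambda>x. indicator K x *\<^sub>R \<omega> x) x - conv (\<rho> m) (\<lambda>x. indicator
            K x *\<^sub>R \<omega>' x) x"
          unfolding conv_def f_def scaleR_diff_right
          by (rule Bochner_Integration.integral_diff[OF iz[OF i(2)] iz[OF i(3)]])
        also have "\<dots> = 0"
          using mollified_ext_deriv[OF U d(1) i(1) h(1) i(2) h(2) \<rho> s] mollified_ext_deriv[OF U
              d(2) i(1) h(1) i(3) h(3) \<rho> s]
          by simp
        finally show ?thesis .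
      qed
      moreover have "\<forall>\<^sub>F m in sequentially. inverse (real (Suc m)) < e"
        by (rule order_tendstoD(2)[OF LIMSEQ_inverse_real_of_nat e(1)])
      ultimately have "\<forall>\<^sub>F m in sequentially. conv (\<rho> m) f x = 0" by (auto elim: eventually_mono)
      then have "(\<lambda>m. conv (\<rho> m) f x) \<longlonglongrightarrow> 0" by (rule tendsto_eventually)
      then have "f x = 0" using l LIMSEQ_unique by blast
      moreover have "x \<in> K" using x by (simp add: K_def)
      ultimately show "\<omega> x = \<omega>' x" by (simp add: f_def)
    qed
  qed
  then have "AE x in lborel. \<forall>R::nat. x \<in> U \<longrightarrow> norm x < real R \<longrightarrow> \<omega> x = \<omega>' x"
    by (subst AE_all_countable) auto
  then show ?thesis
    by eventually_elim (use reals_Archimedean2 in blast)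
qed

lemma lw_one_component: "lw u (axis {} 1) $ {i} = u $ i"
proof -
  have "lw u (axis {} 1) $ {i} = (\<Sum>j\<in>{i}. merge_sign {j} ({i} - {j}) * u $ j *
      axis {} 1 $ ({i} - {j}))"
    unfolding lw_def by (rule vec_lambda_beta)
  then show ?thesis by (simp add: axis_def)
qed

text \<open>Both sides are weak differentials of the coordinate functions: \<open>H\<close> pulls back to the identity.\<close>

lemma (in bilipschitz_chart) chain_rule:
  assumes J: "weak_jacobian D H K" and H: "\<And>y. y \<in> V \<Longrightarrow> H y = g y"
  shows "AE x in lborel. x \<in> U \<longrightarrow> K (F x) ** G x = mat 1"
proof -
  let ?e = "axis {} 1 :: (real, 'n set) vec"
  have e0: "homog 0 ?e" using homog_axis[of "{} :: 'n set" 1] by simp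
  have coord: "partial j (\<lambda>y::(real, 'n) vec. y $ l) y = axis l 1 $ j" for j y and l :: 'n
    by (rule trans[OF partial_eqI[OF bounded_linear.has_derivative[OF bounded_linear_vec_nth
        has_derivative_ident]]])
      (auto simp: axis_def)
  have g: "grad (\<lambda>y. y $ l) y = axis l 1" for y and l :: 'n
    by (simp add: grad_def coord vec_eq_iff)
  have sm: "smooth (\<lambda>y::(real, 'n) vec. y $ l)" for l by (rule smooth_bounded_linear[OF
      bounded_linear_vec_nth smooth_id])
  have row: "axis l 1 v* A = A $ l" for A :: "((real, 'n) vec, 'n) vec" and l
    by (simp add: vector_matrix_mult_def vec_eq_iff axis_def if_distrib[of "(*) _"] if_distrib[of
        "\<lambda>c. c * _"] cong: if_cong)
  have cH: "continuous_on UNIV H"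
    using J component_lipschitz_continuous by (auto simp: weak_jacobian_def)
  note bK = weak_jacobian_bounded_borel[OF J] and bG = weak_jacobian_bounded_borel[OF jac]
  have bKF: "bounded_borel (\<lambda>x. K (F x))"
    using bK measurable_compose[OF meas_F] unfolding bounded_borel_def by blast
  have "AE x in lborel. x \<in> U \<longrightarrow> K (F x) $ l v* G x = axis l 1" for l
  proof -
    \<comment> \<open>The 0-form given by the coordinate \<open>l\<close> of \<open>H\<close>, with
      differential the row \<open>l\<close> of \<open>K\<close>. Pulled back by \<open>F\<close> the
      function becomes \<open>x $ l\<close> on \<open>U\<close>, and the differential becomes the
      row \<open>l\<close> of the matrix product.\<close>
    define \<theta> where "\<theta> y = (H y $ l) *\<^sub>R ?e" for y
    define \<omega> where "\<omega> y = lw (K y $ l) ?e" for y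
    have "weak_ext_deriv 0 (\<lambda>y. (H y $ l) *\<^sub>R ?e) (\<lambda>y. lw (grad (\<lambda>y. y $ l) (H y) v* K y) ?e)"
    proof (rule weak_ext_deriv_compose_product[OF J sm])
      show "\<exists>c. \<forall>y::(real, 'n) vec. norm y \<le> R \<longrightarrow> \<bar>y $ l\<bar> \<le> c" for R
        using component_le_norm_cart order_trans by blast
      show "\<bar>partial j (\<lambda>y::(real, 'n) vec. y $ l) y\<bar> \<le> 1" for j y by (simp add: coord axis_def)
    qed (auto simp: bounded_borel_const e0 weak_ext_deriv_one)
    then have w: "weak_ext_deriv 0 \<theta> \<omega>" by (simp add: g row \<theta>_def[abs_def] \<omega>_def[abs_def])
    have c\<theta>: "continuous_on UNIV \<theta>" unfolding \<theta>_def by (intro continuous_intros cH)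
    have b\<omega>: "bounded_borel \<omega>" unfolding \<omega>_def
      by (intro bounded_borel_bilinear[OF bounded_bilinear_lw] bounded_borel_vec_nth bK
          bounded_borel_const)
    have m: "\<theta> \<in> borel_measurable borel" "\<omega> \<in> borel_measurable borel"
      using b\<omega> borel_measurable_continuous_onI[OF c\<theta>] by (auto simp: bounded_borel_def)
    have "weak_d V 0 \<theta> \<omega>" by (rule weak_ext_deriv_imp_weak_d[OF open_V w m])
    then have "weak_d U 0 (\<lambda>x. pull (G x) (\<theta> (F x))) (\<lambda>x. pull (G x) (\<omega> (F x)))"
    proof (rule pull_weak_d_borel[rotated -1])
      \<comment> \<open>Here \<open>K\<close> is a compact set; it shadows the Jacobian of
        \<open>H\<close>.\<close>
      show "integrable lborel (\<lambda>x. indicator K x *\<^sub>R \<theta> x)" if "compact K" for K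
        using that by (intro locally_integrable_bounded_set continuous_locally_integrable c\<theta>) (auto
            intro: compact_imp_bounded borel_compact)
      show "integrable lborel (\<lambda>x. indicator K x *\<^sub>R \<omega> x)" if "compact K" for K
        using that by (intro locally_integrable_bounded_set bounded_borel_locally_integrable b\<omega>)
            (auto intro: compact_imp_bounded borel_compact)
      show "homog 0 (\<theta> x)" for x unfolding \<theta>_def by (intro homog_scaleR e0)
      show "homog (Suc 0) (\<omega> x)" for x unfolding \<omega>_def by (intro homog_lw e0)
    qed (rule m)+
    moreover have "pull (G x) (\<theta> (F x)) = (x $ l) *\<^sub>R ?e" if "x \<in> U" for x
      using F_in[OF that] H by (simp add: \<theta>_def pull_scaleR pull_axis)
    moreover have "pull (G x) (\<omega> (F x)) = lw (K (F x) $ l v* G x) ?e" for x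
      by (simp add: \<omega>_def pull_lw pull_axis)
    ultimately have d1: "weak_d U 0 (\<lambda>x. (x $ l) *\<^sub>R ?e) (\<lambda>x. lw (K (F x) $ l v* G x) ?e)"
      by (subst weak_d_cong[where \<omega>' = "\<lambda>x. pull (G x) (\<theta> (F x))" and \<eta>' =
          "\<lambda>x. pull (G x) (\<omega> (F x))"]) auto
    have li: "locally_integrable (\<lambda>x::(real, 'n) vec. ?e)"
        by (intro continuous_locally_integrable continuous_on_const)
    have li0: "locally_integrable (\<lambda>x::(real, 'n) vec. 0 :: (real, 'n set) vec)"
        by (intro continuous_locally_integrable continuous_on_const)
    \<comment> \<open>The other differential of the same function comes from the product rule
      applied to the smooth coordinate and the constant form 1.\<close>
    have "weak_ext_deriv 0 (\<lambda>x. (x $ l) *\<^sub>R ?e) (\<lambda>x. lw (axis l 1) ?e)"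
      unfolding weak_ext_deriv_def
      using weak_ext_deriv_smooth_product[OF li _ e0 li0 _ weak_ext_deriv_one sm]
      by (simp add: g wedge_top.zero_left)
    then have d2: "weak_d U 0 (\<lambda>x. (x $ l) *\<^sub>R ?e) (\<lambda>x. lw (axis l 1) ?e)"
    proof (rule weak_ext_deriv_imp_weak_d[OF open_U])
      have "continuous_on UNIV (\<lambda>x::(real, 'n) vec. (x $ l) *\<^sub>R ?e)" by (intro continuous_intros)
      then show "(\<lambda>x::(real, 'n) vec. (x $ l) *\<^sub>R ?e) \<in> borel_measurable borel"
          by (rule borel_measurable_continuous_onI)
    qed simp
    have "AE x in lborel. x \<in> U \<longrightarrow> lw (K (F x) $ l v* G x) ?e = lw (axis l 1) ?e"
    proof (rule weak_d_unique_AE[OF open_U d1 d2])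
      show "locally_integrable (\<lambda>x::(real, 'n) vec. (x $ l) *\<^sub>R ?e)"
        by (intro continuous_locally_integrable continuous_intros)
      show "locally_integrable (\<lambda>x. lw (K (F x) $ l v* G x) ?e)"
        by (intro bounded_borel_locally_integrable bounded_borel_bilinear[OF bounded_bilinear_lw]
            bounded_borel_bilinear[OF bounded_bilinear_vector_matrix_mult] bounded_borel_vec_nth
                bKF bG bounded_borel_const)
      show "locally_integrable (\<lambda>x::(real, 'n) vec. lw (axis l 1) ?e)"
        by (intro continuous_locally_integrable continuous_on_const)
    qed (intro homog_scaleR homog_lw e0)+
    then show ?thesis
    proof (eventually_elim, intro impI)
      fix x assume "x \<in> U \<longrightarrow> lw (K (F x) $ l v* G x) ?e = lw (axis l 1) ?e" "x \<in> U"
      then have "lw (K (F x) $ l v* G x) ?e $ {i} = lw (axis l 1) ?e $ {i}" for i by simp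
      then show "K (F x) $ l v* G x = axis l 1" by (simp only: lw_one_component) (simp add:
          vec_eq_iff)
    qed
  qed
  then have "AE x in lborel. \<forall>l\<in>UNIV. x \<in> U \<longrightarrow> K (F x) $ l v* G x = axis l 1"
    by (subst AE_finite_all) auto
  then show ?thesis
  proof (eventually_elim, intro impI)
    fix x assume a: "\<forall>l\<in>UNIV. x \<in> U \<longrightarrow> K (F x) $ l v* G x = axis l 1" "x \<in> U"
    have "(K (F x) ** G x) $ l = mat 1 $ l" for l
      using a by (simp add: matrix_mult_row) (simp add: mat_def axis_def vec_eq_iff)
    then show "K (F x) ** G x = mat 1" by (simp add: vec_eq_iff)
  qed
qed

subsection \<open>Pullback of \<open>p\<close>-integrable forms\<close>

lemma AE_lebesgue_on_open:
  fixes W :: "'a::euclidean_space set"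
  assumes "open W"
  shows "(AE x in lebesgue_on W. P x) \<longleftrightarrow> (AE x in lborel. x \<in> W \<longrightarrow> P x)"
  using assms by (subst AE_restrict_space_iff) (auto simp: AE_completion_iff)

lemma borel_measurable_lebesgue_on_AE:
  fixes f f' :: "'a::euclidean_space \<Rightarrow> 'b::euclidean_space"
  assumes W: "open W" and f: "f \<in> borel_measurable (lebesgue_on W)"
      and ae: "AE x in lborel. x \<in> W \<longrightarrow> f x = f' x"
  shows "f' \<in> borel_measurable (lebesgue_on W)"
proof -
  have "(\<lambda>x. if x \<in> W then f x else 0) \<in> borel_measurable lebesgue"
    by (rule borel_measurable_if_I[OF f]) (use W in auto)
  then have "(\<lambda>x. if x \<in> W then f' x else 0) \<in> borel_measurable lebesgue"
  proof (rule borel_measurable_AE)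
    show "AE x in lebesgue. (if x \<in> W then f x else 0) = (if x \<in> W then f' x else 0)"
      unfolding AE_completion_iff using ae by eventually_elim auto
  qed
  then show ?thesis by (rule borel_measurable_if_D)
qed

lemma borel_measurable_lebesgue_on:
  "f \<in> borel_measurable borel \<Longrightarrow> f \<in> borel_measurable (lebesgue_on W)"
  by (intro measurable_restrict_space1 measurable_completion) simp

lemma weak_d_cong_AE:
  fixes \<omega> \<omega>' \<eta> \<eta>' :: "'n::{finite,linorder} form"
  assumes W: "open W" and m: "\<omega> \<in> borel_measurable (lebesgue_on W)"
      "\<eta> \<in> borel_measurable (lebesgue_on W)"
    and ae: "AE x in lborel. x \<in> W \<longrightarrow> \<omega> x = \<omega>' x" "AE x in lborel. x \<in> W \<longrightarrow> \<eta> x = \<eta>' x"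
    and d: "weak_d W k \<omega> \<eta>"
  shows "weak_d W k \<omega>' \<eta>'"
proof -
  have eq: "form_integral W (wedge \<alpha> \<psi>) = form_integral W (wedge \<alpha>' \<psi>)"
    if \<alpha>: "\<alpha> \<in> borel_measurable (lebesgue_on W)" "AE x in lborel. x \<in> W \<longrightarrow> \<alpha> x = \<alpha>' x"
        and \<psi>: "smooth \<psi>"
    for \<alpha> \<alpha>' \<psi> :: "'n form"
    unfolding form_integral_def wedge_UNIV
  proof (rule integral_cong_AE)
    have p: "\<psi> \<in> borel_measurable (lebesgue_on W)"
      by (intro borel_measurable_lebesgue_on borel_measurable_continuous_onI smooth_continuous_on \<psi>)
    show "(\<lambda>x. wedge_top (\<alpha> x) (\<psi> x)) \<in> borel_measurable (lebesgue_on W)"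
      by (rule borel_measurable_bilinear[OF bounded_bilinear_wedge_top \<alpha>(1) p])
    show "(\<lambda>x. wedge_top (\<alpha>' x) (\<psi> x)) \<in> borel_measurable (lebesgue_on W)"
      by (rule borel_measurable_bilinear[OF bounded_bilinear_wedge_top
          borel_measurable_lebesgue_on_AE[OF W \<alpha>] p])
    show "AE x in lebesgue_on W. wedge_top (\<alpha> x) (\<psi> x) = wedge_top (\<alpha>' x) (\<psi> x)"
      unfolding AE_lebesgue_on_open[OF W] using \<alpha>(2) by eventually_elim auto
  qed
  show ?thesis
    unfolding weak_d_def
  proof (intro allI impI)
    fix m \<phi> assume "m + k + 1 = CARD('n)" and t: "test_form W m (\<phi> :: 'n form)"
    then have "form_integral W (wedge \<omega> (ext_deriv \<phi>)) =
        (- 1) ^ (k + 1) * form_integral W (wedge \<eta> \<phi>)"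
      using d unfolding weak_d_def by blast
    moreover have "smooth \<phi>" using t by (simp add: test_form_def)
    ultimately show "form_integral W (wedge \<omega>' (ext_deriv \<phi>)) =
        (- 1) ^ (k + 1) * form_integral W (wedge \<eta>' \<phi>)"
      using eq[OF m(1) ae(1) smooth_ext_deriv] eq[OF m(2) ae(2)] by simp
  qed
qed

text \<open>Composition with \<open>F\<close> is immediate for Borel functions, whereas elements of
  \<open>Omega\<close> are only Lebesgue measurable on \<open>W\<close>. Each coefficient is
  replaced by a Borel version, and dropping the coefficients of other degrees makes the result
  homogeneous at every point.\<close>

lemma form_borel_representative:
  fixes \<theta> :: "'n::{finite,linorder} form"
  assumes W: "open W" and f: "is_form W k \<theta>" and m: "\<theta> \<in> borel_measurable (lebesgue_on W)"
  obtains \<theta>' where "\<theta>' \<in> borel_measurable borel" "\<And>x. homog k (\<theta>' x)" "AE x in lborel. x \<in> W \<longrightarrow>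
      \<theta> x = \<theta>' x"
proof -
  have m': "(\<lambda>x. if x \<in> W then \<theta> x else 0) \<in> borel_measurable lebesgue"
    by (rule borel_measurable_if_I[OF m]) (use W in auto)
  define Q where "Q I h \<longleftrightarrow> h \<in> borel_measurable borel \<and> (AE x in lborel. (if x \<in> W then \<theta> x else 0)
      $ I = h x)"
    for I and h :: "(real, 'n) vec \<Rightarrow> real"
  have "\<exists>h. Q I h" for I
  proof -
    have "(\<lambda>x. (if x \<in> W then \<theta> x else 0) $ I) \<in> borel_measurable lebesgue"
      using borel_measurable_continuous_on[where f = "\<lambda>A. A $ I", OF _ m']
          by (simp add: continuous_on_component)
    from completion_ex_borel_measurable_real[OF this] show ?thesis by (auto simp: Q_def)
  qed
  then obtain h where "\<And>I. Q I (h I)" by metis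
  then have h: "\<And>I. h I \<in> borel_measurable borel"
    "\<And>I. AE x in lborel. (if x \<in> W then \<theta> x else 0) $ I = h I x"
    unfolding Q_def by auto
  define \<theta>' where "\<theta>' x = (\<Sum>I\<in>{I. card I = k}. h I x *\<^sub>R axis I (1::real))" for x
  show thesis
  proof (rule that)
    show "\<theta>' \<in> borel_measurable borel"
      unfolding \<theta>'_def by (intro borel_measurable_sum borel_measurable_scaleR h) simp
    show "homog k (\<theta>' x)" for x
      unfolding \<theta>'_def using homog_axis by (intro homog_sum homog_scaleR) auto
    have "AE x in lborel. \<forall>I\<in>UNIV. (if x \<in> W then \<theta> x else 0) $ I = h I x"
      by (rule AE_finite_allI) (use h in auto)
    then show "AE x in lborel. x \<in> W \<longrightarrow> \<theta> x = \<theta>' x"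
    proof (eventually_elim, intro impI)
      fix x assume a: "\<forall>I\<in>UNIV. (if x \<in> W then \<theta> x else 0) $ I = h I x" "x \<in> W"
      have "\<theta>' x $ J = \<theta> x $ J" for J
      proof -
        have "\<theta>' x $ J = (\<Sum>I\<in>{I. card I = k}. if I = J then \<theta> x $ J else 0)"
          unfolding \<theta>'_def sum_component using a by (intro sum.cong) (auto simp: axis_def)
        also have "\<dots> = \<theta> x $ J"
          using f a(2) by (auto simp: is_form_def)
        finally show ?thesis .
      qed
      then show "\<theta> x = \<theta>' x" by (simp add: vec_eq_iff)
    qed
  qed
qed

lemma Omega_nn_integral:
  fixes \<theta> :: "'n::{finite,linorder} form"
  assumes W: "open W" and ae: "AE x in lborel. x \<in> W \<longrightarrow> \<theta> x = \<theta>' x"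
  shows "(\<integral>\<^sup>+x. ennreal (norm (\<theta> x) powr p) \<partial>lebesgue_on W) =
      (\<integral>\<^sup>+x. ennreal (norm (\<theta>' x) powr p) * indicator W x \<partial>lborel)"
proof -
  have "(\<integral>\<^sup>+x. ennreal (norm (\<theta> x) powr p) \<partial>lebesgue_on W) =
      (\<integral>\<^sup>+x. ennreal (norm (\<theta> x) powr p) * indicator W x \<partial>lborel)"
    using W by (subst nn_integral_restrict_space) (auto simp: nn_integral_completion)
  also have "\<dots> = (\<integral>\<^sup>+x. ennreal (norm (\<theta>' x) powr p) * indicator W x \<partial>lborel)"
  proof (rule nn_integral_cong_AE)
    show "AE x in lborel. ennreal (norm (\<theta> x) powr p) * indicator W x =
        ennreal (norm (\<theta>' x) powr p) * indicator W x"
      using ae by eventually_elim (auto simp: indicator_def)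
  qed
  finally show ?thesis .
qed

text \<open>The inequality \<open>t \<le> 1 + t powr p\<close> dominates the norm on a set of finite
  measure.\<close>

lemma Omega_locally_integrable:
  fixes \<theta> \<theta>' :: "'n::{finite,linorder} form"
  assumes W: "open W" and \<theta>: "\<theta> \<in> Omega W k p" and p: "1 \<le> p"
    and \<theta>': "\<theta>' \<in> borel_measurable borel" "AE x in lborel. x \<in> W \<longrightarrow> \<theta> x = \<theta>' x"
    and K: "compact K" "K \<subseteq> W"
  shows "integrable lborel (\<lambda>x. indicator K x *\<^sub>R \<theta>' x)"
proof (rule integrableI_bounded)
  have Kb: "K \<in> sets borel" using K by (simp add: borel_compact)
  show "(\<lambda>x. indicator K x *\<^sub>R \<theta>' x) \<in> borel_measurable lborel"
    using Kb \<theta>' by (intro borel_measurable_scaleR borel_measurable_indicator) auto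
  note [measurable] = \<theta>'(1) Kb
  have t: "t \<le> 1 + t powr p" if "0 \<le> t" for t :: real
  proof (cases "t \<le> 1")
    case True
    then show ?thesis using powr_ge_zero[of t p] by linarith
  next
    case False
    then have "t powr 1 \<le> t powr p" using p by (intro powr_mono) auto
    then show ?thesis using False by simp
  qed
  have "(\<integral>\<^sup>+x. ennreal (norm (indicator K x *\<^sub>R \<theta>' x)) \<partial>lborel) \<le>
    (\<integral>\<^sup>+x. indicator K x + ennreal (norm (\<theta>' x) powr p) * indicator W x \<partial>lborel)"
  proof (rule nn_integral_mono)
    fix x
    show "ennreal (norm (indicator K x *\<^sub>R \<theta>' x)) \<le> indicator K x + ennreal (norm (\<theta>' x) powr p) *
        indicator W x"
    proof (cases "x \<in> K")
      case True
      have "ennreal (norm (\<theta>' x)) \<le> ennreal (1 + norm (\<theta>' x) powr p)" by (intro ennreal_leI t) simp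
      then show ?thesis using True K(2) by (auto simp: subset_iff)
    qed simp
  qed
  also have "\<dots> = emeasure lborel K + (\<integral>\<^sup>+x. ennreal (norm (\<theta>' x) powr p) * indicator W x \<partial>lborel)"
    using W by (subst nn_integral_add) auto
  also have "\<dots> < \<infinity>"
  proof -
    have "(\<integral>\<^sup>+x. ennreal (norm (\<theta> x) powr p) \<partial>lebesgue_on W) < \<infinity>"
      using \<theta> nn_integral_eq_integral[of "lebesgue_on W" "\<lambda>x. norm (\<theta> x) powr p"]
          by (simp add: Omega_def)
    then have "(\<integral>\<^sup>+x. ennreal (norm (\<theta>' x) powr p) * indicator W x \<partial>lborel) < \<infinity>"
      unfolding Omega_nn_integral[OF W \<theta>'(2)] .
    moreover have "emeasure lborel K < \<infinity>" using emeasure_bounded_finite[OF compact_imp_bounded[OF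
        K(1)]] .
    ultimately show ?thesis by (simp add: less_top)
  qed
  finally show "(\<integral>\<^sup>+x. ennreal (norm (indicator K x *\<^sub>R \<theta>' x)) \<partial>lborel) < \<infinity>" .
qed

context bilipschitz_chart
begin

definition pb :: "'n form \<Rightarrow> 'n form" where
  "pb \<theta> = (\<lambda>x. pull (G x) (\<theta> (F x)))"

text \<open>Applied to the indicator of a null set of \<open>V\<close>, the volume inequality shows
  that its preimage in \<open>U\<close> is a null set. This makes pullback well defined on
  equivalence classes.\<close>

lemma AE_compose_F:
  assumes "AE y in lborel. y \<in> V \<longrightarrow> P y"
  shows "AE x in lborel. x \<in> U \<longrightarrow> P (F x)"
proof -
  obtain N where N: "{y \<in> space lborel. \<not> (y \<in> V \<longrightarrow> P y)} \<subseteq> N" "emeasure lborel N = 0"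
      "N \<in> sets lborel"
    by (rule AE_E[OF assms])
  have [measurable]: "N \<in> sets borel" using N(3) by simp
  have "(\<integral>\<^sup>+x. indicator N (F x) * indicator U x \<partial>lborel) \<le>
      ennreal (C ^ CARD('n)) * (\<integral>\<^sup>+y. indicator N y * indicator V y \<partial>lborel)"
    by (rule nn_integral_F) simp
  also have "(\<integral>\<^sup>+y. indicator N y * indicator V y \<partial>lborel) \<le> (\<integral>\<^sup>+y. indicator N y \<partial>lborel)"
    by (intro nn_integral_mono) (auto simp: indicator_def)
  also have "(\<integral>\<^sup>+y. indicator N y \<partial>lborel) = 0" using N by simp
  finally have "(\<integral>\<^sup>+x. indicator N (F x) * indicator U x \<partial>lborel) = (0 :: ennreal)"
    by (simp add: mult_left_mono)
  moreover have "(\<lambda>x. indicator N (F x) * indicator U x :: ennreal) \<in> borel_measurable lborel"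
  proof -
    have "U \<in> sets borel" using open_U by simp
    then show ?thesis by measurable
  qed
  ultimately have "AE x in lborel. indicator N (F x) * indicator U x = (0 :: ennreal)"
    using nn_integral_0_iff_AE by blast
  then show ?thesis
  proof (eventually_elim, intro impI)
    fix x assume "indicator N (F x) * indicator U x = (0 :: ennreal)" "x \<in> U"
    then have "F x \<notin> N" by (auto simp: indicator_def)
    then show "P (F x)" using N(1) F_in[OF \<open>x \<in> U\<close>] by auto
  qed
qed

lemma AE_pb:
  assumes "AE y in lborel. y \<in> V \<longrightarrow> \<theta> y = \<theta>' y"
  shows "AE x in lborel. x \<in> U \<longrightarrow> pb \<theta> x = pb \<theta>' x"
  using AE_compose_F[OF assms] by eventually_elim (auto simp: pb_def)

text \<open>The first factors are the pointwise bound \<open>norm_pull\<close>, with entries of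
  \<open>G\<close> at most \<open>C\<close>. The factor \<open>C ^ n\<close> from the change of
  variables becomes \<open>C powr (n / p)\<close> after taking the root of order
  \<open>p\<close>.\<close>

lemma pb_Omega:
  assumes \<theta>: "\<theta> \<in> Omega V k p" and k: "k \<le> CARD('n)" and p: "1 \<le> p"
  shows "pb \<theta> \<in> Omega U k p"
    and "Omega_norm U p (pb \<theta>) \<le>
      (fact CARD('n) / fact (CARD('n) - k) * C ^ k * C powr (real CARD('n) / p)) * Omega_norm V p \<theta>"
proof -
  have f: "is_form V k \<theta>" and m: "\<theta> \<in> borel_measurable (lebesgue_on V)"
    and i: "integrable (lebesgue_on V) (\<lambda>x. norm (\<theta> x) powr p)"
    using \<theta> by (auto simp: Omega_def)
  obtain \<theta>' where \<theta>': "\<theta>' \<in> borel_measurable borel" "\<And>x. homog k (\<theta>' x)" "AE x in lborel. x \<in> V \<longrightarrow>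
      \<theta> x = \<theta>' x"
    by (rule form_borel_representative[OF open_V f m]) (rule that)
  have ae: "AE x in lborel. x \<in> U \<longrightarrow> pb \<theta> x = pb \<theta>' x" by (rule AE_pb[OF \<theta>'(3)])
  have pm: "pb \<theta>' \<in> borel_measurable borel" unfolding pb_def by (rule pull_meas[OF \<theta>'(1)])
  have "AE x in lborel. x \<in> U \<longrightarrow> pb \<theta>' x = pb \<theta> x" using ae by eventually_elim auto
  then have pm': "pb \<theta> \<in> borel_measurable (lebesgue_on U)"
    by (rule borel_measurable_lebesgue_on_AE[OF open_U borel_measurable_lebesgue_on[OF pm]])
  have form: "is_form U k (pb \<theta>)"
    using homog_pull[of k] f F_in unfolding is_form_def pb_def homog_def by blast
  define A where "A = fact CARD('n) / fact (CARD('n) - k) * C ^ k"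
  have A: "0 \<le> A" using C_pos by (simp add: A_def)
  define I where "I = (LINT x|lebesgue_on V. norm (\<theta> x) powr p)"
  have I: "0 \<le> I" by (simp add: I_def)
  have G: "\<bar>G x $ j $ i\<bar> \<le> C" for x j i using jac by (simp add: weak_jacobian_def)
  have "(\<integral>\<^sup>+x. ennreal (norm (pb \<theta> x) powr p) \<partial>lebesgue_on U) =
      (\<integral>\<^sup>+x. ennreal (norm (pb \<theta>' x) powr p) * indicator U x \<partial>lborel)"
    by (rule Omega_nn_integral[OF open_U ae])
  also have "\<dots> \<le> (\<integral>\<^sup>+x. ennreal (A powr p) * (ennreal (norm (\<theta>' (F x)) powr p) *
      indicator U x) \<partial>lborel)"
  proof (rule nn_integral_mono)
    fix x
    have "norm (pb \<theta>' x) \<le> A * norm (\<theta>' (F x))"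
      unfolding pb_def A_def by (rule norm_pull[OF G \<theta>'(2) k])
    then have "norm (pb \<theta>' x) powr p \<le> (A * norm (\<theta>' (F x))) powr p"
      using p by (intro powr_mono2) auto
    also have "\<dots> = A powr p * norm (\<theta>' (F x)) powr p" by (simp add: powr_mult)
    finally have "ennreal (norm (pb \<theta>' x) powr p) \<le> ennreal (A powr p) *
        ennreal (norm (\<theta>' (F x)) powr p)"
      by (simp add: ennreal_mult[symmetric] ennreal_leI)
    then show "ennreal (norm (pb \<theta>' x) powr p) * indicator U x \<le>
        ennreal (A powr p) * (ennreal (norm (\<theta>' (F x)) powr p) * indicator U x)"
      by (auto simp: indicator_def)
  qed
  also have "\<dots> = ennreal (A powr p) * (\<integral>\<^sup>+x. ennreal (norm (\<theta>' (F x)) powr p) *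
      indicator U x \<partial>lborel)"
  proof (rule nn_integral_cmult)
    have "U \<in> sets borel" using open_U by simp
    moreover note \<theta>'(1)[measurable]
    ultimately show "(\<lambda>x. ennreal (norm (\<theta>' (F x)) powr p) *
        indicator U x) \<in> borel_measurable lborel" by measurable
  qed
  also have "\<dots> \<le> ennreal (A powr p) * (ennreal (C ^ CARD('n)) *
      (\<integral>\<^sup>+y. ennreal (norm (\<theta>' y) powr p) * indicator V y \<partial>lborel))"
  proof (intro mult_left_mono nn_integral_F[of "\<lambda>y. ennreal (norm (\<theta>' y) powr p)"])
    note \<theta>'(1)[measurable]
    show "(\<lambda>y. ennreal (norm (\<theta>' y) powr p)) \<in> borel_measurable borel" by measurable
  qed simp
  also have "(\<integral>\<^sup>+y. ennreal (norm (\<theta>' y) powr p) * indicator V y \<partial>lborel) = ennreal I"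
    unfolding Omega_nn_integral[OF open_V \<theta>'(3), symmetric] I_def
        by (rule nn_integral_eq_integral[OF i]) simp
  also have "ennreal (A powr p) * (ennreal (C ^ CARD('n)) * ennreal I) =
      ennreal (A powr p * C ^ CARD('n) * I)"
    using C_pos I by (simp add: ennreal_mult[symmetric] mult.assoc)
  finally have le: "(\<integral>\<^sup>+x. ennreal (norm (pb \<theta> x) powr p) \<partial>lebesgue_on U) \<le>
      ennreal (A powr p * C ^ CARD('n) * I)" .
  have mm: "(\<lambda>x. norm (pb \<theta> x) powr p) \<in> borel_measurable (lebesgue_on U)"
  proof (rule measurable_compose[OF pm'])
    show "(\<lambda>v::(real, 'n set) vec. norm v powr p) \<in> borel_measurable borel" by measurable
  qed
  have int: "integrable (lebesgue_on U) (\<lambda>x. norm (pb \<theta> x) powr p)"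
    by (rule integrableI_bounded[OF mm]) (use le in \<open>auto intro: le_less_trans\<close>)
  then show "pb \<theta> \<in> Omega U k p" using form pm' by (simp add: Omega_def)
  have "ennreal (LINT x|lebesgue_on U. norm (pb \<theta> x) powr p) \<le>
      ennreal (A powr p * C ^ CARD('n) * I)"
    using le nn_integral_eq_integral[OF int] by simp
  then have "(LINT x|lebesgue_on U. norm (pb \<theta> x) powr p) \<le> A powr p * C ^ CARD('n) * I"
    using C_pos I by (subst (asm) ennreal_le_iff) auto
  then have "Omega_norm U p (pb \<theta>) \<le> (A powr p * C ^ CARD('n) * I) powr (1 / p)"
    unfolding Omega_norm_def using p by (intro powr_mono2) auto
  also have "\<dots> = (A powr p) powr (1 / p) * (C ^ CARD('n)) powr (1 / p) * I powr (1 / p)"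
    using C_pos I by (simp add: powr_mult)
  also have "(A powr p) powr (1 / p) = A" using A p by (simp add: powr_powr)
  also have "(C ^ CARD('n)) powr (1 / p) = C powr (real CARD('n) / p)"
    using C_pos by (simp add: powr_realpow[symmetric] powr_powr)
  finally show "Omega_norm U p (pb \<theta>) \<le>
      (fact CARD('n) / fact (CARD('n) - k) * C ^ k * C powr (real CARD('n) / p)) * Omega_norm V p \<theta>"
    by (simp add: A_def I_def Omega_norm_def)
qed

text \<open>Passing to Borel representatives alters the forms on null sets of \<open>V\<close> and,
  by \<open>AE_pb\<close>, their pullbacks on null sets of \<open>U\<close>, which the weak
  differential does not see.\<close>

lemma pb_weak_d:
  assumes \<theta>: "\<theta> \<in> Omega V k p" and \<omega>: "\<omega> \<in> Omega V (Suc k) p" and p: "1 \<le> p" and d: "weak_d V k \<theta> \<omega>"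
  shows "weak_d U k (pb \<theta>) (pb \<omega>)"
proof -
  have m: "\<theta> \<in> borel_measurable (lebesgue_on V)" "\<omega> \<in> borel_measurable (lebesgue_on V)"
    and f: "is_form V k \<theta>" "is_form V (Suc k) \<omega>" using \<theta> \<omega> by (auto simp: Omega_def)
  obtain \<theta>' where \<theta>': "\<theta>' \<in> borel_measurable borel" "\<And>x. homog k (\<theta>' x)" "AE x in lborel. x \<in> V \<longrightarrow>
      \<theta> x = \<theta>' x"
    by (rule form_borel_representative[OF open_V f(1) m(1)]) (rule that)
  obtain \<omega>' where \<omega>': "\<omega>' \<in> borel_measurable borel" "\<And>x. homog (Suc k) (\<omega>' x)"
      "AE x in lborel. x \<in> V \<longrightarrow> \<omega> x = \<omega>' x"
    by (rule form_borel_representative[OF open_V f(2) m(2)]) (rule that)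
  have "weak_d V k \<theta>' \<omega>'" by (rule weak_d_cong_AE[OF open_V m \<theta>'(3) \<omega>'(3) d])
  then have "weak_d U k (pb \<theta>') (pb \<omega>')"
    unfolding pb_def
    by (intro pull_weak_d_borel \<theta>' \<omega>' Omega_locally_integrable[OF open_V \<theta> p \<theta>'(1,3)]
        Omega_locally_integrable[OF open_V \<omega> p \<omega>'(1,3)])
  then show ?thesis
  proof (rule weak_d_cong_AE[OF open_U, rotated -1])
    show "pb \<theta>' \<in> borel_measurable (lebesgue_on U)" "pb \<omega>' \<in> borel_measurable (lebesgue_on U)"
      unfolding pb_def by (intro borel_measurable_lebesgue_on pull_meas \<theta>' \<omega>')+
    show "AE x in lborel. x \<in> U \<longrightarrow> pb \<theta>' x = pb \<theta> x" using AE_pb[OF \<theta>'(3)] by eventually_elim auto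
    show "AE x in lborel. x \<in> U \<longrightarrow> pb \<omega>' x = pb \<omega> x" using AE_pb[OF \<omega>'(3)] by eventually_elim auto
  qed
qed

text \<open>The pullback of a primitive is a primitive of the pullback. For the chart of the inverse
  map this places pulled back exact forms into the domain of \<open>P\<close>.\<close>

lemma pb_B:
  assumes \<omega>: "\<omega> \<in> B V k p" and k: "1 \<le> k" "k \<le> CARD('n)" and p: "1 \<le> p"
  shows "pb \<omega> \<in> B U k p"
proof -
  obtain \<theta> where \<theta>: "\<theta> \<in> Omega V (k - 1) p" "weak_d V (k - 1) \<theta> \<omega>" and o: "\<omega> \<in> Omega V k p"
    using \<omega> by (auto simp: B_def Omega_pp_def)
  have sk: "Suc (k - 1) = k" using k by simp
  have d: "weak_d U (k - 1) (pb \<theta>) (pb \<omega>)"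
    by (rule pb_weak_d[OF \<theta>(1) _ p \<theta>(2)]) (use o sk in simp)
  moreover have "pb \<theta> \<in> Omega U (k - 1) p" "pb \<omega> \<in> Omega U k p"
    using pb_Omega(1)[OF \<theta>(1) _ p] pb_Omega(1)[OF o k(2) p] k by auto
  ultimately show ?thesis
    using sk by (auto simp: B_def Omega_pp_def)
qed

end

section \<open>Operator norms and the proof of the theorem\<close>

lemma B_zero: "(\<lambda>x. 0) \<in> B W k p"
proof -
  have z: "(\<lambda>x. 0) \<in> Omega W k p" for k by (simp add: Omega_def is_form_def)
  moreover have "weak_d W k (\<lambda>x. 0) (\<lambda>x. 0)" for k
    by (simp add: weak_d_def form_integral_def wedge_def)
  ultimately show ?thesis by (auto simp: B_def Omega_pp_def)
qed

lemma Omega_norm_nonneg: "0 \<le> Omega_norm W p \<omega>"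
  by (simp add: Omega_norm_def)

lemma Omega_norm_zero: "Omega_norm W p (\<lambda>x. 0) = 0"
  by (simp add: Omega_norm_def)

text \<open>A real supremum bounds its elements only once the set is known to be bounded above; the
  boundedness clause of \<open>form_operator\<close> supplies this. The zero form contributes the
  quotient 0, which yields \<open>0 \<le> M\<close>.\<close>

lemma operator_norm_upper:
  assumes T: "form_operator W k p T" and \<omega>: "\<omega> \<in> B W k p" and M: "operator_norm W k p T \<le> M"
  shows "Omega_norm W p (T \<omega>) \<le> M * Omega_norm W p \<omega>" and "0 \<le> M"
proof -
  obtain K where K: "\<And>\<omega>. \<omega> \<in> B W k p \<Longrightarrow> Omega_norm W p (T \<omega>) \<le> K * Omega_norm W p \<omega>"
    using T unfolding form_operator_def by blast
  have "Omega_norm W p (T \<omega>) / Omega_norm W p \<omega> \<le> max K 0" if "\<omega> \<in> B W k p" for \<omega>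
  proof (cases "Omega_norm W p \<omega> = 0")
    case False
    then have "0 < Omega_norm W p \<omega>" using Omega_norm_nonneg[of W p \<omega>] by linarith
    then have "Omega_norm W p (T \<omega>) / Omega_norm W p \<omega> \<le> K"
      using K[OF that] by (simp add: divide_le_eq)
    then show ?thesis by simp
  qed simp
  then have "bdd_above ((\<lambda>\<omega>. Omega_norm W p (T \<omega>) / Omega_norm W p \<omega>) ` B W k p)"
    by (rule bdd_aboveI2)
  then have le: "Omega_norm W p (T \<omega>) / Omega_norm W p \<omega> \<le> M" if "\<omega> \<in> B W k p" for \<omega>
    using cSUP_upper[OF that] M unfolding operator_norm_def by (meson order_trans)
  show "0 \<le> M" using le[OF B_zero] by (simp add: Omega_norm_zero)
  show "Omega_norm W p (T \<omega>) \<le> M * Omega_norm W p \<omega>"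
  proof (cases "Omega_norm W p \<omega> = 0")
    case True
    \<comment> \<open>For a form of norm 0 the quotient is 0 by convention and says nothing about
      the image; boundedness of the operator forces the norm of the image to be 0.\<close>
    then show ?thesis using K[OF \<omega>] by simp
  next
    case False
    then have "0 < Omega_norm W p \<omega>" using Omega_norm_nonneg[of W p \<omega>] by linarith
    then show ?thesis using le[OF \<omega>] by (simp add: divide_le_eq)
  qed
qed

lemma operator_norm_le:
  assumes "\<And>\<omega>. \<omega> \<in> B W k p \<Longrightarrow> Omega_norm W p (T \<omega>) \<le> M * Omega_norm W p \<omega>" "0 \<le> M"
  shows "operator_norm W k p T \<le> M"
  unfolding operator_norm_def
proof (rule cSUP_least)
  show "B W k p \<noteq> {}" using B_zero by blast
  fix \<omega> assume "\<omega> \<in> B W k p"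
  then show "Omega_norm W p (T \<omega>) / Omega_norm W p \<omega> \<le> M"
    using assms(1)[of \<omega>] assms(2) Omega_norm_nonneg[of W p \<omega>]
    by (cases "Omega_norm W p \<omega> = 0") (auto simp: divide_le_eq)
qed

lemma open_nonempty_two_points:
  fixes U :: "'a::euclidean_space set"
  assumes "open U" "U \<noteq> {}"
  obtains x y where "x \<in> U" "y \<in> U" "x \<noteq> y"
  using assms by (metis all_not_in_conv islimptE islimpt_UNIV open_UNIV UNIV_I Int_iff islimpt_def)

theorem theorem3p1:
  fixes U V :: "(real ^ 'n::{finite,linorder}) set"
    and C M p :: real and k :: nat
    and P :: "'n form \<Rightarrow> 'n form"
  assumes "open U" and "open V"
    and "bi_lipschitz_homeomorphic C U V"
    and "1 \<le> k" and "k \<le> CARD('n)"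
    and "1 \<le> p"
    and "form_operator V k p P"
    and "\<And>\<omega>. \<omega> \<in> B V k p \<Longrightarrow> weak_d V (k - 1) (P \<omega>) \<omega>"
    and "operator_norm V k p P \<le> M"
  shows "\<exists>\<gamma>. form_operator U k p \<gamma> \<and>
    (\<forall>\<omega> \<in> B U k p. weak_d U (k - 1) (\<gamma> \<omega>) \<omega>) \<and>
    operator_norm U k p \<gamma> \<le>
      M * real (CARD('n) - k + 1)
        * C powr ((2 * (p * real k + real CARD('n)) - p) / p)
        * (fact CARD('n) / fact (CARD('n) - k + 1))\<^sup>2"
proof -
  note U = assms(1) and V = assms(2) and k = assms(4,5) and p = assms(6) and P = assms(7)
    and dP = assms(8) and PM = assms(9)
  let ?bound = "M * real (CARD('n) - k + 1) * C powr ((2 * (p * real k + real CARD('n)) - p) / p)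
        * (fact CARD('n) / fact (CARD('n) - k + 1))\<^sup>2"
  have M: "0 \<le> M" by (rule operator_norm_upper(2)[OF P B_zero PM])
  then have bound: "0 \<le> ?bound" by simp
  obtain f g where hom: "homeomorphism U V f g"
    and f: "\<And>x x'. x \<in> U \<Longrightarrow> x' \<in> U \<Longrightarrow> dist (f x) (f x') \<le> C * dist x x'"
    and g: "\<And>y y'. y \<in> V \<Longrightarrow> y' \<in> V \<Longrightarrow> dist (g y) (g y') \<le> C * dist y y'"
    using assms(3) unfolding bi_lipschitz_homeomorphic_def by blast
  have fg: "f x \<in> V" "g (f x) = x" if "x \<in> U" for x
    using hom that by (auto simp: homeomorphism_def)
  have gf: "g y \<in> U" "f (g y) = y" if "y \<in> V" for y
    using hom that by (auto simp: homeomorphism_def)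
  show ?thesis
  proof (cases "U = {}")
    \<comment> \<open>With \<open>U\<close> empty nothing forces \<open>C\<close> to be positive, as
      the charts require. The zero operator does the job, its bound being nonnegative because
      \<open>M\<close> is.\<close>
    case True
    have i0: "integral\<^sup>L (lebesgue_on U) h = 0" for h :: "(real, 'n) vec \<Rightarrow> real"
    proof -
      have "integral\<^sup>L (lebesgue_on U) h = integral\<^sup>L (lebesgue_on U) (\<lambda>x. 0)"
        by (rule Bochner_Integration.integral_cong) (simp_all add: True)
      then show ?thesis by simp
    qed
    have n0: "Omega_norm U p \<omega> = 0" for \<omega> :: "'n form" by (simp add: Omega_norm_def i0)
    have ae: "form_eq U \<alpha> \<beta>" for \<alpha> \<beta> :: "'n form"
      unfolding form_eq_def by (rule AE_I2) (simp add: True)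
    have z: "(\<lambda>x. 0) \<in> Omega U (k - 1) p" by (simp add: Omega_def is_form_def)
    show ?thesis
    proof (intro exI[of _ "\<lambda>\<omega> x. 0"] conjI ballI)
      show "form_operator U k p (\<lambda>\<omega> x. 0)"
        using z by (simp add: form_operator_def ae n0)
      show "weak_d U (k - 1) (\<lambda>x. 0) \<omega>" for \<omega> :: "'n form"
        by (simp add: weak_d_def form_integral_def i0)
      show "operator_norm U k p (\<lambda>\<omega> x. 0) \<le> ?bound"
        by (rule operator_norm_le[OF _ bound]) (simp add: n0)
    qed
  next
    case False
    obtain a b where ab: "a \<in> U" "b \<in> U" "a \<noteq> b" by (rule open_nonempty_two_points[OF U False])
    have C: "0 < C"
    proof -
      have "f a \<noteq> f b" using ab fg by metis
      then have "0 < dist (f a) (f b)" by simp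
      also have "\<dots> \<le> C * dist a b" by (rule f[OF ab(1,2)])
      finally show ?thesis using ab(3) by (simp add: zero_less_mult_iff)
    qed
    obtain F where F: "component_lipschitz C F" "\<And>x. x \<in> U \<Longrightarrow> F x = f x"
      by (rule component_lipschitz_extension[of C U f]) (use C f in \<open>auto simp: dist_norm\<close>)
    obtain H where H: "component_lipschitz C H" "\<And>y. y \<in> V \<Longrightarrow> H y = g y"
      by (rule component_lipschitz_extension[of C V g]) (use C g in \<open>auto simp: dist_norm\<close>)
    obtain G where G: "weak_jacobian C F G" by (rule lipschitz_weak_jacobian[OF F(1)])
    obtain K where K: "weak_jacobian C H K" by (rule lipschitz_weak_jacobian[OF H(1)])
    interpret fw: bilipschitz_chart U V F g G C
      by unfold_locales (use U V C G F(2) fg gf g in auto)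
    interpret bw: bilipschitz_chart V U H f K C
      by unfold_locales (use U V C K H(2) fg gf f in auto)
    have chain: "AE x in lborel. x \<in> U \<longrightarrow> K (F x) ** G x = mat 1"
      by (rule fw.chain_rule[OF K H(2)])
    define \<gamma> where "\<gamma> \<omega> = fw.pb (P (bw.pb \<omega>))" for \<omega>
    have recover: "AE x in lborel. x \<in> U \<longrightarrow> fw.pb (bw.pb \<omega>) x = \<omega> x" for \<omega>
      using chain
    proof (eventually_elim, intro impI)
      fix x assume "x \<in> U \<longrightarrow> K (F x) ** G x = mat 1" and x: "x \<in> U"
      moreover have "H (F x) = x" using F(2)[OF x] H(2)[OF fg(1)[OF x]] fg(2)[OF x] by simp
      ultimately show "fw.pb (bw.pb \<omega>) x = \<omega> x"
        by (simp add: fw.pb_def bw.pb_def pull_pull pull_one)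
    qed
    have bB: "bw.pb \<omega> \<in> B V k p" if "\<omega> \<in> B U k p" for \<omega> by (rule bw.pb_B[OF that k p])
    have PO: "P \<omega> \<in> Omega V (k - 1) p" if "\<omega> \<in> B V k p" for \<omega>
      using P that by (simp add: form_operator_def)
    have BO: "\<omega> \<in> Omega W k p" if "\<omega> \<in> B W k p" for \<omega> and W :: "(real, 'n) vec set"
      using that by (simp add: B_def)
    have k': "k - 1 \<le> CARD('n)" "Suc (k - 1) = k" using k by simp_all
    define c where "c j = fact CARD('n) / fact (CARD('n) - j) * C ^ j * C powr (real CARD('n) / p)"
        for j
    have c0: "0 \<le> c j" for j using C by (simp add: c_def)
    have bnd: "Omega_norm U p (\<gamma> \<omega>) \<le> (c (k - 1) * M * c k) * Omega_norm U p \<omega>" if \<omega>: "\<omega> \<in> B U k p"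
        for \<omega>
    proof -
      have "Omega_norm U p (\<gamma> \<omega>) \<le> c (k - 1) * Omega_norm V p (P (bw.pb \<omega>))"
        unfolding \<gamma>_def c_def by (rule fw.pb_Omega(2)[OF PO[OF bB[OF \<omega>]] k'(1) p])
      also have "\<dots> \<le> c (k - 1) * (M * Omega_norm V p (bw.pb \<omega>))"
        by (intro mult_left_mono c0 operator_norm_upper(1)[OF P bB[OF \<omega>] PM])
      also have "\<dots> \<le> c (k - 1) * (M * (c k * Omega_norm U p \<omega>))"
        unfolding c_def[of k] by (intro mult_left_mono c0 M bw.pb_Omega(2)[OF BO[OF \<omega>] k(2) p])
      finally show ?thesis by (simp add: mult_ac)
    qed
    have const: "c (k - 1) * M * c k = ?bound"
    proof -
      have f1: "fact (CARD('n) - k + 1) = real (CARD('n) - k + 1) * (fact (CARD('n) - k) :: real)"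
          by simp
      have nk: "CARD('n) - (k - 1) = CARD('n) - k + 1" using k by simp
      \<comment> \<open>The exponent splits into the degrees \<open>k - 1\<close> and
        \<open>k\<close> of the two pullbacks and one summand n/p from each change of
        variables.\<close>
      have "(2 * (p * real k + real CARD('n)) - p) / p =
          real (k - 1) + real k + (real CARD('n) / p + real CARD('n) / p)"
        using p k by (simp add: field_simps of_nat_diff)
      then have "C powr ((2 * (p * real k + real CARD('n)) - p) / p) =
          C ^ (k - 1) * C ^ k * (C powr (real CARD('n) / p) * C powr (real CARD('n) / p))"
        by (simp only: powr_add powr_realpow[OF C])
      \<comment> \<open>Here \<open>q = n - k + 1\<close> and \<open>d = (n - k)!\<close>, so
        \<open>q * d\<close> is \<open>(n - k + 1)!\<close>; turning \<open>N / d\<close> into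
        \<open>q * (N / (q * d))\<close> brings out the linear factor of the bound.\<close>
      moreover have "N / (q * d) * a * e * M * (N / d * b * e) =
          M * q * (a * b * (e * e)) * (N / (q * d))\<^sup>2"
        if "q \<noteq> 0" for N q d a b e :: real
        using that by (simp add: power2_eq_square mult_ac)
      ultimately show ?thesis
        unfolding c_def nk f1 by simp
    qed
    have feU: "form_eq U \<alpha> \<beta> \<longleftrightarrow> (AE x in lborel. x \<in> U \<longrightarrow> \<alpha> x = \<beta> x)" for \<alpha> \<beta> :: "'n form"
      unfolding form_eq_def by (rule AE_lebesgue_on_open[OF U])
    have feV: "form_eq V \<alpha> \<beta> \<longleftrightarrow> (AE x in lborel. x \<in> V \<longrightarrow> \<alpha> x = \<beta> x)" for \<alpha> \<beta> :: "'n form"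
      unfolding form_eq_def by (rule AE_lebesgue_on_open[OF V])
    have eqU: "form_eq U (fw.pb \<alpha>) (fw.pb \<beta>)" if "form_eq V \<alpha> \<beta>" for \<alpha> \<beta>
      using fw.AE_pb that unfolding feU feV .
    have eqV: "form_eq V (bw.pb \<alpha>) (bw.pb \<beta>)" if "form_eq U \<alpha> \<beta>" for \<alpha> \<beta>
      using bw.AE_pb that unfolding feU feV .
    have op: "form_operator U k p \<gamma>"
      unfolding form_operator_def
    proof (intro conjI ballI allI impI)
      show "\<gamma> \<omega> \<in> Omega U (k - 1) p" if "\<omega> \<in> B U k p" for \<omega>
        unfolding \<gamma>_def by (rule fw.pb_Omega(1)[OF PO[OF bB[OF that]] k'(1) p])
      show "form_eq U (\<gamma> \<omega>) (\<gamma> \<omega>')" if "\<omega> \<in> B U k p" "\<omega>' \<in> B U k p" "form_eq U \<omega> \<omega>'" for \<omega> \<omega>'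
        unfolding \<gamma>_def using P bB[OF that(1)] bB[OF that(2)] eqV[OF that(3)]
        by (intro eqU) (simp add: form_operator_def)
      show "form_eq U (\<gamma> (\<lambda>x. \<omega> x + \<omega>' x)) (\<lambda>x. \<gamma> \<omega> x + \<gamma> \<omega>' x)" if "\<omega> \<in> B U k p" "\<omega>' \<in> B U k p"
          for \<omega> \<omega>'
      proof -
        have "form_eq V (P (\<lambda>x. bw.pb \<omega> x + bw.pb \<omega>' x)) (\<lambda>x. P (bw.pb \<omega>) x + P (bw.pb \<omega>') x)"
          using P bB[OF that(1)] bB[OF that(2)] by (simp add: form_operator_def)
        from eqU[OF this] show ?thesis by (simp add: \<gamma>_def fw.pb_def bw.pb_def pull_add)
      qed
      show "form_eq U (\<gamma> (\<lambda>x. t *\<^sub>R \<omega> x)) (\<lambda>x. t *\<^sub>R \<gamma> \<omega> x)" if "\<omega> \<in> B U k p" for \<omega> t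
      proof -
        have "form_eq V (P (\<lambda>x. t *\<^sub>R bw.pb \<omega> x)) (\<lambda>x. t *\<^sub>R P (bw.pb \<omega>) x)"
          using P bB[OF that] by (simp add: form_operator_def)
        from eqU[OF this] show ?thesis by (simp add: \<gamma>_def fw.pb_def bw.pb_def pull_scaleR)
      qed
      show "\<exists>K. \<forall>\<omega>\<in>B U k p. Omega_norm U p (\<gamma> \<omega>) \<le> K * Omega_norm U p \<omega>"
        using bnd by blast
    qed
    moreover have "weak_d U (k - 1) (\<gamma> \<omega>) \<omega>" if \<omega>: "\<omega> \<in> B U k p" for \<omega>
    proof -
      have o: "bw.pb \<omega> \<in> Omega V (Suc (k - 1)) p" using BO[OF bB[OF \<omega>]] k'(2) by simp
      \<comment> \<open>The differential obtained is the double pullback, which agrees with \<omega>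
        only almost everywhere; \<open>recover\<close> replaces it.\<close>
      have d: "weak_d U (k - 1) (\<gamma> \<omega>) (fw.pb (bw.pb \<omega>))"
        unfolding \<gamma>_def by (rule fw.pb_weak_d[OF PO[OF bB[OF \<omega>]] o p dP[OF bB[OF \<omega>]]])
      have m: "\<gamma> \<omega> \<in> borel_measurable (lebesgue_on U)" "fw.pb (bw.pb \<omega>) \<in> borel_measurable
          (lebesgue_on U)"
        using fw.pb_Omega(1)[OF PO[OF bB[OF \<omega>]] k'(1) p] fw.pb_Omega(1)[OF BO[OF bB[OF \<omega>]] k(2) p]
        by (simp_all add: \<gamma>_def Omega_def)
      show ?thesis
        by (rule weak_d_cong_AE[OF U m _ recover d]) simp
    qed
    moreover have "operator_norm U k p \<gamma> \<le> ?bound"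
      using bnd bound unfolding const by (intro operator_norm_le)
    ultimately show ?thesis by blast
  qed
qed

end
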